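(* Assume the setting and hypotheses (A1)–(A3) described in the context, and suppose $0<2A<1$. If at least one of the following conditions holds: (a) $\phi(s)$ is entire; (b) $\xi=0$ and all poles of $\phi(s)$ are real; (c) all poles of $\phi(s)$ lie in the half-plane $\mathrm{Re}\,s<\vartheta_0$, where $\vartheta_0:=1-\vartheta+1/(2A)$; then for all sufficiently large $n$ we have $\lambda_{n+1}-\lambda_n\ll\lambda_n^{1-1/(2A)}$, where the implied constant is independent of $n$.
   Context: Let $(a_n)_{n\ge1},(b_n)_{n\ge1}$ be complex sequences with $a_1\ne0$, $b_1\ne0$, and let $(\lambda_n),(\mu_n)$ be strictly increasing sequences of positive reals tending to $\infty$. Assume: (A1) $\phi(s):=\sum_{n\ge1}a_n\lambda_n^{-s}$ and $\psi(s):=\sum_{n\ge1}b_n\mu_n^{-s}$ converge absolutely for $\mathrm{Re}\,s\ge\sigma^*$, for some constant $\sigma^*>0$. (A2) There are $d\ge1$, $\alpha_\nu>0$ and $\beta_\nu,\widetilde\beta_\nu\in\mathbb C$ ($1\le\nu\le d$) such that, with $\Delta(s):=\prod_{\nu=1}^d\Gamma(\alpha_\nu s+\beta_\nu)$ and $\widetilde\Delta(s):=\prod_{\nu=1}^d\Gamma(\alpha_\nu s+\widetilde\beta_\nu)$, one has $\Delta(s)\phi(s)=\omega\widetilde\Delta(1-s)\psi(1-s)$ for some $\omega\in\mathbb C$ with $|\omega|=1$. (A3) $\Delta(s)\phi(s)$ extends meromorphically to $\mathbb C$; all its singularities lie in a disk $|z|<R$ for some $R>0$; and $\Delta(\sigma+it)\phi(\sigma+it)\to0$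 uniformly in every vertical strip $b\le\sigma\le b'$ as $|t|\to\infty$. Notation: $A:=\sum\alpha_\nu$, $B:=\sum\beta_\nu$, $\widetilde B:=\sum\widetilde\beta_\nu$, and $\frac{1}{4A}-\frac12-\frac{B-\widetilde B}{2A}=:-\vartheta+i\xi$ with $\vartheta,\xi\in\mathbb R$. *)

theory Defs
  imports "HOL-Complex_Analysis.Complex_Analysis"
begin

definition gen_dirichlet :: "(nat \<Rightarrow> complex) \<Rightarrow> (nat \<Rightarrow> real) \<Rightarrow> complex \<Rightarrow> complex" where
  "gen_dirichlet a lam s = (\<Sum>n. a n * complex_of_real (lam n) powr (- s))"

definition gamma_factor :: "nat \<Rightarrow> (nat \<Rightarrow> real) \<Rightarrow> (nat \<Rightarrow> complex) \<Rightarrow> complex \<Rightarrow> complex" where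
  "gamma_factor d alpha beta s = (\<Prod>\<nu>=1..d. Gamma (complex_of_real (alpha \<nu>) * s + beta \<nu>))"

definition gamma_regular :: "nat \<Rightarrow> (nat \<Rightarrow> real) \<Rightarrow> (nat \<Rightarrow> complex) \<Rightarrow> complex \<Rightarrow> bool" where
  "gamma_regular d alpha beta s = (\<forall>\<nu>\<in>{1..d}. complex_of_real (alpha \<nu>) * s + beta \<nu> \<notin> \<int>\<^sub>\<le>\<^sub>0)"

end

theory Submission
  imports Defs
begin

text \<open>
  Put \<open>\<kappa>\<^sub>n = \<lambda>\<^sub>n\<^bsup>1/(2A)\<^esup>\<close>; since \<open>2A < 1\<close>, concavity of \<open>x \<mapsto> x\<^bsup>2A\<^esup>\<close> reduces the claim to the
  boundedness of \<open>\<kappa>\<^sub>n\<^sub>+\<^sub>1 - \<kappa>\<^sub>n\<close>. Test the coefficients \<open>a\<^sub>n\<close> against a spline living on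
  \<open>[T, T e\<^bsup>N\<eta>/T\<^esup>]\<close> in the \<open>\<kappa>\<close> scale: the result is zero if that interval lies in a gap. The
  spline has so many vanishing moments that, when its Mellin integral is moved far to the left, the
  poles of \<open>\<phi>\<close> contribute a negligible amount. There the functional equation applies, and by
  Stirling's formula the quotient of the Gamma factors is \<open>\<Gamma>(2Au + g)\<close> times exponentials up to a
  relative error \<open>O(1/|u|)\<close>, and the inverse Mellin transform of that main term is an oscillating
  exponential. Hence in a gap the almost periodic function
  \<open>\<Sum> p\<^sub>n e\<^bsup>i\<nu>\<^sub>nT\<^esup> + q\<^sub>n e\<^bsup>-i\<nu>\<^sub>nT\<^esup>\<close>, whose frequencies \<open>\<nu>\<^sub>n\<close> are a constant multiple of \<open>\<mu>\<^sub>n\<^bsup>1/(2A)\<^esup>\<close>, is \<open>o(1)\<close>.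
  Arbitrarily long gaps would make its mean value \<open>p\<^sub>0\<close> vanish, contradicting \<open>b\<^sub>0 \<noteq> 0\<close>.
\<close>

subsection \<open>Stirling's formula on vertical lines\<close>

text \<open>Each parameter of the kernel (exp (h s) - 1)^N / s^M answers one obstacle. On Re s = -c
  the quotient of the Gamma factors grows like a power of |t| that increases with c;
  \<open>M\<close> divides this growth out, and c is then fixed by Re (2 A u + g) = -3/4, so that
  all integrals converge absolutely although the exponential weight cancels the whole exponential
  decay of Gamma. With h of order 1/T the poles contribute O(T^(2 A R - N)), while the main term has
  size T^(Re g); hence \<open>N\<close> must exceed 2 A R - Re g. The step h = 2 A \<eta> / T sends
  T to T exp (\<eta>/T), about T + \<eta>, so the N-fold multiplicative difference becomes an
  additive one: it multiplies the term of frequency \<nu> by (exp (i \<nu> \<eta>) - 1)^N and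
  removes the constant left by the pole of Gamma at 0, up to O(1/T). The choice \<eta> = pi /
  \<nu>_0 keeps this factor from vanishing at the lowest frequency. The error in Stirling's formula
  is beaten by a margin of T^(-1/4) only.\<close>

lemma Ln_add_1_expansion:
  assumes "norm (w::complex) \<le> 1 / 2"
  shows "norm (Ln (1 + w) - (w - w\<^sup>2 / 2)) \<le> 8 * norm w ^ 3"
proof -
  define f :: "nat \<Rightarrow> complex \<Rightarrow> complex" where
    "f i = (if i = 0 then (\<lambda>x. Ln (1 + x)) else if i = 1 then (\<lambda>x. inverse (1 + x))
      else if i = 2 then (\<lambda>x. - (inverse (1 + x) ^ 2)) else (\<lambda>x. 2 * inverse (1 + x) ^ 3))" for i
  have half: "norm (1 + x) \<ge> 1 / 2" "Re (1 + x) > 0" if "x \<in> cball 0 (1/2)" for x :: complex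
  proof -
    have n: "norm x \<le> 1 / 2" using that by simp
    show "norm (1 + x) \<ge> 1 / 2" using norm_triangle_ineq2[of 1 "-x"] n by simp
    show "Re (1 + x) > 0" using n abs_Re_le_cmod[of x] by simp
  qed
  \<comment> \<open>16 bounds the third derivative 2/(1 + x)^3, as |1 + x| is at least 1/2 on the
    disc; \<open>complex_Taylor\<close> divides by 2!, not 3!, whence the 8.\<close>
  have "norm (f 0 w - (\<Sum>i\<le>2. f i 0 * (w - 0) ^ i / fact i)) \<le> 16 * norm (w - 0) ^ Suc 2 / fact 2"
  proof (rule complex_Taylor[where S = "cball 0 (1/2)"])
    fix i x assume x: "x \<in> cball (0::complex) (1/2)" and i: "i \<le> (2::nat)"
    have nz: "1 + x \<noteq> 0" using half(1)[OF x] by auto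
    have nn: "1 + x \<notin> \<real>\<^sub>\<le>\<^sub>0" using half(2)[OF x] by (auto simp: complex_nonpos_Reals_iff)
    consider "i = 0" | "i = 1" | "i = 2" using i by linarith
    then show "(f i has_field_derivative f (Suc i) x) (at x within cball 0 (1/2))"
    proof cases
      case 1 show ?thesis unfolding 1 f_def using nn
        by (auto intro!: derivative_eq_intros simp: field_simps)
    next
      case 2 show ?thesis unfolding 2 f_def using nz
        by (auto intro!: derivative_eq_intros simp: field_simps power2_eq_square)
    next
      case 3
      have "((\<lambda>x. - (inverse (1 + x) ^ 2)) has_field_derivative 2 * inverse (1 + x) ^ 3) (at x within cball 0 (1/2))"
        using nz by (auto intro!: derivative_eq_intros simp: power2_eq_square power3_eq_cube)
      then show ?thesis unfolding 3 f_def by simp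
    qed
  next
    fix x assume x: "x \<in> cball (0::complex) (1/2)"
    have "norm (inverse (1 + x)) \<le> 2"
      using half(1)[OF x] le_imp_inverse_le[OF half(1)[OF x]] by (simp add: norm_inverse)
    from power_mono[OF this, of 3] show "norm (f (Suc 2) x) \<le> 16"
      by (simp add: f_def norm_mult norm_power)
  qed (use assms in auto)
  then show ?thesis
    by (simp add: f_def numeral_2_eq_2 algebra_simps power_numeral_reduce)
qed

text \<open>The 1/2 makes the increment summable along z, z + 1, ...: with w = 1/z, the product (1/w
  + 1/2) (w - w^2/2) equals 1 - w^2/4, so the first-order term cancels. The constant 11 is 1/4 + 10
  rounded up.\<close>

lemma stirling_increment_bound:
  assumes "norm (z::complex) \<ge> 2"
  shows "norm ((z + 1/2) * Ln (1 + 1/z) - 1) \<le> 11 / norm z ^ 2"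
proof -
  define w where "w = 1 / z"
  define \<rho> where "\<rho> = Ln (1 + w) - (w - w\<^sup>2 / 2)"
  have z0: "z \<noteq> 0" using assms by auto
  have w: "norm w \<le> 1 / 2" using assms z0 by (simp add: w_def norm_divide divide_le_eq)
  have r: "norm \<rho> \<le> 8 * norm w ^ 3" unfolding \<rho>_def by (rule Ln_add_1_expansion[OF w])
  have w0: "w \<noteq> 0" using z0 by (simp add: w_def)
  have "(z + 1/2) * Ln (1 + 1/z) - 1 = (1/w + 1/2) * (w - w\<^sup>2/2 + \<rho>) - 1"
    using z0 by (simp add: \<rho>_def w_def)
  also have "\<dots> = - w\<^sup>2 / 4 + (1/w + 1/2) * \<rho>"
    using w0 by (simp add: field_simps power2_eq_square)
  finally have eq: "(z + 1/2) * Ln (1 + 1/z) - 1 = - w\<^sup>2 / 4 + (1/w + 1/2) * \<rho>" .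
  have "norm ((1/w + 1/2) * \<rho>) \<le> (1 / norm w + 1/2) * (8 * norm w ^ 3)"
    unfolding norm_mult
    by (intro mult_mono r order.trans[OF norm_triangle_ineq]) (auto simp: norm_divide)
  also have "\<dots> = 8 * norm w ^ 2 + 4 * norm w * norm w ^ 2"
    using w0 by (simp add: field_simps power2_eq_square power3_eq_cube)
  also have "\<dots> \<le> 8 * norm w ^ 2 + 2 * norm w ^ 2"
    using w by (intro add_mono mult_right_mono) auto
  finally have "norm (- w\<^sup>2 / 4 + (1/w + 1/2) * \<rho>) \<le> norm w ^ 2 / 4 + 10 * norm w ^ 2"
    by (intro order.trans[OF norm_triangle_ineq]) (auto simp: norm_divide norm_power)
  also have "\<dots> \<le> 11 * norm w ^ 2" by simp
  also have "\<dots> = 11 / norm z ^ 2" by (simp add: w_def norm_divide power_divide)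
  finally show ?thesis unfolding eq .
qed

text \<open>Adding 1 stays in the same open half-plane or on the positive axis, so the arguments of
  z and z + 1 differ by less than pi and no multiple of 2 pi i appears.\<close>

lemma Ln_add_1_eq:
  assumes "Im z \<noteq> 0 \<or> Re z > 0"
  shows "Ln (z + 1) = Ln z + Ln (1 + 1 / z)"
proof -
  have z: "z \<noteq> 0" "z + 1 \<noteq> 0" using assms by (auto simp: complex_eq_iff)
  have "-pi < Im (Ln (z + 1) - Ln z) \<and> Im (Ln (z + 1) - Ln z) < pi"
  proof -
    consider "Im z > 0" | "Im z < 0" | "Im z = 0" "Re z > 0" using assms by linarith
    then show ?thesis
    proof cases
      case 1 then show ?thesis using Im_Ln_pos_lt[OF z(1)] Im_Ln_pos_lt[OF z(2)] by auto
    next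
      case 2
      have "Im (Ln z) < 0" "Im (Ln (z + 1)) < 0"
        using Im_Ln_pos_le[OF z(1)] Im_Ln_pos_le[OF z(2)] 2 mpi_less_Im_Ln[OF z(1)] Im_Ln_le_pi[OF z(1)]
          mpi_less_Im_Ln[OF z(2)] Im_Ln_le_pi[OF z(2)] by auto
      then show ?thesis using mpi_less_Im_Ln[OF z(1)] mpi_less_Im_Ln[OF z(2)] by auto
    next
      case 3
      then have "Im (Ln z) = 0" "Im (Ln (z + 1)) = 0" 
        using Im_Ln_eq_0[OF z(1)] Im_Ln_eq_0[OF z(2)] by auto
      then show ?thesis by simp
    qed
  qed
  moreover have "exp (Ln (z + 1) - Ln z) = 1 + 1 / z"
    using z by (simp add: exp_diff field_simps)
  ultimately have "Ln (1 + 1 / z) = Ln (z + 1) - Ln z" by (intro Ln_unique) auto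
  then show ?thesis by simp
qed

lemma of_nat_mult_Ln_tendsto: "(\<lambda>n. of_nat n * Ln (1 + z / of_nat n)) \<longlonglongrightarrow> (z::complex)"
proof (rule Lim_transform_eventually)
  have ev: "eventually (\<lambda>n. norm (of_nat n * Ln (1 + z / of_nat n) - z) \<le> 2 * norm z ^ 2 / real n) sequentially"
  proof -
    obtain N where N: "real N > 2 * norm z + 1" using reals_Archimedean2 by blast
    show ?thesis
    proof (rule eventually_sequentiallyI[of N])
      fix n assume "n \<ge> N"
      then have n: "real n > 2 * norm z" "real n > 0" using N by (smt (verit) of_nat_mono norm_ge_zero)+
      have w: "norm (z / of_nat n) \<le> 1/2" using n by (simp add: norm_divide field_simps)
      have "norm (Ln (1 + z / of_nat n) - z / of_nat n) \<le> norm (z / of_nat n)^2 / (1 - norm (z / of_nat n))"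
        by (rule Ln_approx_linear) (use w in simp)
      also have "\<dots> \<le> norm (z / of_nat n)^2 / (1/2)" using w by (intro divide_left_mono) auto
      finally have "norm (of_nat n :: complex) * norm (Ln (1 + z / of_nat n) - z / of_nat n) \<le> real n * (2 * norm (z / of_nat n)^2)"
        by (intro mult_mono) auto
      also have "\<dots> = 2 * norm z ^ 2 / real n" using n by (simp add: norm_divide field_simps power2_eq_square)
      also have "norm (of_nat n :: complex) * norm (Ln (1 + z / of_nat n) - z / of_nat n) = norm (of_nat n * Ln (1 + z / of_nat n) - z)"
        unfolding norm_mult[symmetric] right_diff_distrib using n by simp
      finally show "norm (of_nat n * Ln (1 + z / of_nat n) - z) \<le> 2 * norm z ^ 2 / real n" .
    qed
  qed
  have "(\<lambda>n. of_nat n * Ln (1 + z / of_nat n) - z) \<longlonglongrightarrow> 0"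
    by (rule Lim_null_comparison[OF ev]) (rule lim_const_over_n)
  then show "(\<lambda>n. (of_nat n * Ln (1 + z / of_nat n) - z) + z) \<longlonglongrightarrow> z"
    using tendsto_add[OF _ tendsto_const[of z]] by fastforce
qed (auto)

text \<open>Gamma divided by Stirling's main term z^(z - 1/2) e^(-z). The constant sqrt (2 pi) is
  left out; it reappears only as an unidentified limit \<open>exp c\<close>.\<close>

definition stirling_ratio :: "complex \<Rightarrow> complex" where
  "stirling_ratio z = Gamma z * exp (z - (z - 1/2) * Ln z)"

lemma stirling_ratio_step:
  assumes "Im z \<noteq> 0 \<or> Re z > 0"
  shows "stirling_ratio z = stirling_ratio (z + 1) * exp ((z + 1/2) * Ln (1 + 1/z) - 1)"
proof -
  have z: "z \<noteq> 0" using assms by auto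
  have "z \<notin> \<int>\<^sub>\<le>\<^sub>0" using assms by (auto elim!: nonpos_Ints_cases)
  then have G: "Gamma (z + 1) = z * Gamma z" by (rule Gamma_plus1)
  have "stirling_ratio (z + 1) * exp ((z + 1/2) * Ln (1 + 1/z) - 1)
     = Gamma z * exp (Ln z) * exp (z + 1 - (z + 1/2) * (Ln z + Ln (1 + 1/z))) * exp ((z + 1/2) * Ln (1 + 1/z) - 1)"
    using z by (simp add: stirling_ratio_def G Ln_add_1_eq[OF assms] add.commute[of "1/2"] mult.commute[of z])
  also have "\<dots> = Gamma z * exp (Ln z + (z + 1 - (z + 1/2) * (Ln z + Ln (1 + 1/z))) + ((z + 1/2) * Ln (1 + 1/z) - 1))"
    by (simp only: exp_add mult.assoc)
  also have "Ln z + (z + 1 - (z + 1/2) * (Ln z + Ln (1 + 1/z))) + ((z + 1/2) * Ln (1 + 1/z) - 1) = z - (z - 1/2) * Ln z"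
    by (simp add: algebra_simps)
  finally show ?thesis by (simp add: stirling_ratio_def)
qed

lemma stirling_ratio_iterate:
  assumes "Im z \<noteq> 0 \<or> Re z > 0"
  shows "stirling_ratio z = stirling_ratio (z + of_nat n) *
    exp (\<Sum>k<n. ((z + of_nat k) + 1/2) * Ln (1 + 1/(z + of_nat k)) - 1)"
proof (induction n)
  case (Suc n)
  have "stirling_ratio (z + of_nat n) = stirling_ratio (z + of_nat n + 1) * 
     exp (((z + of_nat n) + 1/2) * Ln (1 + 1/(z + of_nat n)) - 1)"
    by (rule stirling_ratio_step) (use assms in auto)
  then show ?case using Suc by (simp add: exp_add ac_simps)
qed auto

text \<open>Telescoping from 1 turns the ratio into the exponential of a convergent series. Writing
  the limit as \<open>exp c\<close> shows that it is nonzero and lets \<open>c\<close> be merged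
  into the exponent later.\<close>

lemma stirling_ratio_of_nat_tendsto:
  "\<exists>c. (\<lambda>n. stirling_ratio (of_nat n)) \<longlonglongrightarrow> exp c"
proof -
  define e where "e k = ((1 + of_nat k) + 1/2) * Ln (1 + 1/(1 + of_nat k)) - (1::complex)" for k :: nat
  have "summable e"
  proof (rule summable_comparison_test_ev)
    show "eventually (\<lambda>k. norm (e k) \<le> 11 * inverse (real (Suc k) ^ 2)) sequentially"
    proof (rule eventually_sequentiallyI[of 1])
      fix k :: nat assume "k \<ge> 1"
      have nk: "norm (1 + of_nat k :: complex) = real (Suc k)"
        by (metis norm_of_nat of_nat_Suc)
      have "norm (e k) \<le> 11 / norm (1 + of_nat k :: complex) ^ 2"
        unfolding e_def by (rule stirling_increment_bound) (use \<open>k \<ge> 1\<close> nk in simp)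
      then show "norm (e k) \<le> 11 * inverse (real (Suc k) ^ 2)" by (simp only: nk divide_inverse)
    qed
    show "summable (\<lambda>k. 11 * inverse (real (Suc k) ^ 2))"
      using summable_Suc_iff[of "\<lambda>n. inverse (real n ^ 2)"] inverse_power_summable[of 2, where 'a = real]
      by (intro summable_mult) auto
  qed
  then have lim: "(\<lambda>n. exp (- (\<Sum>k<n. e k))) \<longlonglongrightarrow> exp (- (\<Sum>k. e k))"
    by (intro tendsto_intros summable_LIMSEQ)
  have S: "stirling_ratio (of_nat (Suc n)) = exp 1 * exp (- (\<Sum>k<n. e k))" for n
  proof -
    have "stirling_ratio 1 = stirling_ratio (1 + of_nat n) * exp (\<Sum>k<n. e k)"
      unfolding e_def by (rule stirling_ratio_iterate) simp
    then show ?thesis by (simp add: stirling_ratio_def exp_minus field_simps)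
  qed
  have "(\<lambda>n. stirling_ratio (of_nat (Suc n))) \<longlonglongrightarrow> exp 1 * exp (- (\<Sum>k. e k))"
    unfolding S by (intro tendsto_intros lim)
  then have "(\<lambda>n. stirling_ratio (of_nat n)) \<longlonglongrightarrow> exp (1 - (\<Sum>k. e k))"
    by (subst (asm) filterlim_sequentially_Suc) (simp add: exp_diff exp_minus field_simps)
  then show ?thesis by blast
qed

text \<open>Gauss's limit for Gamma compares Gamma (z + n) with Gamma n * n^z, and n Ln (1 + z/n) ->
  z takes care of the elementary factors; so every translate inherits the limit found along the
  integers.\<close>

lemma stirling_ratio_shift_tendsto:
  assumes "z \<notin> \<int>\<^sub>\<le>\<^sub>0" and c: "(\<lambda>n. stirling_ratio (of_nat n)) \<longlonglongrightarrow> exp c"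
  shows "(\<lambda>n. stirling_ratio (z + of_nat n)) \<longlonglongrightarrow> exp c"
proof -
  have G: "(\<lambda>n. Gamma z / Gamma_series' z n) \<longlonglongrightarrow> 1"
    using tendsto_divide[OF tendsto_const[of "Gamma z"] Gamma_series'_LIMSEQ[of z]] assms(1)
    by (auto simp: Gamma_eq_zero_iff)
  have z0: "(\<lambda>n. z / of_nat n) \<longlonglongrightarrow> 0" by (rule lim_const_over_n)
  have L0: "(\<lambda>n. Ln (1 + z / of_nat n)) \<longlonglongrightarrow> Ln (1 + 0)"
    by (intro tendsto_intros z0) auto
  have "(\<lambda>n. z - ((z - 1/2) * Ln (1 + z / of_nat n) + of_nat n * Ln (1 + z / of_nat n))) \<longlonglongrightarrow> z - ((z - 1/2) * Ln (1+0) + z)"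
    by (intro tendsto_intros L0 of_nat_mult_Ln_tendsto)
  then have "(\<lambda>n. exp (z - ((z - 1/2) * Ln (1 + z / of_nat n) + of_nat n * Ln (1 + z / of_nat n)))) \<longlonglongrightarrow> exp 0"
    by (intro tendsto_exp) simp
  from tendsto_mult[OF tendsto_mult[OF c G] this]
  have lim: "(\<lambda>n. stirling_ratio (of_nat n) * (Gamma z / Gamma_series' z n) *
      exp (z - ((z - 1/2) * Ln (1 + z / of_nat n) + of_nat n * Ln (1 + z / of_nat n)))) \<longlonglongrightarrow> exp c" by simp
  \<comment> \<open>For such n the number 1 + z/n has positive real part, so Ln (z + n) splits into
    ln n + Ln (1 + z/n).\<close>
  obtain N where N: "real N > norm z + 1" using reals_Archimedean2 by blast
  show ?thesis
  proof (rule Lim_transform_eventually[OF lim], rule eventually_sequentiallyI[of N])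
    fix n assume "n \<ge> N"
    then have n: "real n > norm z + 1" using N by (auto intro: order.strict_trans2)
    have n0: "n > 0" using n norm_ge_zero[of z] by (cases n) (auto simp del: norm_ge_zero)
    have "norm (z / of_nat n) < 1" using n n0 by (auto simp: norm_divide field_simps intro: order.strict_trans[OF _ n])
    then have re: "Re (1 + z / of_nat n) > 0" using abs_Re_le_cmod[of "z / of_nat n"] by (simp only: plus_complex.sel one_complex.sel)
    have "z + of_nat n = of_nat n * (1 + z / of_nat n)" using n0 by (simp add: field_simps)
    also have "Ln \<dots> = ln (real n) + Ln (1 + z / of_nat n)"
      using Ln_times_of_real[of "real n" "1 + z / of_nat n"] re n0 by fastforce
    finally have L: "Ln (z + of_nat n) = ln (real n) + Ln (1 + z / of_nat n)" .
    have Lr: "Ln (of_nat n) = of_real (ln (real n))" using n0 by (metis Ln_of_nat of_nat_0_less_iff)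
    have gs: "Gamma z / Gamma_series' z n = Gamma (z + of_nat n) / (Gamma (of_nat n) * exp (z * of_real (ln (real n))))"
    proof -
      have "Gamma (of_nat n :: complex) = fact (n - 1)" using n0 Gamma_fact[of "n-1", where 'a = complex] by (cases n) auto
      then show ?thesis using assms(1)
        by (simp add: Gamma_series'_def pochhammer_Gamma[OF assms(1)] Gamma_eq_zero_iff)
    qed
    have "stirling_ratio (of_nat n) * (Gamma z / Gamma_series' z n) *
      exp (z - ((z - 1/2) * Ln (1 + z / of_nat n) + of_nat n * Ln (1 + z / of_nat n)))
     = Gamma (z + of_nat n) * (exp (of_nat n - (of_nat n - 1/2) * of_real (ln (real n))) / exp (z * of_real (ln (real n)))
      * exp (z - ((z - 1/2) * Ln (1 + z / of_nat n) + of_nat n * Ln (1 + z / of_nat n))))"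
      using n0 by (simp add: stirling_ratio_def gs Lr Gamma_eq_zero_iff of_nat_in_nonpos_Ints_iff)
    also have "\<dots> = stirling_ratio (z + of_nat n)"
      unfolding stirling_ratio_def L by (simp flip: exp_diff exp_add) (simp add: algebra_simps)
    finally show "stirling_ratio (of_nat n) * (Gamma z / Gamma_series' z n) *
      exp (z - ((z - 1/2) * Ln (1 + z / of_nat n) + of_nat n * Ln (1 + z / of_nat n))) = stirling_ratio (z + of_nat n)" .
  qed
qed

lemma sum_inverse_square_shift_le:
  assumes "x > (1::real)"
  shows "(\<Sum>k<n. 1 / (x + real k)^2) \<le> 1 / (x - 1)"
proof -
  have "(\<Sum>k<n. 1 / (x + real k)^2) \<le> 1 / (x - 1) - 1 / (x - 1 + real n)"
  proof (induction n)
    case (Suc n)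
    have "1 / (x + real n)^2 \<le> 1 / ((x - 1 + real n) * (x + real n))"
      unfolding power2_eq_square using assms by (intro divide_left_mono mult_right_mono mult_pos_pos) auto
    also have "\<dots> = 1 / (x - 1 + real n) - 1 / (x + real n)" using assms by (simp add: field_simps)
    finally show ?case using Suc by (simp add: algebra_simps)
  qed auto
  also have "\<dots> \<le> 1 / (x - 1)" using assms by simp
  finally show ?thesis .
qed

text \<open>Run the recurrence along z, z + 1, ... to infinity, where the ratio is
  \<open>exp c\<close>; the error \<open>r\<close> is the sum of all increments. Measuring it by |Im
  z| makes it uniform in the whole half-plane Re z \<ge> -m.\<close>

theorem Gamma_stirling:
  "\<exists>c. \<forall>m\<ge>0. \<forall>z. Re z \<ge> - m \<and> \<bar>Im z\<bar> \<ge> 2 * m + 2 \<longrightarrow>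
     (\<exists>r. norm r \<le> 44 / \<bar>Im z\<bar> \<and> Gamma z = exp (c + (z - 1/2) * Ln z - z + r))"
proof -
  obtain c where c: "(\<lambda>n. stirling_ratio (of_nat n)) \<longlonglongrightarrow> exp c"
    using stirling_ratio_of_nat_tendsto by blast
  show ?thesis
  proof (rule exI[of _ c], intro allI impI)
    fix m :: real and z :: complex assume m: "m \<ge> 0" and "Re z \<ge> - m \<and> \<bar>Im z\<bar> \<ge> 2 * m + 2"
    then have z: "Re z \<ge> - m" "\<bar>Im z\<bar> \<ge> 2 * m + 2" by auto
    define e where "e k = ((z + of_nat k) + 1/2) * Ln (1 + 1/(z + of_nat k)) - 1" for k :: nat
    \<comment> \<open>Since Re z + k \<ge> k - m, the number x + k is at most |Im z| + |Re z + k|,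
      hence at most sqrt 2 * |z + k|. The hypothesis |Im z| \<ge> 2 m + 2 gives x - 1 \<ge> |Im z| /
      2, which turns 22/(x - 1) into 44/|Im z|.\<close>
    define x where "x = \<bar>Im z\<bar> - m"
    have x: "x > 1" "x \<ge> \<bar>Im z\<bar> / 2 + 1" using z m by (auto simp: x_def)
    have im: "Im z \<noteq> 0" using z m by auto
    have zk: "norm (z + of_nat k) \<ge> 2" for k
      using abs_Im_le_cmod[of "z + of_nat k"] z m by auto
    have ek: "norm (e k) \<le> 22 * (1 / (x + real k)^2)" for k
    proof -
      have "norm (e k) \<le> 11 / norm (z + of_nat k)^2"
        unfolding e_def by (rule stirling_increment_bound[OF zk])
      also have "(x + real k)^2 \<le> (\<bar>Im z\<bar> + \<bar>Re z + real k\<bar>)^2"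
        using z x unfolding x_def by (intro power_mono) auto
      then have "(x + real k)^2 \<le> 2 * norm (z + of_nat k)^2"
        using arith_geo_mean_sqrt[of "(Im z)^2" "(Re z + real k)^2"] sum_squares_bound[of "\<bar>Im z\<bar>" "\<bar>Re z + real k\<bar>"]
        by (simp add: cmod_power2 power2_sum)
      then have "11 / norm (z + of_nat k)^2 \<le> 11 / ((x + real k)^2 / 2)"
        using x zk[of k] by (intro divide_left_mono) (auto intro!: mult_pos_pos)
      finally show ?thesis by (simp add: field_simps)
    qed
    have bound: "norm (\<Sum>k<n. e k) \<le> 44 / \<bar>Im z\<bar>" for n
    proof -
      have "norm (\<Sum>k<n. e k) \<le> (\<Sum>k<n. 22 * (1 / (x + real k)^2))" by (intro sum_norm_le ek)
      also have "\<dots> \<le> 22 * (1 / (x - 1))"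
        unfolding sum_distrib_left[symmetric] by (intro mult_left_mono sum_inverse_square_shift_le x) auto
      also have "\<dots> \<le> 22 * (1 / (\<bar>Im z\<bar> / 2))"
        using x im by (intro mult_left_mono divide_left_mono) auto
      finally show ?thesis by simp
    qed
    have "summable e"
    proof (rule summable_norm_cancel, rule bounded_imp_summable)
      show "(\<Sum>k\<le>n. norm (e k)) \<le> 22 * (1 / (x - 1))" for n
      proof -
        have "(\<Sum>k\<le>n. norm (e k)) \<le> (\<Sum>k<Suc n. 22 * (1 / (x + real k)^2))"
          unfolding lessThan_Suc_atMost by (intro sum_mono ek)
        also have "\<dots> \<le> 22 * (1 / (x - 1))"
          unfolding sum_distrib_left[symmetric] by (intro mult_left_mono sum_inverse_square_shift_le x) auto
        finally show ?thesis .
      qed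
    qed auto
    then have se: "(\<lambda>n. \<Sum>k<n. e k) \<longlonglongrightarrow> suminf e" by (rule summable_LIMSEQ)
    have "z \<notin> \<int>\<^sub>\<le>\<^sub>0" using im by (auto elim!: nonpos_Ints_cases)
    from tendsto_mult[OF stirling_ratio_shift_tendsto[OF this c] tendsto_exp[OF se]]
    have "(\<lambda>n. stirling_ratio z) \<longlonglongrightarrow> exp c * exp (suminf e)"
      using stirling_ratio_iterate[of z] im unfolding e_def by simp
    then have "stirling_ratio z = exp c * exp (suminf e)" by (simp add: LIMSEQ_const_iff)
    then have "Gamma z = exp c * exp (suminf e) / exp (z - (z - 1/2) * Ln z)"
      unfolding stirling_ratio_def by (simp add: field_simps)
    then have "Gamma z = exp (c + (z - 1/2) * Ln z - z + suminf e)"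
      by (simp flip: exp_add exp_diff) (simp add: algebra_simps)
    moreover have "norm (suminf e) \<le> 44 / \<bar>Im z\<bar>"
      by (rule LIMSEQ_le_const2[OF tendsto_norm[OF se]]) (use bound in auto)
    ultimately show "\<exists>r. norm r \<le> 44 / \<bar>Im z\<bar> \<and> Gamma z = exp (c + (z - 1/2) * Ln z - z + r)" by auto
  qed
qed

section \<open>Size of Gamma and 1/Gamma in vertical strips\<close>

lemma norm_Gamma_vertical_le:
  fixes m :: real assumes "m \<ge> 0"
  shows "\<exists>K>0. \<forall>z. \<bar>Re z\<bar> \<le> m \<and> \<bar>Im z\<bar> \<ge> 2 * m + 2 \<longrightarrow>
    norm (Gamma z) \<le> K * \<bar>Im z\<bar> powr (Re z - 1/2) * exp (- pi * \<bar>Im z\<bar> / 2)"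
proof -
  obtain c where c: "\<And>z. Re z \<ge> - m \<Longrightarrow> \<bar>Im z\<bar> \<ge> 2 * m + 2 \<Longrightarrow>
     (\<exists>r. norm r \<le> 44 / \<bar>Im z\<bar> \<and> Gamma z = exp (c + (z - 1/2) * Ln z - z + r))"
    using Gamma_stirling assms by blast
  define K where "K = exp (\<bar>Re c\<bar> + 2 * m + 22) * (1 + m) powr (m + 1/2)"
  have pos: "norm (Gamma z) \<le> K * \<bar>Im z\<bar> powr (Re z - 1/2) * exp (- pi * \<bar>Im z\<bar> / 2)"
    if z: "\<bar>Re z\<bar> \<le> m" "Im z \<ge> 2 * m + 2" for z
  proof -
    have t2: "Im z \<ge> 2" using z assms by simp
    have z0: "z \<noteq> 0" using t2 by auto
    obtain r where r: "norm r \<le> 44 / \<bar>Im z\<bar>" "Gamma z = exp (c + (z - 1/2) * Ln z - z + r)"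
      using c[of z] z abs_le_D2[of "Re z" m] minus_le_iff[of m "Re z"] by fastforce
    have r22: "norm r \<le> 22"
    proof -
      have "44 / \<bar>Im z\<bar> \<le> 44 / 2" using t2 by (intro divide_left_mono) auto
      then show ?thesis using r(1) by simp
    qed
    \<comment> \<open>After a quarter turn \<open>v\<close> lies in the right half-plane, where its
      argument is an arctangent of size at most m / Im z. So Im z times the argument of z is pi Im z
      / 2 up to an error m, which produces the factor exp (- pi |Im z| / 2).\<close>
    define v where "v = Complex (Im z) (- Re z)"
    have zv: "z = \<i> * v" by (simp add: v_def complex_eq_iff)
    have v0: "v \<noteq> 0" using z0 zv by auto
    have "Ln z = Ln v + \<i> * of_real pi / 2" using Ln_times_ii[OF v0] t2 unfolding zv by (auto simp: v_def)
    then have "Im (Ln z) = Im (Ln v) + pi / 2" by simp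
    moreover have "\<bar>Im (Ln v)\<bar> \<le> m / Im z"
    proof -
      have "Im (Ln v) = arctan (Im v / Re v)" using Im_Ln_eq[OF v0] t2 by (simp add: v_def)
      then have "\<bar>Im (Ln v)\<bar> \<le> \<bar>Im v / Re v\<bar>" by (simp only: abs_arctan_le)
      also have "\<dots> \<le> m / Im z" using t2 z by (auto simp: v_def intro: divide_right_mono)
      finally show ?thesis .
    qed
    ultimately have A: "Im z * Im (Ln z) \<ge> pi * Im z / 2 - m"
    proof -
      assume i: "Im (Ln z) = Im (Ln v) + pi / 2" and b: "\<bar>Im (Ln v)\<bar> \<le> m / Im z"
      have "Im z * Im (Ln v) \<ge> Im z * (- (m / Im z))" using b t2 by (intro mult_left_mono) auto
      then show ?thesis using i t2 by (simp add: algebra_simps)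
    qed
    have "norm (Gamma z) = exp (Re (c + (z - 1/2) * Ln z - z + r))" using r(2) by simp
    also have "Re (c + (z - 1/2) * Ln z - z + r) = Re c + (Re z - 1/2) * ln (norm z) - Im z * Im (Ln z) - Re z + Re r"
      using z0 by simp
    also have "\<dots> \<le> \<bar>Re c\<bar> + 2 * m + 22 + (Re z - 1/2) * ln (norm z) - pi * Im z / 2"
      using A r22 abs_Re_le_cmod[of r] z by linarith
    finally have "norm (Gamma z) \<le> exp (\<bar>Re c\<bar> + 2 * m + 22 + (Re z - 1/2) * ln (norm z) - pi * Im z / 2)" by simp
    also have "\<dots> = exp (\<bar>Re c\<bar> + 2 * m + 22) * exp ((Re z - 1/2) * ln (norm z)) * exp (- pi * Im z / 2)"
      unfolding exp_add[symmetric] by simp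
    also have "exp ((Re z - 1/2) * ln (norm z)) = norm z powr (Re z - 1/2)"
      using z0 by (simp add: powr_def)
    also have "norm z powr (Re z - 1/2) \<le> (1 + m) powr (m + 1/2) * Im z powr (Re z - 1/2)"
    proof -
      define q where "q = norm z / Im z"
      have q1: "q \<ge> 1" using abs_Im_le_cmod[of z] t2 by (simp add: q_def)
      have "norm z \<le> m + Im z" using cmod_le[of z] z t2 by simp
      also have "\<dots> \<le> m * Im z + Im z" using t2 assms mult_left_mono[of 1 "Im z" m] by simp
      finally have q2: "q \<le> 1 + m" using t2 by (simp add: q_def field_simps)
      have "q powr (Re z - 1/2) \<le> q powr (m + 1/2)" using q1 z by (intro powr_mono) auto
      also have "\<dots> \<le> (1 + m) powr (m + 1/2)" using q1 q2 assms by (intro powr_mono2) auto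
      finally have "q powr (Re z - 1/2) * Im z powr (Re z - 1/2) \<le> (1 + m) powr (m + 1/2) * Im z powr (Re z - 1/2)"
        by (intro mult_right_mono) auto
      moreover have "q powr (Re z - 1/2) * Im z powr (Re z - 1/2) = norm z powr (Re z - 1/2)"
        using t2 by (simp add: q_def flip: powr_mult)
      ultimately show ?thesis by simp
    qed
    finally show ?thesis using t2 by (simp add: K_def mult_ac)
  qed
  show ?thesis
  proof (intro exI[of _ K] conjI allI impI)
    show "K > 0" using assms by (simp add: K_def)
    fix z assume z: "\<bar>Re z\<bar> \<le> m \<and> \<bar>Im z\<bar> \<ge> 2 * m + 2"
    show "norm (Gamma z) \<le> K * \<bar>Im z\<bar> powr (Re z - 1/2) * exp (- pi * \<bar>Im z\<bar> / 2)"
    proof (cases "Im z \<ge> 0")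
      case True then show ?thesis using pos[of z] z by simp
    next
      case False
      have "norm (Gamma z) = norm (Gamma (cnj z))" by (simp flip: cnj_Gamma)
      then show ?thesis using pos[of "cnj z"] z False by simp
    qed
  qed
qed

text \<open>A crude bound is enough: exp of order |Im z|^(3/2) is still beaten by the Gaussian
  factor with which lines are shifted. The logarithm in Stirling's exponent is therefore just
  estimated by a square root.\<close>

lemma norm_rGamma_vertical_le:
  fixes m :: real assumes "m \<ge> 0"
  shows "\<exists>K>0. \<forall>z. \<bar>Re z\<bar> \<le> m \<and> \<bar>Im z\<bar> \<ge> 2 * m + 2 \<longrightarrow>
    norm (rGamma z) \<le> exp (K * (\<bar>Im z\<bar> * sqrt \<bar>Im z\<bar>))"
proof -
  obtain c where c: "\<And>z. Re z \<ge> - m \<Longrightarrow> \<bar>Im z\<bar> \<ge> 2 * m + 2 \<Longrightarrow>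
     (\<exists>r. norm r \<le> 44 / \<bar>Im z\<bar> \<and> Gamma z = exp (c + (z - 1/2) * Ln z - z + r))"
    using Gamma_stirling assms by blast
  define M where "M = 1 + m"
  define K where "K = norm c + (M + 1) * (2 * sqrt M + pi) + M + 22"
  have M: "M \<ge> 1" using assms by (simp add: M_def)
  show ?thesis
  proof (intro exI[of _ K] conjI allI impI)
    show "K > 0" using M pi_gt_zero by (auto simp: K_def intro!: add_nonneg_pos mult_nonneg_nonneg add_nonneg_nonneg)
    fix z assume z: "\<bar>Re z\<bar> \<le> m \<and> \<bar>Im z\<bar> \<ge> 2 * m + 2"
    define y where "y = \<bar>Im z\<bar>"
    have y: "y \<ge> 2" using z assms by (simp add: y_def)
    have z0: "z \<noteq> 0" using y by (auto simp: y_def)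
    obtain r where r: "norm r \<le> 44 / \<bar>Im z\<bar>" "Gamma z = exp (c + (z - 1/2) * Ln z - z + r)"
      using c[of z] z abs_le_D2[of "Re z" m] minus_le_iff[of m "Re z"] by fastforce
    have r22: "norm r \<le> 22"
    proof -
      have "44 / \<bar>Im z\<bar> \<le> 44 / 2" using y unfolding y_def by (intro divide_left_mono) auto
      then show ?thesis using r(1) by simp
    qed
    have zM: "norm z \<le> M * y"
    proof -
      have "norm z \<le> m + y" using cmod_le[of z] z by (simp add: y_def)
      also have "\<dots> \<le> m * y + y" using y assms mult_left_mono[of 1 y m] by simp
      finally show ?thesis by (simp add: M_def algebra_simps)
    qed
    have z1: "norm z \<ge> 1" using y abs_Im_le_cmod[of z] by (simp add: y_def)
    have L: "norm (Ln z) \<le> (2 * sqrt M + pi) * sqrt y"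
    proof -
      have "norm (Ln z) \<le> \<bar>Re (Ln z)\<bar> + \<bar>Im (Ln z)\<bar>" by (rule cmod_le)
      also have "\<bar>Re (Ln z)\<bar> = ln (norm z)" using z0 z1 by simp
      also have "ln (norm z) = 2 * ln (sqrt (norm z))" using z0 by (simp add: ln_sqrt)
      also have "\<dots> \<le> 2 * sqrt (norm z)" using z0 ln_bound[of "sqrt (norm z)"] by simp
      also have "\<dots> \<le> 2 * sqrt (M * y)" using zM by simp
      also have "\<bar>Im (Ln z)\<bar> \<le> pi" using mpi_less_Im_Ln[OF z0] Im_Ln_le_pi[OF z0] by simp
      also have "pi \<le> pi * sqrt y" using y by simp
      finally show ?thesis by (simp add: real_sqrt_mult algebra_simps)
    qed
    have ysq: "y \<le> y * sqrt y" "1 \<le> y * sqrt y"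
      using y mult_mono[of 1 y 1 "sqrt y"] by auto
    have "norm (rGamma z) = norm (exp (- (c + (z - 1/2) * Ln z - z + r)))"
      by (simp only: rGamma_inverse_Gamma r(2) exp_minus)
    also have "\<dots> \<le> exp (norm (- (c + (z - 1/2) * Ln z - z + r)))" by (rule norm_exp)
    also have "norm (- (c + (z - 1/2) * Ln z - z + r)) \<le> norm c + norm ((z - 1/2) * Ln z) + norm z + norm r"
      unfolding norm_minus_cancel
      using norm_triangle_ineq[of "c + (z - 1/2) * Ln z - z" r] norm_triangle_ineq4[of "c + (z - 1/2) * Ln z" z]
        norm_triangle_ineq[of c "(z - 1/2) * Ln z"] by linarith
    also have "norm ((z - 1/2) * Ln z) \<le> ((M + 1) * y) * ((2 * sqrt M + pi) * sqrt y)"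
    proof -
      have "norm (z - 1/2) \<le> norm z + 1/2" using norm_triangle_ineq4[of z "1/2"] by simp
      also have "\<dots> \<le> (M + 1) * y" using zM y by (simp add: algebra_simps)
      finally show ?thesis unfolding norm_mult using L M y by (intro mult_mono) auto
    qed
    also have "norm c + (M + 1) * y * ((2 * sqrt M + pi) * sqrt y) + norm z + norm r \<le> K * (y * sqrt y)"
    proof -
      have "norm c \<le> norm c * (y * sqrt y)" using ysq mult_left_mono[of 1 "y * sqrt y" "norm c"] by simp
      moreover have "norm z \<le> M * (y * sqrt y)" using zM ysq M mult_left_mono[of y "y * sqrt y" M] by linarith
      moreover have "norm r \<le> 22 * (y * sqrt y)" using r22 ysq by linarith
      ultimately show ?thesis by (simp add: K_def algebra_simps)
    qed
    finally show "norm (rGamma z) \<le> exp (K * (\<bar>Im z\<bar> * sqrt \<bar>Im z\<bar>))" by (simp add: y_def)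
  qed
qed

text \<open>\<open>f(\<tau>)\<close> has the shape of \<open>\<Gamma>(au + b + 1/2)\<close>, \<open>u = c + i\<tau>\<close>, up to a factor \<open>exp(k\<^sub>0 + k\<^sub>1u + O(1/\<tau>))\<close>.\<close>

definition stirling_form :: "real \<Rightarrow> (real \<Rightarrow> complex) \<Rightarrow> real \<Rightarrow> complex \<Rightarrow> bool" where
  "stirling_form c f a b \<longleftrightarrow> (\<exists>k0. \<exists>k1::real. \<exists>T0>0. \<exists>K\<ge>0. \<forall>\<tau>. \<bar>\<tau>\<bar> \<ge> T0 \<longrightarrow> (\<exists>\<rho>. norm \<rho> \<le> K / \<bar>\<tau>\<bar> \<and>
    f \<tau> = exp (k0 + of_real k1 * Complex c \<tau> + (of_real a * Complex c \<tau> + b) * Ln (Complex c \<tau>)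
       - of_real a * Complex c \<tau> + \<rho>)))"

lemma stirling_formE:
  assumes "stirling_form c f a b"
  obtains k0 and k1 T0 K :: real where "T0 > 0" "K \<ge> 0" "\<And>\<tau>. \<bar>\<tau>\<bar> \<ge> T0 \<Longrightarrow> \<exists>\<rho>. norm \<rho> \<le> K / \<bar>\<tau>\<bar> \<and>
    f \<tau> = exp (k0 + of_real k1 * Complex c \<tau> + (of_real a * Complex c \<tau> + b) * Ln (Complex c \<tau>)
       - of_real a * Complex c \<tau> + \<rho>)"
  using assms unfolding stirling_form_def by blast

lemma stirling_form_mult:
  assumes "stirling_form c f a b" "stirling_form c f' a' b'"
  shows "stirling_form c (\<lambda>\<tau>. f \<tau> * f' \<tau>) (a + a') (b + b')"
proof -
  from assms(1) obtain k0 and k1 T0 K :: real where T0: "T0 > 0" "K \<ge> 0" and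
    1: "\<And>\<tau>. \<bar>\<tau>\<bar> \<ge> T0 \<Longrightarrow> \<exists>\<rho>. norm \<rho> \<le> K / \<bar>\<tau>\<bar> \<and> f \<tau> = exp (k0 + of_real k1 * Complex c \<tau>
      + (of_real a * Complex c \<tau> + b) * Ln (Complex c \<tau>) - of_real a * Complex c \<tau> + \<rho>)"
    by (rule stirling_formE) (rule that)
  from assms(2) obtain k0' and k1' T0' K' :: real where T0': "T0' > 0" "K' \<ge> 0" and
    2: "\<And>\<tau>. \<bar>\<tau>\<bar> \<ge> T0' \<Longrightarrow> \<exists>\<rho>. norm \<rho> \<le> K' / \<bar>\<tau>\<bar> \<and> f' \<tau> = exp (k0' + of_real k1' * Complex c \<tau>
      + (of_real a' * Complex c \<tau> + b') * Ln (Complex c \<tau>) - of_real a' * Complex c \<tau> + \<rho>)"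
    by (rule stirling_formE) (rule that)
  show ?thesis unfolding stirling_form_def
  proof (rule exI[of _ "k0 + k0'"], rule exI[of _ "k1 + k1'"], rule exI[of _ "max T0 T0'"], intro conjI,
      use T0 in simp, rule exI[of _ "K + K'"], intro conjI allI impI)
    show "0 \<le> K + K'" using T0 T0' by simp
    fix \<tau> :: real assume "\<bar>\<tau>\<bar> \<ge> max T0 T0'"
    then obtain \<rho> \<rho>' where r: "norm \<rho> \<le> K / \<bar>\<tau>\<bar>" "f \<tau> = exp (k0 + of_real k1 * Complex c \<tau>
      + (of_real a * Complex c \<tau> + b) * Ln (Complex c \<tau>) - of_real a * Complex c \<tau> + \<rho>)"
      and r': "norm \<rho>' \<le> K' / \<bar>\<tau>\<bar>" "f' \<tau> = exp (k0' + of_real k1' * Complex c \<tau>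
      + (of_real a' * Complex c \<tau> + b') * Ln (Complex c \<tau>) - of_real a' * Complex c \<tau> + \<rho>')"
      using 1[of \<tau>] 2[of \<tau>] by auto
    show "\<exists>\<rho>. norm \<rho> \<le> (K + K') / \<bar>\<tau>\<bar> \<and> f \<tau> * f' \<tau> = exp (k0 + k0' + of_real (k1 + k1') * Complex c \<tau>
      + (of_real (a + a') * Complex c \<tau> + (b + b')) * Ln (Complex c \<tau>) - of_real (a + a') * Complex c \<tau> + \<rho>)"
    proof (rule exI[of _ "\<rho> + \<rho>'"], rule conjI)
      show "norm (\<rho> + \<rho>') \<le> (K + K') / \<bar>\<tau>\<bar>"
        using r(1) r'(1) by (intro norm_triangle_le) (simp add: add_divide_distrib)
      show "f \<tau> * f' \<tau> = exp (k0 + k0' + of_real (k1 + k1') * Complex c \<tau>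
        + (of_real (a + a') * Complex c \<tau> + (b + b')) * Ln (Complex c \<tau>) - of_real (a + a') * Complex c \<tau> + (\<rho> + \<rho>'))"
        unfolding r(2) r'(2) exp_add[symmetric] by (rule arg_cong[of _ _ exp]) (simp add: algebra_simps)
    qed
  qed
qed

text \<open>With w = \<gamma>/(\<alpha> u) one has Ln (\<alpha> u + \<gamma>) = ln \<alpha> + Ln u +
  Ln (1 + w). The first-order term \<alpha> u w = \<gamma> cancels the -\<gamma> contained in -z,
  and what remains of w is O(1/|u|).\<close>

lemma stirling_form_Gamma:
  fixes \<alpha> c :: real and \<gamma> :: complex
  assumes "\<alpha> > 0" "c > 0"
  shows "stirling_form c (\<lambda>\<tau>. Gamma (of_real \<alpha> * Complex c \<tau> + \<gamma>)) \<alpha> (\<gamma> - 1/2)"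
proof -
  define m where "m = \<bar>\<alpha> * c + Re \<gamma>\<bar>"
  obtain c0 where c0: "\<And>z. Re z \<ge> - m \<Longrightarrow> \<bar>Im z\<bar> \<ge> 2 * m + 2 \<Longrightarrow>
     (\<exists>r. norm r \<le> 44 / \<bar>Im z\<bar> \<and> Gamma z = exp (c0 + (z - 1/2) * Ln z - z + r))"
    using Gamma_stirling abs_ge_zero[of "\<alpha> * c + Re \<gamma>"] unfolding m_def by blast
  define C where "C = 88 / \<alpha> + norm \<gamma> / \<alpha> * (2 * norm \<gamma> + 2 * norm (\<gamma> - 1/2))"
  \<comment> \<open>Beyond \<open>T0\<close> Stirling's formula applies at \<alpha> u + \<gamma>,
    and |w| \<le> 1/2.\<close>
  define T0 where "T0 = max 1 (max ((2 * m + 2 + \<bar>Im \<gamma>\<bar>) / \<alpha>) (2 * norm \<gamma> / \<alpha>))"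
  define k0 where "k0 = c0 + (\<gamma> - 1/2) * of_real (ln \<alpha>)"
  define k1 where "k1 = \<alpha> * ln \<alpha>"
  show ?thesis unfolding stirling_form_def
  proof (rule exI[of _ k0], rule exI[of _ k1], rule exI[of _ T0], intro conjI, simp add: T0_def,
      rule exI[of _ C], intro conjI allI impI)
    show "C \<ge> 0" using assms by (simp add: C_def)
  next
    fix \<tau> :: real assume t: "\<bar>\<tau>\<bar> \<ge> T0"
    define u where "u = Complex c \<tau>"
    define w where "w = \<gamma> / (of_real \<alpha> * u)"
    define z where "z = of_real \<alpha> * u + \<gamma>"
    have t1: "\<bar>\<tau>\<bar> \<ge> 1" "\<bar>\<tau>\<bar> \<ge> (2 * m + 2 + \<bar>Im \<gamma>\<bar>) / \<alpha>" "\<bar>\<tau>\<bar> \<ge> 2 * norm \<gamma> / \<alpha>"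
      using t unfolding T0_def by auto
    have t2: "\<alpha> * \<bar>\<tau>\<bar> \<ge> 2 * m + 2 + \<bar>Im \<gamma>\<bar>" "\<alpha> * \<bar>\<tau>\<bar> \<ge> 2 * norm \<gamma>"
      using t1 assms by (simp_all add: field_simps)
    have m0: "m \<ge> 0" by (simp add: m_def)
    have imz: "\<bar>Im z\<bar> \<ge> 2 * m + 2" "\<bar>Im z\<bar> \<ge> \<alpha> * \<bar>\<tau>\<bar> / 2"
    proof -
      have "\<bar>Im z\<bar> \<ge> \<alpha> * \<bar>\<tau>\<bar> - \<bar>Im \<gamma>\<bar>"
        using assms abs_triangle_ineq2[of "\<alpha> * \<tau>" "- Im \<gamma>"] by (simp add: z_def u_def abs_mult)
      moreover have "\<bar>Im \<gamma>\<bar> \<le> norm \<gamma>" by (rule abs_Im_le_cmod)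
      ultimately show "\<bar>Im z\<bar> \<ge> 2 * m + 2" "\<bar>Im z\<bar> \<ge> \<alpha> * \<bar>\<tau>\<bar> / 2" using t2 by linarith+
    qed
    have "Re z \<ge> - m" by (simp add: z_def u_def m_def)
    then obtain r where r: "norm r \<le> 44 / \<bar>Im z\<bar>" "Gamma z = exp (c0 + (z - 1/2) * Ln z - z + r)"
      using c0 imz by blast
    have nu: "norm u \<ge> \<bar>\<tau>\<bar>" using abs_Im_le_cmod[of u] by (simp add: u_def)
    have u0: "u \<noteq> 0" using nu t1 by auto
    have wb: "norm w \<le> norm \<gamma> / \<alpha> / \<bar>\<tau>\<bar>"
    proof -
      have "norm w = norm \<gamma> / (\<alpha> * norm u)" using assms by (simp add: w_def norm_divide norm_mult)
      also have "\<dots> \<le> norm \<gamma> / (\<alpha> * \<bar>\<tau>\<bar>)" using nu t1 assms u0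
        by (intro divide_left_mono mult_left_mono mult_pos_pos) auto
      finally show ?thesis by simp
    qed
    also have "norm \<gamma> / \<alpha> / \<bar>\<tau>\<bar> \<le> 1/2" using t2 t1 assms by (simp add: field_simps)
    finally have w12: "norm w \<le> 1/2" .
    have l1: "norm (Ln (1 + w) - w) \<le> 2 * norm w ^ 2"
    proof -
      have "norm (Ln (1 + w) - w) \<le> norm w^2 / (1 - norm w)" by (rule Ln_approx_linear) (use w12 in simp)
      also have "\<dots> \<le> norm w^2 / (1/2)" using w12 by (intro divide_left_mono) auto
      finally show ?thesis by simp
    qed
    have l2: "norm (Ln (1 + w)) \<le> 2 * norm w"
    proof -
      have "norm (Ln (1 + w)) \<le> norm (Ln (1 + w) - w) + norm w" using norm_triangle_ineq[of "Ln (1+w) - w" w] by simp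
      also have "2 * norm w ^ 2 \<le> norm w" using w12 mult_right_mono[of "2 * norm w" 1 "norm w"] by (simp add: power2_eq_square)
      then have "norm (Ln (1 + w) - w) + norm w \<le> 2 * norm w" using l1 by simp
      finally show ?thesis .
    qed
    have Lz: "Ln z = of_real (ln \<alpha>) + Ln u + Ln (1 + w)"
    proof -
      have rw: "Re (1 + w) > 0" using w12 abs_Re_le_cmod[of w] by simp
      have w0: "1 + w \<noteq> 0" using rw by (metis less_irrefl zero_complex.sel(1))
      have "z = of_real \<alpha> * (u * (1 + w))" using u0 assms by (simp add: z_def w_def field_simps)
      moreover have "Ln (of_real \<alpha> * (u * (1 + w))) = of_real (ln \<alpha>) + Ln (u * (1 + w))"
        using Ln_times_of_real[of \<alpha> "u * (1 + w)"] Ln_of_real[OF assms(1)] u0 w0 assms(1) by simp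
      \<comment> \<open>Both factors have positive real part, so the sum of their arguments stays
        below pi in absolute value; this is where c > 0 enters.\<close>
      moreover have "Ln (u * (1 + w)) = Ln u + Ln (1 + w)"
      proof -
        have "\<bar>Im (Ln u)\<bar> < pi/2" using Re_Ln_pos_lt[OF u0] assms by (simp add: u_def)
        moreover have "\<bar>Im (Ln (1 + w))\<bar> < pi/2" using Re_Ln_pos_lt[OF w0] rw by simp
        ultimately show ?thesis using u0 w0 by (intro Ln_times_simple) (auto simp: abs_if split: if_splits)
      qed
      ultimately show ?thesis by simp
    qed
    define \<rho> where "\<rho> = r + (of_real \<alpha> * u * (Ln (1 + w) - w) + (\<gamma> - 1/2) * Ln (1 + w))"
    have auw: "of_real \<alpha> * u * w = \<gamma>" using u0 assms by (simp add: w_def)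
    have "Gamma z = exp (k0 + of_real k1 * u + (of_real \<alpha> * u + (\<gamma> - 1/2)) * Ln u - of_real \<alpha> * u + \<rho>)"
    proof -
      have "c0 + (z - 1/2) * Ln z - z + r = k0 + of_real k1 * u + (of_real \<alpha> * u + (\<gamma> - 1/2)) * Ln u - of_real \<alpha> * u + \<rho>
         + (of_real \<alpha> * u * w - \<gamma>)"
        unfolding Lz k0_def k1_def \<rho>_def unfolding z_def by (simp add: algebra_simps)
      then show ?thesis using r(2) auw by simp
    qed
    moreover have "norm \<rho> \<le> C / \<bar>\<tau>\<bar>"
    proof -
      have "norm r \<le> 88 / \<alpha> / \<bar>\<tau>\<bar>"
      proof -
        have "44 / \<bar>Im z\<bar> \<le> 44 / (\<alpha> * \<bar>\<tau>\<bar> / 2)" using imz t1 assms m0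
          by (intro divide_left_mono mult_pos_pos) auto
        then show ?thesis using r(1) by simp
      qed
      moreover have "norm (of_real \<alpha> * u * (Ln (1 + w) - w)) \<le> 2 * norm \<gamma> * norm w"
      proof -
        have "norm (of_real \<alpha> * u * (Ln (1 + w) - w)) \<le> norm (of_real \<alpha> * u) * (2 * norm w ^ 2)"
          unfolding norm_mult[of "of_real \<alpha> * u"] by (intro mult_left_mono l1) auto
        also have "\<dots> = 2 * norm (of_real \<alpha> * u * w) * norm w" by (simp add: norm_mult power2_eq_square)
        finally show ?thesis by (simp only: auw)
      qed
      moreover have "norm ((\<gamma> - 1/2) * Ln (1 + w)) \<le> norm (\<gamma> - 1/2) * (2 * norm w)"
        unfolding norm_mult by (intro mult_left_mono l2) auto
      ultimately have "norm \<rho> \<le> 88 / \<alpha> / \<bar>\<tau>\<bar> + norm w * (2 * norm \<gamma> + 2 * norm (\<gamma> - 1/2))"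
        unfolding \<rho>_def by (intro norm_triangle_le add_mono) (auto simp: algebra_simps intro: norm_triangle_le)
      also have "\<dots> \<le> 88 / \<alpha> / \<bar>\<tau>\<bar> + norm \<gamma> / \<alpha> / \<bar>\<tau>\<bar> * (2 * norm \<gamma> + 2 * norm (\<gamma> - 1/2))"
        by (intro add_left_mono mult_right_mono wb) auto
      also have "\<dots> = C / \<bar>\<tau>\<bar>" by (simp add: C_def add_divide_distrib)
      finally show ?thesis .
    qed
    ultimately show "\<exists>\<rho>. norm \<rho> \<le> C / \<bar>\<tau>\<bar> \<and>
      Gamma (of_real \<alpha> * Complex c \<tau> + \<gamma>) = 
     exp (k0 + of_real k1 * Complex c \<tau> + (of_real \<alpha> * Complex c \<tau> + (\<gamma> - 1/2)) * Ln (Complex c \<tau>) - of_real \<alpha> * Complex c \<tau> + \<rho>)"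
      unfolding z_def u_def by blast
  qed
qed

lemma stirling_form_Gamma_prod:
  fixes \<alpha> :: "'i \<Rightarrow> real" and c :: real and \<gamma> :: "'i \<Rightarrow> complex"
  assumes "finite I" "\<forall>i\<in>I. \<alpha> i > 0" "c > 0"
  shows "stirling_form c (\<lambda>\<tau>. \<Prod>i\<in>I. Gamma (of_real (\<alpha> i) * Complex c \<tau> + \<gamma> i)) (\<Sum>i\<in>I. \<alpha> i) (\<Sum>i\<in>I. \<gamma> i - 1/2)"
  using assms(1,2)
proof (induction I rule: finite_induct)
  case empty
  show ?case unfolding stirling_form_def
    by (rule exI[of _ 0], rule exI[of _ 0], rule exI[of _ 1], simp, rule exI[of _ 0], auto intro!: exI[of _ 0])
next
  case (insert j I)
  then have "\<alpha> j > 0" and I: "\<forall>i\<in>I. \<alpha> i > 0" by auto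
  from stirling_form_mult[OF stirling_form_Gamma[OF this(1) assms(3), of "\<gamma> j"] insert.IH[OF I]] show ?case
    using insert.hyps by simp
qed

text \<open>Up to exponentials of linear functions, Stirling's form sees only the total slope and
  the total shift, so a product of Gamma factors looks like a single one. \<open>g\<close> is chosen
  such that g - 1/2 is the total shift; dividing by u^M lowers it by M.\<close>

lemma Gamma_prod_line_eq_Gamma:
  fixes \<alpha> :: "'i \<Rightarrow> real" and c :: real and \<gamma> :: "'i \<Rightarrow> complex" and M :: nat
  assumes "finite I" "I \<noteq> {}" "\<forall>i\<in>I. \<alpha> i > 0" "c > 0"
  defines "a \<equiv> \<Sum>i\<in>I. \<alpha> i" and "g \<equiv> 1/2 + (\<Sum>i\<in>I. \<gamma> i - 1/2) - of_nat M"
  shows "\<exists>k0. \<exists>k1::real. \<exists>T0>0. \<exists>K\<ge>0. \<forall>\<tau>. \<bar>\<tau>\<bar> \<ge> T0 \<longrightarrow> (\<exists>\<rho>. norm \<rho> \<le> K / \<bar>\<tau>\<bar> \<and>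
    (\<Prod>i\<in>I. Gamma (of_real (\<alpha> i) * Complex c \<tau> + \<gamma> i)) / Complex c \<tau> ^ M = 
     exp (k0 + of_real k1 * Complex c \<tau>) * Gamma (of_real a * Complex c \<tau> + g) * exp \<rho>)"
proof -
  have a: "a > 0" unfolding a_def using assms by (intro sum_pos) auto
  from stirling_form_Gamma_prod[OF assms(1,3,4), of \<gamma>, folded a_def] obtain k0 and k1 T0 K :: real where T0: "T0 > 0" "K \<ge> 0" and
    IH: "\<And>\<tau>. \<bar>\<tau>\<bar> \<ge> T0 \<Longrightarrow> \<exists>\<rho>. norm \<rho> \<le> K / \<bar>\<tau>\<bar> \<and>
    (\<Prod>i\<in>I. Gamma (of_real (\<alpha> i) * Complex c \<tau> + \<gamma> i)) = 
     exp (k0 + of_real k1 * Complex c \<tau> + (of_real a * Complex c \<tau> + (\<Sum>i\<in>I. \<gamma> i - 1/2)) * Ln (Complex c \<tau>)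
       - of_real a * Complex c \<tau> + \<rho>)" by (rule stirling_formE) (rule that)
  from stirling_form_Gamma[OF a \<open>c > 0\<close>, of g] obtain k0' and k1' T0' K' :: real where
    T0': "T0' > 0" "K' \<ge> 0" and
    J: "\<And>\<tau>. \<bar>\<tau>\<bar> \<ge> T0' \<Longrightarrow> \<exists>\<rho>. norm \<rho> \<le> K' / \<bar>\<tau>\<bar> \<and>
    Gamma (of_real a * Complex c \<tau> + g) = 
     exp (k0' + of_real k1' * Complex c \<tau> + (of_real a * Complex c \<tau> + (g - 1/2)) * Ln (Complex c \<tau>)
       - of_real a * Complex c \<tau> + \<rho>)" by (rule stirling_formE) (rule that)
  show ?thesis
  proof (rule exI[of _ "k0 - k0'"], rule exI[of _ "k1 - k1'"], rule exI[of _ "max T0 T0'"], intro conjI,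
      use T0 in simp, rule exI[of _ "K + K'"], intro conjI allI impI)
    show "0 \<le> K + K'" using T0 T0' by simp
    fix \<tau> :: real assume t: "\<bar>\<tau>\<bar> \<ge> max T0 T0'"
    obtain \<rho> where r: "norm \<rho> \<le> K / \<bar>\<tau>\<bar>" "(\<Prod>i\<in>I. Gamma (of_real (\<alpha> i) * Complex c \<tau> + \<gamma> i)) = 
     exp (k0 + of_real k1 * Complex c \<tau> + (of_real a * Complex c \<tau> + (\<Sum>i\<in>I. \<gamma> i - 1/2)) * Ln (Complex c \<tau>)
       - of_real a * Complex c \<tau> + \<rho>)" using IH[of \<tau>] t by auto
    obtain \<rho>' where r': "norm \<rho>' \<le> K' / \<bar>\<tau>\<bar>" "Gamma (of_real a * Complex c \<tau> + g) = 
     exp (k0' + of_real k1' * Complex c \<tau> + (of_real a * Complex c \<tau> + (g - 1/2)) * Ln (Complex c \<tau>) - of_real a * Complex c \<tau> + \<rho>')" 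
      using J[of \<tau>] t by auto
    have u0: "Complex c \<tau> \<noteq> 0" using \<open>c > 0\<close> by (auto simp: complex_eq_iff)
    have pw: "Complex c \<tau> ^ M = exp (of_nat M * Ln (Complex c \<tau>))"
      using u0 by (simp add: exp_of_nat_mult)
    show "\<exists>\<rho>. norm \<rho> \<le> (K + K') / \<bar>\<tau>\<bar> \<and>
     (\<Prod>i\<in>I. Gamma (of_real (\<alpha> i) * Complex c \<tau> + \<gamma> i)) / Complex c \<tau> ^ M = 
     exp (k0 - k0' + of_real (k1 - k1') * Complex c \<tau>) * Gamma (of_real a * Complex c \<tau> + g) * exp \<rho>"
    proof (rule exI[of _ "\<rho> - \<rho>'"], rule conjI)
      show "norm (\<rho> - \<rho>') \<le> (K + K') / \<bar>\<tau>\<bar>" using r(1) r'(1) 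
        by (intro order.trans[OF norm_triangle_ineq4]) (simp add: add_divide_distrib)
      show "(\<Prod>i\<in>I. Gamma (of_real (\<alpha> i) * Complex c \<tau> + \<gamma> i)) / Complex c \<tau> ^ M = 
       exp (k0 - k0' + of_real (k1 - k1') * Complex c \<tau>) * Gamma (of_real a * Complex c \<tau> + g) * exp (\<rho> - \<rho>')"
        unfolding r(2) r'(2) pw exp_add[symmetric] exp_diff[symmetric]
        by (rule arg_cong[of _ _ exp]) (simp add: g_def algebra_simps)
    qed
  qed
qed

subsection \<open>Shifting vertical lines of integration\<close>

text \<open>Links the Lebesgue integral over the line to the gauge integrals over segments in which
  contour integrals along a vertical \<open>linepath\<close> are expressed.\<close>

lemma integral_symmetric_interval_tendsto:
  fixes g :: "real \<Rightarrow> complex"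
  assumes g: "integrable lborel g"
  shows "(\<lambda>n. integral {- real n..real n} g) \<longlonglongrightarrow> (LINT t|lborel. g t)"
proof -
  have "(\<lambda>n. LINT t|lborel. indicator {- real n..real n} t *\<^sub>R g t) \<longlonglongrightarrow> (LINT t|lborel. g t)"
  proof (rule integral_dominated_convergence[where w = "\<lambda>t. norm (g t)"])
    show "AE t in lborel. (\<lambda>n. indicator {- real n..real n} t *\<^sub>R g t) \<longlonglongrightarrow> g t"
    proof (rule AE_I2)
      fix t :: real
      obtain N where N: "real N \<ge> \<bar>t\<bar>" using real_arch_simple by blast
      show "(\<lambda>n. indicator {- real n..real n} t *\<^sub>R g t) \<longlonglongrightarrow> g t"
      proof (rule tendsto_eventually, rule eventually_sequentiallyI[of N])
        fix n assume "n \<ge> N"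
        then have "real n \<ge> \<bar>t\<bar>" using N by (meson of_nat_mono order_trans)
        then have "t \<in> {- real n..real n}" by auto
        then show "indicator {- real n..real n} t *\<^sub>R g t = g t" by simp
      qed
    qed
  qed (use g in \<open>(simp, simp, simp add: integrable_norm, auto intro!: AE_I2 simp: indicator_def)\<close>)
  moreover have "(LINT t|lborel. indicator {- real n..real n} t *\<^sub>R g t) = integral {- real n..real n} g" for n
  proof -
    have "set_integrable lborel {- real n..real n} g"
      unfolding set_integrable_def using integrable_mult_indicator[OF _ g, of "{- real n..real n}"] by simp
    from set_borel_integral_eq_integral(2)[OF this] show ?thesis
      by (simp add: set_lebesgue_integral_def)
  qed
  ultimately show ?thesis by simp
qed

text \<open>The rectangle integral does not depend on T; its vertical sides tend to the two line
  integrals, and the horizontal ones vanish by \<open>decay\<close>. The abstract value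
  \<open>V\<close> lets one proof serve both with and without poles.\<close>

lemma vertical_line_integral_shift:
  assumes sig: "\<sigma>1 < \<sigma>2"
    and int1: "integrable lborel (\<lambda>t. f (Complex \<sigma>1 t))"
    and int2: "integrable lborel (\<lambda>t. f (Complex \<sigma>2 t))"
    and decay: "\<And>e. e > 0 \<Longrightarrow> \<exists>T. \<forall>\<sigma> t. \<sigma>1 \<le> \<sigma> \<and> \<sigma> \<le> \<sigma>2 \<and> \<bar>t\<bar> \<ge> T \<longrightarrow> norm (f (Complex \<sigma> t)) \<le> e"
    and rect: "\<And>T. T \<ge> T0 \<Longrightarrow> (f has_contour_integral V) (rectpath (Complex \<sigma>1 (- T)) (Complex \<sigma>2 T))"
  shows "\<i> * (LINT t|lborel. f (Complex \<sigma>2 t)) - \<i> * (LINT t|lborel. f (Complex \<sigma>1 t)) = V"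
proof -
  define I1 where "I1 n = integral {- real n..real n} (\<lambda>t. f (Complex \<sigma>1 t))" for n
  define I2 where "I2 n = integral {- real n..real n} (\<lambda>t. f (Complex \<sigma>2 t))" for n
  have lim: "(\<lambda>n. V - (\<i> * I2 n - \<i> * I1 n)) \<longlonglongrightarrow> V - (\<i> * (LINT t|lborel. f (Complex \<sigma>2 t)) - \<i> * (LINT t|lborel. f (Complex \<sigma>1 t)))"
    unfolding I1_def I2_def by (intro tendsto_intros integral_symmetric_interval_tendsto int1 int2)
  have "(\<lambda>n. V - (\<i> * I2 n - \<i> * I1 n)) \<longlonglongrightarrow> 0"
  proof (rule metric_LIMSEQ_I)
    fix r :: real assume r: "r > 0"
    define e where "e = r / 4 / (\<sigma>2 - \<sigma>1)"
    have e: "e > 0" using r sig by (simp add: e_def)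
    obtain T where T: "\<And>\<sigma> t. \<sigma>1 \<le> \<sigma> \<Longrightarrow> \<sigma> \<le> \<sigma>2 \<Longrightarrow> \<bar>t\<bar> \<ge> T \<Longrightarrow> norm (f (Complex \<sigma> t)) \<le> e"
      using decay[OF e] by blast
    obtain N where N: "real N \<ge> max (max T T0) 1" using real_arch_simple by blast
    show "\<exists>N. \<forall>n\<ge>N. dist (V - (\<i> * I2 n - \<i> * I1 n)) 0 < r"
    proof (intro exI[of _ N] allI impI)
      fix n assume "n \<ge> N"
      then have n: "real n \<ge> T" "real n \<ge> T0" "real n \<ge> 1" using N by (auto intro: order_trans)
      define a1 a2 a3 a4 where "a1 = Complex \<sigma>1 (- real n)" and "a2 = Complex \<sigma>2 (- real n)"
        and "a3 = Complex \<sigma>2 (real n)" and "a4 = Complex \<sigma>1 (real n)"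
      have rp: "rectpath a1 a3 = linepath a1 a2 +++ linepath a2 a3 +++ linepath a3 a4 +++ linepath a4 a1"
        by (simp add: rectpath_def a1_def a2_def a3_def a4_def Let_def)
      have V: "(f has_contour_integral V) (rectpath a1 a3)" using rect[OF n(2)] by (simp add: a1_def a3_def)
      then have "f contour_integrable_on (rectpath a1 a3)" by (auto simp: contour_integrable_on_def)
      then have ci: "f contour_integrable_on linepath a1 a2" "f contour_integrable_on linepath a2 a3"
        "f contour_integrable_on linepath a3 a4" "f contour_integrable_on linepath a4 a1"
        unfolding rp by simp_all
      have "V = contour_integral (rectpath a1 a3) f" using V by (simp add: contour_integral_unique)
      also have "\<dots> = contour_integral (linepath a1 a2) f + contour_integral (linepath a2 a3) f +
          contour_integral (linepath a3 a4) f + contour_integral (linepath a4 a1) f"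
        unfolding rp using ci by simp
      also have "contour_integral (linepath a2 a3) f = \<i> * I2 n"
        unfolding I2_def using n by (intro contour_integral_linepath_same_Re) (auto simp: a2_def a3_def)
      also have "contour_integral (linepath a4 a1) f = - contour_integral (linepath a1 a4) f"
        using contour_integral_reversepath[of "linepath a1 a4" f] by simp
      also have "contour_integral (linepath a1 a4) f = \<i> * I1 n"
        unfolding I1_def using n by (intro contour_integral_linepath_same_Re) (auto simp: a1_def a4_def)
      finally have eq: "V - (\<i> * I2 n - \<i> * I1 n) = contour_integral (linepath a1 a2) f + contour_integral (linepath a3 a4) f"
        by simp
      have "norm (contour_integral (linepath a1 a2) f) \<le> e * norm (a2 - a1)"
      proof (rule contour_integral_bound_linepath[OF ci(1)])
        fix x assume "x \<in> closed_segment a1 a2"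
        then have "Re x \<in> {\<sigma>1..\<sigma>2}" "Im x = - real n"
          using sig by (auto simp: a1_def a2_def closed_segment_same_Im closed_segment_eq_real_ivl)
        then have "norm (f (Complex (Re x) (Im x))) \<le> e" using n by (intro T) auto
        then show "norm (f x) \<le> e" by (simp only: complex_surj)
      qed (use e in simp)
      moreover have "norm (contour_integral (linepath a3 a4) f) \<le> e * norm (a4 - a3)"
      proof (rule contour_integral_bound_linepath[OF ci(3)])
        fix x assume "x \<in> closed_segment a3 a4"
        then have "Re x \<in> {\<sigma>1..\<sigma>2}" "Im x = real n"
          using sig by (auto simp: a3_def a4_def closed_segment_same_Im closed_segment_eq_real_ivl)
        then have "norm (f (Complex (Re x) (Im x))) \<le> e" using n by (intro T) auto
        then show "norm (f x) \<le> e" by (simp only: complex_surj)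
      qed (use e in simp)
      moreover have "norm (a2 - a1) = \<sigma>2 - \<sigma>1" "norm (a4 - a3) = \<sigma>2 - \<sigma>1"
        using sig by (simp_all add: a1_def a2_def a3_def a4_def cmod_def)
      ultimately have "norm (V - (\<i> * I2 n - \<i> * I1 n)) \<le> e * (\<sigma>2 - \<sigma>1) + e * (\<sigma>2 - \<sigma>1)"
        unfolding eq by (intro norm_triangle_le) auto
      also have "e * (\<sigma>2 - \<sigma>1) = r / 4" 
      proof -
        define w where "w = \<sigma>2 - \<sigma>1"
        have "w > 0" using sig by (simp add: w_def)
        then show ?thesis unfolding e_def w_def[symmetric] by simp
      qed
      finally show "dist (V - (\<i> * I2 n - \<i> * I1 n)) 0 < r" using r by (simp add: dist_norm)
    qed
  qed
  from LIMSEQ_unique[OF this lim] show ?thesis by simp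
qed

lemma vertical_line_integral_shift_holomorphic:
  assumes sig: "\<sigma>1 < \<sigma>2"
    and int1: "integrable lborel (\<lambda>t. f (Complex \<sigma>1 t))"
    and int2: "integrable lborel (\<lambda>t. f (Complex \<sigma>2 t))"
    and decay: "\<And>e. e > 0 \<Longrightarrow> \<exists>T. \<forall>\<sigma> t. \<sigma>1 \<le> \<sigma> \<and> \<sigma> \<le> \<sigma>2 \<and> \<bar>t\<bar> \<ge> T \<longrightarrow> norm (f (Complex \<sigma> t)) \<le> e"
    and hol: "f holomorphic_on {z. \<sigma>1 \<le> Re z \<and> Re z \<le> \<sigma>2}"
  shows "(LINT t|lborel. f (Complex \<sigma>2 t)) = (LINT t|lborel. f (Complex \<sigma>1 t))"
proof -
  have cv: "convex {z. \<sigma>1 \<le> Re z \<and> Re z \<le> \<sigma>2}"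
    using convex_Int[OF convex_halfspace_Re_ge[of \<sigma>1] convex_halfspace_Re_le[of \<sigma>2]] by (simp add: Collect_conj_eq)
  have "\<i> * (LINT t|lborel. f (Complex \<sigma>2 t)) - \<i> * (LINT t|lborel. f (Complex \<sigma>1 t)) = 0"
  proof (rule vertical_line_integral_shift[OF sig int1 int2 decay])
    fix T :: real assume T: "T \<ge> 1"
    show "(f has_contour_integral 0) (rectpath (Complex \<sigma>1 (- T)) (Complex \<sigma>2 T))"
      by (rule Cauchy_theorem_convex_simple[OF hol cv])
         (use T sig in \<open>auto simp: path_image_rectpath\<close>)
  qed
  then show ?thesis by simp
qed

text \<open>Rectangle and circle wind once around every point of \<open>P\<close>, so their residue
  sums agree. Leaving the answer as a circle integral allows the poles to be estimated by the
  maximum of the function on the circle, without knowing orders or residues.\<close>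

lemma vertical_line_integral_shift_circle:
  assumes sig: "\<sigma>1 < Re z0 - r" "Re z0 + r < \<sigma>2" "r > 0"
    and int1: "integrable lborel (\<lambda>t. f (Complex \<sigma>1 t))"
    and int2: "integrable lborel (\<lambda>t. f (Complex \<sigma>2 t))"
    and decay: "\<And>e. e > 0 \<Longrightarrow> \<exists>T. \<forall>\<sigma> t. \<sigma>1 \<le> \<sigma> \<and> \<sigma> \<le> \<sigma>2 \<and> \<bar>t\<bar> \<ge> T \<longrightarrow> norm (f (Complex \<sigma> t)) \<le> e"
    and S: "open S" "convex S" "{z. \<sigma>1 \<le> Re z \<and> Re z \<le> \<sigma>2} \<subseteq> S"
    and P: "finite P" "P \<subseteq> ball z0 r" and hol: "f holomorphic_on S - P"
  shows "\<i> * (LINT t|lborel. f (Complex \<sigma>2 t)) - \<i> * (LINT t|lborel. f (Complex \<sigma>1 t)) = contour_integral (circlepath z0 r) f"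
proof (rule vertical_line_integral_shift[OF _ int1 int2 decay])
  show "\<sigma>1 < \<sigma>2" using sig by simp
  have bS: "cball z0 r \<subseteq> S"
  proof
    fix z assume "z \<in> cball z0 r"
    then have "\<bar>Re (z0 - z)\<bar> \<le> r" using abs_Re_le_cmod[of "z0 - z"] by (auto simp: dist_norm)
    then show "z \<in> S" using sig S(3) by auto
  qed
  fix T :: real assume T: "T \<ge> \<bar>Im z0\<bar> + r + 1"
  let ?R = "rectpath (Complex \<sigma>1 (- T)) (Complex \<sigma>2 T)"
  have s12: "\<sigma>1 < \<sigma>2" using sig by simp
  have T0: "T > 0" using T sig by simp
  have pim: "path_image ?R \<subseteq> S" using S(3) s12 T0 by (auto simp: path_image_rectpath)
  have box: "z \<in> box (Complex \<sigma>1 (- T)) (Complex \<sigma>2 T)" if "z \<in> ball z0 r" for z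
  proof -
    have "\<bar>Re (z0 - z)\<bar> < r" "\<bar>Im (z0 - z)\<bar> < r"
      using abs_Re_le_cmod[of "z0 - z"] abs_Im_le_cmod[of "z0 - z"] that by (auto simp: dist_norm)
    then show ?thesis using sig T by (auto simp: in_box_complex_iff)
  qed
  have disj: "path_image ?R \<inter> P = {}"
  proof -
    have "path_image ?R \<inter> box (Complex \<sigma>1 (- T)) (Complex \<sigma>2 T) = {}"
      using s12 T0 by (intro path_image_rectpath_inter_box) auto
    then show ?thesis using box P(2) by blast
  qed
  have "contour_integral ?R f = 2 * pi * \<i> * (\<Sum>p\<in>P. winding_number ?R p * residue f p)"
  proof (rule Residue_theorem[OF S(1) convex_connected[OF S(2)] P(1) hol])
    show "\<forall>z. z \<notin> S \<longrightarrow> winding_number ?R z = 0"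
      using winding_number_zero_outside[OF _ S(2) _ _ pim] by auto
  qed (use pim disj in auto)
  also have "(\<Sum>p\<in>P. winding_number ?R p * residue f p) = (\<Sum>p\<in>P. winding_number (circlepath z0 r) p * residue f p)"
  proof (rule sum.cong[OF refl])
    fix p assume "p \<in> P"
    then have p: "p \<in> ball z0 r" using P by auto
    have "winding_number ?R p = 1" by (rule winding_number_rectpath[OF box[OF p]])
    moreover have "winding_number (circlepath z0 r) p = 1"
      using p by (intro winding_number_circlepath) (auto simp: dist_norm norm_minus_commute)
    ultimately show "winding_number ?R p * residue f p = winding_number (circlepath z0 r) p * residue f p" by simp
  qed
  also have "2 * pi * \<i> * \<dots> = contour_integral (circlepath z0 r) f"
  proof (rule Residue_theorem[OF S(1) convex_connected[OF S(2)] P(1) hol, symmetric])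
    have pc: "path_image (circlepath z0 r) \<subseteq> S" using bS sig by auto
    show "\<forall>z. z \<notin> S \<longrightarrow> winding_number (circlepath z0 r) z = 0"
      using winding_number_zero_outside[OF _ S(2) _ _ pc] by auto
    show "path_image (circlepath z0 r) \<subseteq> S - P" using pc P sig by auto
  qed auto
  finally have "contour_integral ?R f = contour_integral (circlepath z0 r) f" .
  moreover have "f contour_integrable_on ?R"
  proof (rule contour_integrable_holomorphic_simple[OF hol])
    show "open (S - P)" using S(1) P(1) by (simp add: open_Diff finite_imp_closed)
    show "path_image ?R \<subseteq> S - P" using pim disj by auto
  qed auto
  ultimately show "(f has_contour_integral contour_integral (circlepath z0 r) f) ?R"
    by (metis has_contour_integral_integral)
qed

subsection \<open>A compactly supported test kernel\<close>

lemma integrable_one_plus_abs_powr: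
  fixes p :: real assumes p: "p > 1"
  shows "integrable lborel (\<lambda>t::real. (1 + \<bar>t\<bar>) powr (- p))"
proof -
  define g where "g t = indicator {0..} t * (1 + t) powr (- p)" for t :: real
  have "(\<integral>\<^sup>+t. ennreal ((1 + t) powr (- p)) * indicator {0..} t \<partial>lborel) = ennreal (0 - (- (1 / (p - 1))))"
  proof (rule nn_integral_FTC_atLeast[where F = "\<lambda>t. (1 + t) powr (1 - p) / (1 - p)", THEN trans])
    show "((\<lambda>t. (1 + t) powr (1 - p) / (1 - p)) has_real_derivative (1 + t) powr (- p)) (at t)" if "0 \<le> t" for t
      using that p by (auto intro!: derivative_eq_intros)
    have "((\<lambda>t. (1 + t) powr (1 - p)) \<longlongrightarrow> 0) at_top"
      using p by (intro tendsto_neg_powr filterlim_tendsto_add_at_top[OF tendsto_const filterlim_ident]) auto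
    from tendsto_divide[OF this tendsto_const[of "1 - p"]] p
    show "((\<lambda>t. (1 + t) powr (1 - p) / (1 - p)) \<longlongrightarrow> 0) at_top" by simp
    show "ennreal (0 - (1 + 0) powr (1 - p) / (1 - p)) = ennreal (0 - - (1 / (p - 1)))"
      using p by (simp add: field_simps)
  qed auto
  moreover have "(\<lambda>t. ennreal ((1 + t) powr (- p)) * indicator {0..} t) = (\<lambda>t. ennreal (g t))"
    by (auto simp: g_def indicator_def)
  ultimately have "(\<integral>\<^sup>+t. ennreal (g t) \<partial>lborel) < \<infinity>" by simp
  moreover have "g \<in> borel_measurable borel" unfolding g_def by measurable
  ultimately have g: "integrable lborel g"
    by (intro integrableI_nonneg) (auto simp: g_def indicator_def intro!: AE_I2)
  have g': "integrable lborel (\<lambda>t. g (- t))"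
    using lborel_integrable_real_affine[OF g, of "-1" 0] by simp
  show ?thesis
    by (rule Bochner_Integration.integrable_bound[OF Bochner_Integration.integrable_add[OF g g']])
      (auto simp: g_def indicator_def intro!: AE_I2)
qed

text \<open>
  The Mellin transform of a spline supported on \<open>[e\<^bsup>-Nh\<^esup>, 1]\<close>. It vanishes to order \<open>N - M\<close> at \<open>0\<close>, which
  makes the contribution of the poles of the Dirichlet series small. In HOL its value at \<open>0\<close> is \<open>0\<close>.
\<close>

definition diff_kernel :: "real \<Rightarrow> nat \<Rightarrow> nat \<Rightarrow> complex \<Rightarrow> complex" where
  "diff_kernel h N M s = (exp (of_real h * s) - 1) ^ N / s ^ M"

lemma norm_exp_minus_1_le: "norm (exp (of_real h * s) - 1) \<le> exp (h * Re s) + 1"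
  using norm_triangle_ineq4[of "exp (of_real h * s)" 1] by simp

lemma norm_inverse_power_line_le:
  assumes "norm s \<ge> 1" "M \<ge> 2"
  shows "norm (1 / s ^ M) \<le> 4 * (1 + \<bar>Im s\<bar>) powr (- 2)"
proof -
  have "1 + \<bar>Im s\<bar> \<le> 2 * norm s" using abs_Im_le_cmod[of s] assms by linarith
  then have "(1 + \<bar>Im s\<bar>)^2 \<le> (2 * norm s)^2" by (intro power_mono) auto
  moreover have "norm s ^ 2 \<le> norm s ^ M" using assms by (intro power_increasing) auto
  ultimately have a: "(1 + \<bar>Im s\<bar>)^2 / 4 \<le> norm s ^ M" by (simp add: power_mult_distrib)
  have "0 < norm s ^ M" using assms by (intro zero_less_power) linarith
  have "norm (1 / s ^ M) = 1 / norm s ^ M" by (simp add: norm_divide norm_power)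
  also have "\<dots> \<le> 1 / ((1 + \<bar>Im s\<bar>)^2 / 4)" using a \<open>0 < norm s ^ M\<close>
    by (intro divide_left_mono mult_pos_pos) auto
  also have "\<dots> = 4 * (1 + \<bar>Im s\<bar>) powr (- 2)" by (simp add: powr_minus_divide)
  finally show ?thesis .
qed

lemma norm_diff_kernel_le:
  assumes "norm s \<ge> 1" "M \<ge> 2"
  shows "norm (diff_kernel h N M s) \<le> (exp (h * Re s) + 1) ^ N * (4 * (1 + \<bar>Im s\<bar>) powr (- 2))"
proof -
  have "norm (diff_kernel h N M s) = norm (exp (of_real h * s) - 1) ^ N * norm (1 / s ^ M)"
    by (simp add: diff_kernel_def norm_divide norm_power)
  also have "\<dots> \<le> (exp (h * Re s) + 1) ^ N * (4 * (1 + \<bar>Im s\<bar>) powr (- 2))"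
    by (intro mult_mono power_mono norm_exp_minus_1_le norm_inverse_power_line_le assms) auto
  finally show ?thesis .
qed

lemma one_plus_abs_powr_small:
  fixes C e p :: real assumes "e > 0" "p > 0"
  shows "\<exists>T\<ge>1. \<forall>t. \<bar>t\<bar> \<ge> T \<longrightarrow> C * (1 + \<bar>t\<bar>) powr (- p) \<le> e"
proof -
  have "((\<lambda>t. C * (1 + t) powr (- p)) \<longlongrightarrow> C * 0) at_top"
    using assms by (intro tendsto_intros tendsto_neg_powr filterlim_tendsto_add_at_top[OF tendsto_const filterlim_ident]) auto
  then have "eventually (\<lambda>t. C * (1 + t) powr (- p) < e) at_top" using assms by (intro order_tendstoD) auto
  then obtain T where T: "\<And>t. t \<ge> T \<Longrightarrow> C * (1 + t) powr (- p) < e" by (auto simp: eventually_at_top_linorder)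
  show ?thesis by (rule exI[of _ "max T 1"]) (auto intro!: less_imp_le[OF T])
qed

lemma continuous_on_Complex_line [continuous_intros]: "continuous_on A (Complex \<sigma>)"
proof -
  have "Complex \<sigma> = (\<lambda>t. of_real \<sigma> + \<i> * of_real t)" by (auto simp: complex_eq_iff)
  then show ?thesis by (auto intro!: continuous_intros)
qed

lemma integrable_line_bound:
  fixes f :: "real \<Rightarrow> complex"
  assumes "p > 1" "continuous_on UNIV f" "\<And>t. norm (f t) \<le> C * (1 + \<bar>t\<bar>) powr (- p)"
  shows "integrable lborel f"
proof (rule Bochner_Integration.integrable_bound)
  show "integrable lborel (\<lambda>t::real. C * (1 + \<bar>t\<bar>) powr (- p))"
    by (intro integrable_mult_right integrable_one_plus_abs_powr assms)
  show "f \<in> borel_measurable lborel" using assms(2) by (simp add: borel_measurable_continuous_onI)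
  show "AE t in lborel. norm (f t) \<le> norm (C * (1 + \<bar>t\<bar>) powr (- p))"
    using assms(3) by (intro AE_I2) (metis abs_ge_self order_trans real_norm_def)
qed

lemma norm_integral_line_le:
  fixes f :: "real \<Rightarrow> complex"
  assumes "p > 1" "integrable lborel f" "\<And>t. norm (f t) \<le> C * (1 + \<bar>t\<bar>) powr (- p)"
  shows "norm (LINT t|lborel. f t) \<le> C * (LINT t|lborel. (1 + \<bar>t\<bar>) powr (- p))"
proof -
  have "norm (LINT t|lborel. f t) \<le> (LINT t|lborel. norm (f t))" by (rule integral_norm_bound)
  also have "\<dots> \<le> (LINT t|lborel. C * (1 + \<bar>t\<bar>) powr (- p))"
    using assms by (intro integral_mono integrable_mult_right integrable_one_plus_abs_powr integrable_norm) auto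
  finally show ?thesis by simp
qed

lemma continuous_on_diff_kernel_line:
  assumes "\<sigma> \<noteq> 0"
  shows "continuous_on UNIV (\<lambda>t. diff_kernel h N M (Complex \<sigma> t))"
proof -
  have "Complex \<sigma> t \<noteq> 0" for t using assms by (simp add: complex_eq_iff)
  then show ?thesis unfolding diff_kernel_def by (auto intro!: continuous_intros)
qed

lemma diff_kernel_exp_bound:
  assumes "norm s \<ge> 1" "M \<ge> 2"
  shows "norm (diff_kernel h N M s * exp (of_real L * s)) \<le>
    ((exp (h * Re s) + 1) ^ N * exp (L * Re s) * 4) * (1 + \<bar>Im s\<bar>) powr (- 2)"
proof -
  have "norm (exp (of_real L * s)) = exp (L * Re s)" by simp
  then show ?thesis
    using mult_right_mono[OF norm_diff_kernel_le[OF assms], of "exp (L * Re s)" h N, OF exp_ge_zero]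
    by (simp only: norm_mult) (simp only: mult_ac)
qed

lemma integrable_diff_kernel_exp:
  assumes "\<bar>\<sigma>\<bar> \<ge> 1" "M \<ge> 2"
  shows "integrable lborel (\<lambda>t. diff_kernel h N M (Complex \<sigma> t) * exp (of_real L * Complex \<sigma> t))"
proof (rule integrable_line_bound[where p = 2])
  show "continuous_on UNIV (\<lambda>t. diff_kernel h N M (Complex \<sigma> t) * exp (of_real L * Complex \<sigma> t))"
    using assms by (auto intro!: continuous_intros continuous_on_diff_kernel_line)
  show "norm (diff_kernel h N M (Complex \<sigma> t) * exp (of_real L * Complex \<sigma> t)) \<le> 
     ((exp (h * \<sigma>) + 1) ^ N * exp (L * \<sigma>) * 4) * (1 + \<bar>t\<bar>) powr (- 2)" for t
    using diff_kernel_exp_bound[of "Complex \<sigma> t" M h N L] assms abs_Re_le_cmod[of "Complex \<sigma> t"] by simp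
qed auto

lemma norm_integral_diff_kernel_exp_le:
  assumes "\<bar>\<sigma>\<bar> \<ge> 1" "M \<ge> 2"
  shows "norm (LINT t|lborel. diff_kernel h N M (Complex \<sigma> t) * exp (of_real L * Complex \<sigma> t)) \<le>
    (exp (h * \<sigma>) + 1) ^ N * exp (L * \<sigma>) * 4 * (LINT t|lborel. (1 + \<bar>t\<bar>) powr (- 2))"
proof (rule norm_integral_line_le[OF _ integrable_diff_kernel_exp[OF assms]])
  show "norm (diff_kernel h N M (Complex \<sigma> t) * exp (of_real L * Complex \<sigma> t)) \<le> 
     ((exp (h * \<sigma>) + 1) ^ N * exp (L * \<sigma>) * 4) * (1 + \<bar>t\<bar>) powr (- 2)" for t
    using diff_kernel_exp_bound[of "Complex \<sigma> t" M h N L] assms abs_Re_le_cmod[of "Complex \<sigma> t"] by simp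
qed auto

text \<open>Every exponential in (exp (h s) - 1)^N exp (L s) has exponent at most L + N h < 0, and
  there is no pole to the right; moving the line to +infinity shows that the spline vanishes on one
  side of its support.\<close>

lemma diff_kernel_integral_zero_right:
  assumes "h > 0" "L + real N * h < 0" "\<sigma> \<ge> 1" "M \<ge> 2"
  shows "(LINT t|lborel. diff_kernel h N M (Complex \<sigma> t) * exp (of_real L * Complex \<sigma> t)) = 0"
proof -
  define I where "I \<sigma> = (LINT t|lborel. diff_kernel h N M (Complex \<sigma> t) * exp (of_real L * Complex \<sigma> t))" for \<sigma>
  define J :: real where "J = integral\<^sup>L lborel (\<lambda>t::real. (1 + \<bar>t\<bar>) powr (- 2))"
  have eq: "I \<sigma>' = I \<sigma>" if "\<sigma>' > \<sigma>" for \<sigma>'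
    unfolding I_def
  proof (rule vertical_line_integral_shift_holomorphic[where f = "\<lambda>s. diff_kernel h N M s * exp (of_real L * s)"])
    fix e :: real assume e: "e > 0"
    define C where "C = (exp (h * \<sigma>') + 1) ^ N * exp (\<bar>L\<bar> * \<sigma>') * 4"
    obtain T where T: "\<And>t. \<bar>t\<bar> \<ge> T \<Longrightarrow> C * (1 + \<bar>t\<bar>) powr (- 2) \<le> e"
      using one_plus_abs_powr_small[OF e, of 2 C] by auto
    show "\<exists>T. \<forall>\<sigma>'' t. \<sigma> \<le> \<sigma>'' \<and> \<sigma>'' \<le> \<sigma>' \<and> T \<le> \<bar>t\<bar> \<longrightarrow>
      norm (diff_kernel h N M (Complex \<sigma>'' t) * exp (of_real L * Complex \<sigma>'' t)) \<le> e"
    proof (intro exI[of _ T] allI impI)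
      fix s t assume A: "\<sigma> \<le> s \<and> s \<le> \<sigma>' \<and> T \<le> \<bar>t\<bar>"
      have "norm (diff_kernel h N M (Complex s t) * exp (of_real L * Complex s t)) \<le> 
        ((exp (h * s) + 1) ^ N * exp (L * s) * 4) * (1 + \<bar>t\<bar>) powr (- 2)"
        using diff_kernel_exp_bound[of "Complex s t" M h N L] assms A abs_Re_le_cmod[of "Complex s t"] by simp
      also have "\<dots> \<le> C * (1 + \<bar>t\<bar>) powr (- 2)"
      proof -
        have "L * s \<le> \<bar>L\<bar> * \<sigma>'" using A assms by (intro mult_mono) auto
        moreover have "h * s \<le> h * \<sigma>'" using A assms by (intro mult_left_mono) auto
        ultimately show ?thesis unfolding C_def by (intro mult_mono power_mono) auto
      qed
      also have "\<dots> \<le> e" using T A by auto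
      finally show "norm (diff_kernel h N M (Complex s t) * exp (of_real L * Complex s t)) \<le> e" .
    qed
  next
    show "(\<lambda>s. diff_kernel h N M s * exp (of_real L * s)) holomorphic_on {z. \<sigma> \<le> Re z \<and> Re z \<le> \<sigma>'}"
      unfolding diff_kernel_def using assms by (auto intro!: holomorphic_intros)
  qed (use that assms in \<open>auto intro!: integrable_diff_kernel_exp\<close>)
  have bd: "norm (I \<sigma>) \<le> (2 ^ N * 4 * J) * exp ((L + real N * h) * \<sigma>')" if "\<sigma>' > \<sigma>" for \<sigma>'
  proof -
    have J0: "J \<ge> 0" unfolding J_def by (intro integral_nonneg_AE) auto
    have "norm (I \<sigma>) = norm (I \<sigma>')" using eq[OF that] by simp
    also have "\<dots> \<le> (exp (h * \<sigma>') + 1) ^ N * exp (L * \<sigma>') * 4 * J"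
      unfolding I_def J_def using that assms by (intro norm_integral_diff_kernel_exp_le) auto
    also have "\<dots> \<le> (2 * exp (h * \<sigma>')) ^ N * exp (L * \<sigma>') * 4 * J"
      using that assms J0 by (intro mult_right_mono power_mono) auto
    also have "\<dots> = (2 ^ N * 4 * J) * exp ((L + real N * h) * \<sigma>')"
      by (simp add: power_mult_distrib algebra_simps exp_add flip: exp_of_nat_mult)
    finally show ?thesis .
  qed
  have "((\<lambda>x. (2 ^ N * 4 * J) * exp ((L + real N * h) * x)) \<longlongrightarrow> (2 ^ N * 4 * J) * 0) at_top"
    using assms(2) by (intro tendsto_intros filterlim_compose[OF exp_at_bot] filterlim_tendsto_neg_mult_at_bot[OF tendsto_const _ filterlim_ident]) auto
  then have "norm (I \<sigma>) \<le> (2 ^ N * 4 * J) * 0"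
    by (rule tendsto_lowerbound) (auto intro!: eventually_mono[OF eventually_gt_at_top[of \<sigma>]] bd)
  then show ?thesis by (simp add: I_def)
qed

text \<open>The other side of the support: all exponents are at least L > 0, so the line moves to
  -infinity. It has to cross 0, where the zero of order N of the numerator absorbs the pole of order
  M.\<close>

lemma diff_kernel_integral_zero_left:
  assumes "h > 0" "L > 0" "\<sigma> \<ge> 1" "M \<ge> 2" "N \<ge> M"
  shows "(LINT t|lborel. diff_kernel h N M (Complex \<sigma> t) * exp (of_real L * Complex \<sigma> t)) = 0"
proof -
  \<comment> \<open>The entire extension of (exp (h s) - 1)/s. The integrand is rewritten with it
    because the HOL value of \<open>diff_kernel\<close> at 0 need not be the limit there.\<close>
  define E where "E s = (if s = 0 then deriv (\<lambda>s. exp (of_real h * s)) 0 else (exp (of_real h * s) - exp (of_real h * 0)) / (s - 0))" for s :: complex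
  have "E holomorphic_on UNIV" unfolding E_def
    by (rule pole_lemma_open) (auto intro!: holomorphic_intros)
  then have fhol: "(\<lambda>s. E s ^ M * (exp (of_real h * s) - 1) ^ (N - M) * exp (of_real L * s)) holomorphic_on UNIV"
    (is "?f holomorphic_on _") by (intro holomorphic_intros)
  have f_eq: "?f s = diff_kernel h N M s * exp (of_real L * s)" if "s \<noteq> 0" for s
    using that assms by (simp add: E_def diff_kernel_def power_divide flip: power_add)
  define J :: real where "J = integral\<^sup>L lborel (\<lambda>t::real. (1 + \<bar>t\<bar>) powr (- 2))"
  have J0: "J \<ge> 0" unfolding J_def by (intro integral_nonneg_AE) auto
  have line: "(\<lambda>t. ?f (Complex x t)) = (\<lambda>t. diff_kernel h N M (Complex x t) * exp (of_real L * Complex x t))"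
    if "\<bar>x\<bar> \<ge> 1" for x
    using that by (intro ext f_eq) (auto simp: complex_eq_iff)
  define I where "I x = (LINT t|lborel. ?f (Complex x t))" for x
  have eq: "I \<sigma> = I (- x)" if "x \<ge> 1" for x
    unfolding I_def
  proof (rule vertical_line_integral_shift_holomorphic)
    show "- x < \<sigma>" using that assms by simp
    show "integrable lborel (\<lambda>t. ?f (Complex (- x) t))" "integrable lborel (\<lambda>t. ?f (Complex \<sigma> t))"
      using line[of "-x"] line[of \<sigma>] that assms by (auto intro!: integrable_diff_kernel_exp)
    show "?f holomorphic_on {z. - x \<le> Re z \<and> Re z \<le> \<sigma>}" using fhol holomorphic_on_subset by blast
    fix e :: real assume e: "e > 0"
    define C where "C = (exp (h * \<sigma>) + 1) ^ N * exp (L * \<sigma>) * 4"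
    obtain T where T: "T \<ge> 1" "\<And>t. \<bar>t\<bar> \<ge> T \<Longrightarrow> C * (1 + \<bar>t\<bar>) powr (- 2) \<le> e"
      using one_plus_abs_powr_small[OF e, of 2 C] by auto
    show "\<exists>T. \<forall>\<sigma>'' t. - x \<le> \<sigma>'' \<and> \<sigma>'' \<le> \<sigma> \<and> T \<le> \<bar>t\<bar> \<longrightarrow> norm (?f (Complex \<sigma>'' t)) \<le> e"
    proof (intro exI[of _ T] allI impI)
      fix s t assume A: "- x \<le> s \<and> s \<le> \<sigma> \<and> T \<le> \<bar>t\<bar>"
      have n1: "norm (Complex s t) \<ge> 1" using A T abs_Im_le_cmod[of "Complex s t"] by simp
      then have "Complex s t \<noteq> 0" by auto
      then have "norm (?f (Complex s t)) = norm (diff_kernel h N M (Complex s t) * exp (of_real L * Complex s t))"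
        by (intro arg_cong[of _ _ norm] f_eq)
      also have "\<dots> \<le> ((exp (h * s) + 1) ^ N * exp (L * s) * 4) * (1 + \<bar>t\<bar>) powr (- 2)"
        using diff_kernel_exp_bound[of "Complex s t" M h N L] assms n1 by simp
      also have "\<dots> \<le> C * (1 + \<bar>t\<bar>) powr (- 2)"
        unfolding C_def using A assms by (intro mult_mono power_mono) auto
      also have "\<dots> \<le> e" using T A by auto
      finally show "norm (?f (Complex s t)) \<le> e" .
    qed
  qed
  have bd: "norm (I \<sigma>) \<le> (2 ^ N * 4 * J) * exp ((- L) * x)" if "x \<ge> 1" for x
  proof -
    have "norm (I \<sigma>) = norm (I (- x))" using eq[OF that] by simp
    also have "\<dots> \<le> (exp (h * (- x)) + 1) ^ N * exp (L * (- x)) * 4 * J"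
      unfolding I_def J_def using that assms line[of "- x"] norm_integral_diff_kernel_exp_le[of "- x" M h N L] by simp
    also have "\<dots> \<le> 2 ^ N * exp (L * (- x)) * 4 * J"
      using that assms J0 by (intro mult_right_mono power_mono) auto
    finally show ?thesis by (simp add: mult_ac)
  qed
  have "((\<lambda>x. (2 ^ N * 4 * J) * exp ((- L) * x)) \<longlongrightarrow> (2 ^ N * 4 * J) * 0) at_top"
    using assms(2) by (intro tendsto_intros filterlim_compose[OF exp_at_bot] filterlim_tendsto_neg_mult_at_bot[OF tendsto_const _ filterlim_ident]) auto
  then have "norm (I \<sigma>) \<le> (2 ^ N * 4 * J) * 0"
    by (rule tendsto_lowerbound) (rule eventually_mono[OF eventually_ge_at_top[of 1] bd], simp_all)
  then have "I \<sigma> = 0" by simp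
  moreover have "\<bar>\<sigma>\<bar> \<ge> 1" using assms by simp
  ultimately show ?thesis unfolding I_def by (simp only: line)
qed

subsection \<open>The inverse Mellin transform of the Gamma function on the boundary of its sector\<close>

text \<open>Compactness of [-T, T] supplies the bound near 0; replacing |t| by 1 + |t| beyond T
  costs the factor (1 + 1/T)^p.\<close>

lemma line_bound_extend:
  fixes f :: "real \<Rightarrow> complex"
  assumes cont: "continuous_on UNIV f" and p: "p \<ge> 0" and T: "T > 0"
    and bd: "\<And>t. \<bar>t\<bar> \<ge> T \<Longrightarrow> norm (f t) \<le> K * \<bar>t\<bar> powr (- p)"
  shows "\<exists>C\<ge>0. \<forall>t. norm (f t) \<le> C * (1 + \<bar>t\<bar>) powr (- p)"
proof -
  have "compact (f ` {-T..T})" by (intro compact_continuous_image continuous_on_subset[OF cont]) auto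
  then have "bounded (f ` {-T..T})" by (rule compact_imp_bounded)
  then obtain B where "\<forall>x\<in>f ` {-T..T}. norm x \<le> B" unfolding bounded_iff by blast
  then have B: "norm (f t) \<le> B" if "\<bar>t\<bar> \<le> T" for t using that by (auto simp: abs_le_iff)
  define C where "C = \<bar>B\<bar> * (1 + T) powr p + \<bar>K\<bar> * (1 + 1 / T) powr p"
  have T1: "(1 + 1 / T) > 0" using T by (simp add: add_pos_pos)
  show ?thesis
  proof (intro exI[of _ C] conjI allI)
    show "C \<ge> 0" by (simp add: C_def)
    fix t :: real
    have inv: "x powr p * x powr (- p) = 1" if "x > 0" for x :: real
      using that by (simp flip: powr_add)
    show "norm (f t) \<le> C * (1 + \<bar>t\<bar>) powr (- p)"
    proof (cases "\<bar>t\<bar> \<le> T")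
      case True
      have "norm (f t) \<le> \<bar>B\<bar> * ((1 + T) powr p * (1 + T) powr (- p))" using B[OF True] T inv[of "1 + T"] by simp
      also have "\<dots> \<le> \<bar>B\<bar> * ((1 + T) powr p * (1 + \<bar>t\<bar>) powr (- p))"
        using True p T by (intro mult_left_mono powr_mono2') auto
      also have "\<dots> \<le> C * (1 + \<bar>t\<bar>) powr (- p)" unfolding C_def mult.assoc[symmetric] by (intro mult_right_mono) auto
      finally show ?thesis .
    next
      case False
      then have t: "\<bar>t\<bar> \<ge> T" "\<bar>t\<bar> > 0" using T by auto
      have "norm (f t) \<le> \<bar>K\<bar> * \<bar>t\<bar> powr (- p)"
        using order.trans[OF bd[OF t(1)] mult_right_mono[OF abs_ge_self[of K]]] by simp
      also have "\<dots> = \<bar>K\<bar> * ((1 + 1 / T) powr p * ((1 + 1 / T) powr (- p) * \<bar>t\<bar> powr (- p)))"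
        using inv[OF T1] by (simp add: mult.assoc[symmetric])
      also have "(1 + 1 / T) powr (- p) * \<bar>t\<bar> powr (- p) = ((1 + 1 / T) * \<bar>t\<bar>) powr (- p)"
        using T1 t by (simp add: powr_mult)
      also have "((1 + 1 / T) * \<bar>t\<bar>) powr (- p) \<le> (1 + \<bar>t\<bar>) powr (- p)"
      proof (rule powr_mono2')
        have "\<bar>t\<bar> / T \<ge> 1" using t T by simp
        then show "1 + \<bar>t\<bar> \<le> (1 + 1 / T) * \<bar>t\<bar>" by (simp add: algebra_simps)
      qed (use p in auto)
      finally have "norm (f t) \<le> \<bar>K\<bar> * ((1 + 1 / T) powr p * (1 + \<bar>t\<bar>) powr (- p))"
        by (simp add: mult_left_mono)
      also have "\<dots> \<le> C * (1 + \<bar>t\<bar>) powr (- p)" unfolding C_def mult.assoc[symmetric] by (intro mult_right_mono) auto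
      finally show ?thesis .
    qed
  qed
qed

lemma Complex_notin_nonpos_Ints:
  assumes "\<And>n::nat. \<sigma> \<noteq> - real n" shows "Complex \<sigma> t \<notin> \<int>\<^sub>\<le>\<^sub>0"
  using assms by (auto elim!: nonpos_Ints_cases' simp: complex_eq_iff)

lemma continuous_on_Gamma_line:
  assumes "\<And>n::nat. \<sigma> \<noteq> - real n" shows "continuous_on UNIV (\<lambda>t. Gamma (Complex \<sigma> t))"
  by (rule continuous_on_compose2[OF continuous_on_Gamma[of "range (Complex \<sigma>)"] continuous_on_Complex_line])
    (use Complex_notin_nonpos_Ints[OF assms] in auto)

text \<open>In one of the two vertical directions exp (\<epsilon> i pi w / 2) grows like exp (pi |Im
  w| / 2), exactly the rate at which Gamma decays. Only the power |Im w|^(Re w - 1/2) is left, which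
  is integrable at infinity for Re w < -1/2.\<close>

lemma norm_Gamma_exp_strip_le:
  fixes \<epsilon> L m :: real assumes "\<bar>\<epsilon>\<bar> = 1" "m \<ge> 0"
  shows "\<exists>K>0. \<forall>w. \<bar>Re w\<bar> \<le> m \<and> \<bar>Im w\<bar> \<ge> 2 * m + 2 \<longrightarrow>
    norm (Gamma w * exp ((of_real \<epsilon> * \<i> * of_real pi / 2 - of_real L) * w)) \<le> K * \<bar>Im w\<bar> powr (Re w - 1/2)"
proof -
  from norm_Gamma_vertical_le[OF assms(2)] obtain K where K: "K > 0" "\<And>w. \<bar>Re w\<bar> \<le> m \<Longrightarrow> \<bar>Im w\<bar> \<ge> 2 * m + 2 \<Longrightarrow>
    norm (Gamma w) \<le> K * \<bar>Im w\<bar> powr (Re w - 1/2) * exp (- pi * \<bar>Im w\<bar> / 2)" by blast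
  show ?thesis
  proof (intro exI[of _ "K * exp (\<bar>L\<bar> * m)"] conjI allI impI)
    show "0 < K * exp (\<bar>L\<bar> * m)" using K by simp
    fix w assume w: "\<bar>Re w\<bar> \<le> m \<and> \<bar>Im w\<bar> \<ge> 2 * m + 2"
    have e: "norm (exp ((of_real \<epsilon> * \<i> * of_real pi / 2 - of_real L) * w)) \<le> exp (pi * \<bar>Im w\<bar> / 2) * exp (\<bar>L\<bar> * m)"
    proof -
      have "Re ((of_real \<epsilon> * \<i> * of_real pi / 2 - of_real L) * w) = - (\<epsilon> * pi * Im w / 2) - L * Re w" by simp
      also have "\<dots> \<le> pi * \<bar>Im w\<bar> / 2 + \<bar>L\<bar> * m"
      proof -
        have "\<bar>\<epsilon> * pi * Im w\<bar> = pi * \<bar>Im w\<bar>" using assms by (simp add: abs_mult)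
        moreover have "\<bar>L * Re w\<bar> \<le> \<bar>L\<bar> * m" using w by (simp add: abs_mult mult_left_mono)
        ultimately show ?thesis by linarith
      qed
      finally have "exp (Re ((of_real \<epsilon> * \<i> * of_real pi / 2 - of_real L) * w)) \<le> exp (pi * \<bar>Im w\<bar> / 2 + \<bar>L\<bar> * m)" by (simp only: exp_le_cancel_iff)
      then show ?thesis by (simp only: norm_exp_eq_Re exp_add)
    qed
    have "norm (Gamma w * exp ((of_real \<epsilon> * \<i> * of_real pi / 2 - of_real L) * w)) \<le>
      (K * \<bar>Im w\<bar> powr (Re w - 1/2) * exp (- pi * \<bar>Im w\<bar> / 2)) * (exp (pi * \<bar>Im w\<bar> / 2) * exp (\<bar>L\<bar> * m))"
      unfolding norm_mult using K w by (intro mult_mono e K) auto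
    also have "\<dots> = K * exp (\<bar>L\<bar> * m) * \<bar>Im w\<bar> powr (Re w - 1/2) * (exp (- pi * \<bar>Im w\<bar> / 2) * exp (pi * \<bar>Im w\<bar> / 2))"
      by (simp only: mult_ac)
    also have "exp (- pi * \<bar>Im w\<bar> / 2) * exp (pi * \<bar>Im w\<bar> / 2) = 1" by (simp flip: exp_add)
    finally show "norm (Gamma w * exp ((of_real \<epsilon> * \<i> * of_real pi / 2 - of_real L) * w)) \<le> K * exp (\<bar>L\<bar> * m) * \<bar>Im w\<bar> powr (Re w - 1/2)" by simp
  qed
qed

lemma Gamma_exp_line_bound:
  fixes \<epsilon> L \<sigma> :: real assumes "\<bar>\<epsilon>\<bar> = 1" "\<sigma> < 1/2" "\<And>n::nat. \<sigma> \<noteq> - real n"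
  shows "\<exists>C\<ge>0. \<forall>t. norm (Gamma (Complex \<sigma> t) * exp ((of_real \<epsilon> * \<i> * of_real pi / 2 - of_real L) * Complex \<sigma> t))
     \<le> C * (1 + \<bar>t\<bar>) powr (- (1/2 - \<sigma>))"
proof -
  from norm_Gamma_exp_strip_le[OF assms(1), of "\<bar>\<sigma>\<bar>" L] obtain K where
    K: "\<And>w. \<bar>Re w\<bar> \<le> \<bar>\<sigma>\<bar> \<Longrightarrow> \<bar>Im w\<bar> \<ge> 2 * \<bar>\<sigma>\<bar> + 2 \<Longrightarrow> norm (Gamma w * exp ((of_real \<epsilon> * \<i> * of_real pi / 2 - of_real L) * w)) \<le> K * \<bar>Im w\<bar> powr (Re w - 1/2)"
    by auto
  show ?thesis
  proof (rule line_bound_extend)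
    show "continuous_on UNIV (\<lambda>t. Gamma (Complex \<sigma> t) * exp ((of_real \<epsilon> * \<i> * of_real pi / 2 - of_real L) * Complex \<sigma> t))"
      by (intro continuous_intros continuous_on_Gamma_line assms)
    show "norm (Gamma (Complex \<sigma> t) * exp ((of_real \<epsilon> * \<i> * of_real pi / 2 - of_real L) * Complex \<sigma> t)) \<le> K * \<bar>t\<bar> powr (- (1/2 - \<sigma>))"
      if "\<bar>t\<bar> \<ge> 2 * \<bar>\<sigma>\<bar> + 2" for t using K[of "Complex \<sigma> t"] that by simp
  qed (use assms in auto)
qed

text \<open>
  The line \<open>Re w = -3/4\<close> is chosen so that the integral still converges absolutely on the boundary of the
  sector; it lies to the left of the pole at \<open>0\<close>, whence the \<open>-1\<close>.
\<close>

lemma Gamma_inverse_Mellin: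
  fixes \<epsilon> X :: real assumes eps: "\<bar>\<epsilon>\<bar> = 1" and X: "X > 0"
  shows "(LINT t|lborel. Gamma (Complex (-3/4) t) * exp ((of_real \<epsilon> * \<i> * of_real pi / 2 - of_real (ln X)) * Complex (-3/4) t))
    = 2 * of_real pi * (exp (\<i> * of_real (\<epsilon> * X)) - 1)"
proof -
  define \<zeta> where "\<zeta> = of_real \<epsilon> * \<i> * of_real pi / 2 - complex_of_real (ln X)"
  \<comment> \<open>\<open>Y\<close> is X turned by a quarter circle, namely -i \<epsilon> X; the
    residue series will sum to exp (-Y) without its constant term.\<close>
  define Y where "Y = exp (- \<zeta>)"
  define f where "f w = Gamma w * exp (\<zeta> * w)" for w
  \<comment> \<open>Between line k and line k + 1 lies only the pole -(k + 1), at distance 1/4 from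
    the former and 3/4 from the latter; its residue is (-Y)^(k+1) / (k+1)!.\<close>
  define J where "J k = (LINT t|lborel. f (Complex (-3/4 - real k) t))" for k :: nat
  have eps': "\<epsilon> = 1 \<or> \<epsilon> = -1" using eps by linarith
  have Y: "Y = - \<i> * of_real (\<epsilon> * X)"
  proof -
    have "Y = exp (of_real (ln X)) * exp (- (of_real \<epsilon> * \<i> * of_real pi / 2))"
      unfolding Y_def \<zeta>_def by (simp flip: exp_add)
    also have "exp (of_real (ln X)) = complex_of_real X" using X by (simp only: exp_of_real exp_ln)
    also have "exp (- (of_real \<epsilon> * \<i> * of_real pi / 2)) = - \<i> * of_real \<epsilon>"
      using eps' by (auto simp: exp_eq_polar complex_eq_iff Re_exp Im_exp)
    finally show ?thesis by (simp add: mult_ac)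
  qed
  have nY: "norm Y = X" using X eps by (simp add: Y norm_mult abs_mult)
  have ni: "-3/4 - real k \<noteq> - real n" for k n
  proof
    assume "-3/4 - real k = - real n"
    then have "real (4 * n) = real (4 * k + 3)" by simp
    then have "4 * n = 4 * k + 3" by (simp only: of_nat_eq_iff)
    then show False by presburger
  qed
  have fb: "\<exists>C\<ge>0. \<forall>t. norm (f (Complex (-3/4 - real k) t)) \<le> C * (1 + \<bar>t\<bar>) powr (- (1/2 - (-3/4 - real k)))" for k
    unfolding f_def \<zeta>_def using ni[of k] eps by (intro Gamma_exp_line_bound) auto
  have int: "integrable lborel (\<lambda>t. f (Complex (-3/4 - real k) t))" for k
  proof -
    from fb[of k] obtain C where C: "\<And>t. norm (f (Complex (-3/4 - real k) t)) \<le> C * (1 + \<bar>t\<bar>) powr (- (1/2 - (-3/4 - real k)))" by blast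
    show ?thesis
    proof (rule integrable_line_bound[OF _ _ C])
      show "continuous_on UNIV (\<lambda>t. f (Complex (-3/4 - real k) t))"
        unfolding f_def by (intro continuous_intros continuous_on_Gamma_line ni)
    qed simp
  qed
  have step: "J k - J (Suc k) = 2 * of_real pi * ((- Y) ^ Suc k / fact (Suc k))" for k
  proof -
    define z0 :: complex where "z0 = - of_nat (Suc k)"
    define S where "S = {w. - real k - 2 < Re w} \<inter> {w. Re w < - real k}"
    have Sop: "open S" "convex S" unfolding S_def
      by (auto intro!: open_Int convex_Int open_halfspace_Re_gt open_halfspace_Re_lt convex_halfspace_Re_gt convex_halfspace_Re_lt)
    have z0S: "z0 \<in> S" by (simp add: S_def z0_def)
    have pole: "w = z0" if w: "w \<in> S" "w \<in> \<int>\<^sub>\<le>\<^sub>0" for w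
    proof -
      from w(2) obtain n where n: "w = - of_nat n" by (elim nonpos_Ints_cases')
      have "real n < real k + 2" "real k < real n" using w(1) by (auto simp: n S_def)
      then have "n = Suc k" by linarith
      then show ?thesis by (simp add: n z0_def)
    qed
    have hol: "f holomorphic_on S - {z0}"
      unfolding f_def by (intro holomorphic_intros) (use pole in auto)
    have sb: "cball z0 (1/8) \<subseteq> S"
    proof
      fix w assume "w \<in> cball z0 (1/8)"
      then have "\<bar>Re (z0 - w)\<bar> \<le> 1/8" using abs_Re_le_cmod[of "z0 - w"] by (auto simp: dist_norm)
      then have "- (1/8) \<le> Re (z0 - w)" "Re (z0 - w) \<le> 1/8" by linarith+
      then show "w \<in> S" by (simp add: S_def z0_def)
    qed
    have "\<i> * J k - \<i> * J (Suc k) = contour_integral (circlepath z0 (1/8)) f"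
      unfolding J_def
    proof (rule vertical_line_integral_shift_circle[OF _ _ _ _ _ _ Sop _ _ _ hol])
      show "- 3 / 4 - real (Suc k) < Re z0 - 1 / 8" "Re z0 + 1 / 8 < - 3 / 4 - real k" by (auto simp: z0_def)
      show "integrable lborel (\<lambda>t. f (Complex (- 3 / 4 - real (Suc k)) t))" "integrable lborel (\<lambda>t. f (Complex (- 3 / 4 - real k) t))"
        by (rule int)+
      show "{z. - 3 / 4 - real (Suc k) \<le> Re z \<and> Re z \<le> - 3 / 4 - real k} \<subseteq> S" by (auto simp: S_def)
      show "{z0} \<subseteq> ball z0 (1/8)" by simp
      fix e :: real assume e: "e > 0"
      define m where "m = real k + 2"
      from norm_Gamma_exp_strip_le[OF eps, of m "ln X"] obtain K where
        K: "\<And>w. \<bar>Re w\<bar> \<le> m \<Longrightarrow> \<bar>Im w\<bar> \<ge> 2 * m + 2 \<Longrightarrow> norm (f w) \<le> K * \<bar>Im w\<bar> powr (Re w - 1/2)" "K > 0"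
        unfolding f_def \<zeta>_def m_def by auto
      have "((\<lambda>t. K * t powr (- (5/4))) \<longlongrightarrow> K * 0) at_top"
        by (intro tendsto_intros tendsto_neg_powr filterlim_ident) auto
      then have "eventually (\<lambda>t. K * t powr (- (5/4)) < e) at_top" using e by (intro order_tendstoD) auto
      then obtain T where T: "\<And>t. t \<ge> T \<Longrightarrow> K * t powr (- (5/4)) < e" by (auto simp: eventually_at_top_linorder)
      show "\<exists>T. \<forall>\<sigma> t. - 3 / 4 - real (Suc k) \<le> \<sigma> \<and> \<sigma> \<le> - 3 / 4 - real k \<and> T \<le> \<bar>t\<bar> \<longrightarrow> norm (f (Complex \<sigma> t)) \<le> e"
      proof (intro exI[of _ "max T (2 * m + 2)"] allI impI)
        fix \<sigma> t assume A: "- 3 / 4 - real (Suc k) \<le> \<sigma> \<and> \<sigma> \<le> - 3 / 4 - real k \<and> max T (2 * m + 2) \<le> \<bar>t\<bar>"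
        have "norm (f (Complex \<sigma> t)) \<le> K * \<bar>t\<bar> powr (\<sigma> - 1/2)"
          using K(1)[of "Complex \<sigma> t"] A by (auto simp: m_def)
        also have "\<dots> \<le> K * \<bar>t\<bar> powr (- (5/4))" using A K(2) by (intro mult_left_mono powr_mono) (auto simp: m_def)
        also have "\<dots> \<le> e" using T[of "\<bar>t\<bar>"] A by auto
        finally show "norm (f (Complex \<sigma> t)) \<le> e" .
      qed
    qed auto
    also have "\<dots> = 2 * of_real pi * \<i> * residue f z0"
      using contour_integral_unique[OF base_residue[OF Sop(1) z0S _ hol sb]] by simp
    also have "residue f z0 = (-1) ^ Suc k / fact (Suc k) * exp (\<zeta> * z0)"
    proof (rule residue_simple'[OF Sop(1) z0S hol])
      have "((\<lambda>w. (Gamma w * (w + of_nat (Suc k))) * exp (\<zeta> * w)) \<longlongrightarrow> (-1) ^ Suc k / fact (Suc k) * exp (\<zeta> * z0)) (at z0)"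
        unfolding z0_def by (intro tendsto_mult Gamma_residues tendsto_intros)
      moreover have "(\<lambda>w. f w * (w - z0)) = (\<lambda>w. (Gamma w * (w + of_nat (Suc k))) * exp (\<zeta> * w))"
        by (simp add: f_def z0_def mult_ac del: of_nat_Suc)
      ultimately show "((\<lambda>w. f w * (w - z0)) \<longlongrightarrow> (-1) ^ Suc k / fact (Suc k) * exp (\<zeta> * z0)) (at z0)"
        by (simp only:)
    qed
    also have "exp (\<zeta> * z0) = Y ^ Suc k" 
    proof -
      have "\<zeta> * z0 = of_nat (Suc k) * (- \<zeta>)" by (simp add: z0_def algebra_simps)
      then show ?thesis unfolding Y_def by (simp only: exp_of_nat_mult)
    qed
    finally have "\<i> * (J k - J (Suc k)) = \<i> * (2 * of_real pi * ((- Y) ^ Suc k / fact (Suc k)))"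
      by (simp add: algebra_simps power_minus[of Y])
    then show ?thesis by (rule mult_left_cancel[OF complex_i_not_zero, THEN iffD1])
  qed
  have sum: "J 0 - J n = 2 * of_real pi * ((\<Sum>k<Suc n. (- Y) ^ k / fact k) - 1)" for n
  proof (induction n)
    case (Suc n)
    have "J 0 - J (Suc n) = (J 0 - J n) + (J n - J (Suc n))" by simp
    also have "\<dots> = 2 * of_real pi * ((\<Sum>k<Suc n. (- Y) ^ k / fact k) - 1) + 2 * of_real pi * ((- Y) ^ Suc n / fact (Suc n))"
      by (simp only: Suc step)
    also have "\<dots> = 2 * of_real pi * ((\<Sum>k<Suc (Suc n). (- Y) ^ k / fact k) - 1)"
      unfolding sum.lessThan_Suc[of _ "Suc n"] by (simp only: ring_distribs) simp
    finally show ?case .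
  qed simp
  \<comment> \<open>Each use of Gamma (w + 1) = w Gamma w to pass from line k to line k + 1 gains
    |w| \<ge> k + 1. The resulting 1/k! beats |Y|^k and sends the remainder \<open>J k\<close> to
    0.\<close>
  have Gle: "norm (Gamma (Complex (-3/4 - real k) t)) \<le> norm (Gamma (Complex (-3/4) t)) / fact k" for k t
  proof (induction k)
    case (Suc k)
    define w where "w = Complex (-3/4 - real (Suc k)) t"
    have "w \<notin> \<int>\<^sub>\<le>\<^sub>0" unfolding w_def by (intro Complex_notin_nonpos_Ints ni)
    then have "Gamma (w + 1) = w * Gamma w" by (rule Gamma_plus1)
    moreover have "w + 1 = Complex (-3/4 - real k) t" by (simp add: w_def complex_eq_iff)
    ultimately have a: "norm w * norm (Gamma w) = norm (Gamma (Complex (-3/4 - real k) t))" by (simp flip: norm_mult)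
    have "norm w \<ge> real (Suc k)" using abs_Re_le_cmod[of w] by (simp add: w_def)
    then have "real (Suc k) * norm (Gamma w) \<le> norm (Gamma (Complex (-3/4 - real k) t))"
      unfolding a[symmetric] by (intro mult_right_mono) auto
    also have "\<dots> \<le> norm (Gamma (Complex (-3/4) t)) / fact k" by (rule Suc)
    finally have "(real (Suc k) * norm (Gamma w)) * fact k \<le> norm (Gamma (Complex (-3/4) t))"
      by (simp only: pos_le_divide_eq[OF fact_gt_zero])
    then show ?case unfolding w_def[symmetric] pos_le_divide_eq[OF fact_gt_zero] by (simp add: algebra_simps)
  qed simp
  define J' where "J' = (LINT t|lborel. norm (f (Complex (-3/4) t)))"
  have Jn: "norm (J k) \<le> J' * (norm Y ^ k / fact k)" for k
  proof -
    have "norm (J k) \<le> (LINT t|lborel. norm (f (Complex (-3/4 - real k) t)))" unfolding J_def by (rule integral_norm_bound)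
    also have "\<dots> \<le> (LINT t|lborel. (norm Y ^ k / fact k) * norm (f (Complex (-3/4) t)))"
    proof (rule integral_mono)
      show "integrable lborel (\<lambda>t. norm (f (Complex (-3/4 - real k) t)))" by (intro integrable_norm int)
      show "integrable lborel (\<lambda>t. (norm Y ^ k / fact k) * norm (f (Complex (-3/4) t)))" 
        using int[of 0] by (intro integrable_mult_right integrable_norm) simp
      fix t
      have "Complex (-3/4 - real k) t = Complex (-3/4) t - of_nat k" by (simp add: complex_eq_iff)
      then have "\<zeta> * Complex (-3/4 - real k) t = \<zeta> * Complex (-3/4) t + of_nat k * (- \<zeta>)" by (simp only:) (simp add: algebra_simps)
      then have "exp (\<zeta> * Complex (-3/4 - real k) t) = exp (\<zeta> * Complex (-3/4) t) * Y ^ k"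
        unfolding Y_def by (simp only: exp_add exp_of_nat_mult)
      then have "norm (f (Complex (-3/4 - real k) t)) = norm (Gamma (Complex (-3/4 - real k) t)) * (norm (exp (\<zeta> * Complex (-3/4) t)) * norm Y ^ k)"
        by (simp only: f_def norm_mult norm_power)
      also have "\<dots> \<le> (norm (Gamma (Complex (-3/4) t)) / fact k) * (norm (exp (\<zeta> * Complex (-3/4) t)) * norm Y ^ k)"
        by (intro mult_right_mono Gle) auto
      also have "\<dots> = (norm Y ^ k / fact k) * norm (f (Complex (-3/4) t))" unfolding f_def norm_mult by (simp only: times_divide_eq_left times_divide_eq_right mult_ac)
      finally show "norm (f (Complex (-3/4 - real k) t)) \<le> (norm Y ^ k / fact k) * norm (f (Complex (-3/4) t))" .
    qed
    also have "\<dots> = J' * (norm Y ^ k / fact k)" by (simp add: J'_def mult.commute)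
    finally show ?thesis .
  qed
  have "(\<lambda>k. norm Y ^ k / fact k) \<longlonglongrightarrow> 0"
  proof -
    have "(\<lambda>k. norm Y ^ k / fact k) = (\<lambda>k. inverse (fact k) * norm Y ^ k)" by (simp add: field_simps)
    then show ?thesis using summable_LIMSEQ_zero[OF summable_exp[of "norm Y"]] by (simp only:)
  qed
  then have "(\<lambda>k. J' * (norm Y ^ k / fact k)) \<longlonglongrightarrow> 0" by (rule tendsto_mult_right_zero)
  then have J0: "J \<longlonglongrightarrow> 0" by (rule Lim_null_comparison[OF always_eventually[OF allI[OF Jn]]])
  have "(\<lambda>n. \<Sum>k<n. (- Y) ^ k / fact k) \<longlonglongrightarrow> exp (- Y)"
  proof -
    have "(- Y) ^ k / fact k = (- Y) ^ k /\<^sub>R fact k" for k by (simp add: scaleR_conv_of_real field_simps)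
    then show ?thesis using exp_converges[of "- Y"] unfolding sums_def by (simp only:)
  qed
  then have "(\<lambda>n. \<Sum>k<Suc n. (- Y) ^ k / fact k) \<longlonglongrightarrow> exp (- Y)" by (rule LIMSEQ_Suc)
  then have "(\<lambda>n. 2 * of_real pi * ((\<Sum>k<Suc n. (- Y) ^ k / fact k) - 1)) \<longlonglongrightarrow> 2 * of_real pi * (exp (- Y) - 1)"
    by (intro tendsto_intros)
  then have "(\<lambda>n. J 0 - J n) \<longlonglongrightarrow> 2 * of_real pi * (exp (- Y) - 1)" by (simp only: sum)
  moreover have "(\<lambda>n. J 0 - J n) \<longlonglongrightarrow> J 0 - 0" by (intro tendsto_intros J0)
  ultimately have "J 0 = 2 * of_real pi * (exp (- Y) - 1)" using LIMSEQ_unique by fastforce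
  then show ?thesis by (simp add: J_def f_def \<zeta>_def Y)
qed

subsection \<open>The quotient of Gamma factors on a vertical line\<close>

lemma prod_near_one:
  fixes f :: "'i \<Rightarrow> real \<Rightarrow> complex"
  assumes "finite I" "\<forall>i\<in>I. \<exists>K\<ge>0. \<forall>\<tau>\<in>S. norm (f i \<tau> - 1) \<le> K / \<bar>\<tau>\<bar>" "\<forall>\<tau>\<in>S. \<bar>\<tau>\<bar> \<ge> 1"
  shows "\<exists>K\<ge>0. \<forall>\<tau>\<in>S. norm ((\<Prod>i\<in>I. f i \<tau>) - 1) \<le> K / \<bar>\<tau>\<bar>"
  using assms(1,2)
proof (induction I rule: finite_induct)
  case empty
  show ?case by (rule exI[of _ 0]) auto
next
  case (insert j I)
  from insert.prems have "\<forall>i\<in>I. \<exists>K\<ge>0. \<forall>\<tau>\<in>S. norm (f i \<tau> - 1) \<le> K / \<bar>\<tau>\<bar>" by simp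
  from insert.IH[OF this] obtain K where K: "K \<ge> 0" "\<And>\<tau>. \<tau> \<in> S \<Longrightarrow> norm ((\<Prod>i\<in>I. f i \<tau>) - 1) \<le> K / \<bar>\<tau>\<bar>" by blast
  from insert.prems obtain K' where K': "K' \<ge> 0" "\<And>\<tau>. \<tau> \<in> S \<Longrightarrow> norm (f j \<tau> - 1) \<le> K' / \<bar>\<tau>\<bar>" by auto
  show ?case
  proof (intro exI[of _ "K' * (1 + K) + K"] conjI ballI)
    show "0 \<le> K' * (1 + K) + K" using K K' by simp
    fix \<tau> assume t: "\<tau> \<in> S"
    then have t1: "\<bar>\<tau>\<bar> \<ge> 1" using assms(3) by auto
    let ?g = "\<Prod>i\<in>I. f i \<tau>"
    have "norm ?g \<le> 1 + K"
    proof -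
      have "norm ?g \<le> norm (?g - 1) + 1" using norm_triangle_ineq[of "?g - 1" 1] by simp
      also have "norm (?g - 1) \<le> K / \<bar>\<tau>\<bar>" by (rule K(2)[OF t])
      also have "K / \<bar>\<tau>\<bar> \<le> K" using K t1 by (simp add: divide_le_eq mult_left_le_one_le mult_le_cancel_left1)
      finally show ?thesis by simp
    qed
    then have "norm ((f j \<tau> - 1) * ?g) \<le> K' / \<bar>\<tau>\<bar> * (1 + K)"
      unfolding norm_mult using K'(2)[OF t] K' by (intro mult_mono) auto
    moreover have "(\<Prod>i\<in>insert j I. f i \<tau>) - 1 = (f j \<tau> - 1) * ?g + (?g - 1)"
      using insert.hyps by (simp add: algebra_simps)
    ultimately have "norm ((\<Prod>i\<in>insert j I. f i \<tau>) - 1) \<le> K' / \<bar>\<tau>\<bar> * (1 + K) + K / \<bar>\<tau>\<bar>"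
      using K(2)[OF t] by (metis (no_types, lifting) add_mono norm_triangle_le)
    also have "\<dots> = (K' * (1 + K) + K) / \<bar>\<tau>\<bar>" by (simp add: add_divide_distrib)
    finally show "norm ((\<Prod>i\<in>insert j I. f i \<tau>) - 1) \<le> (K' * (1 + K) + K) / \<bar>\<tau>\<bar>" .
  qed
qed

lemma exp_minus_le_inverse: "x > 0 \<Longrightarrow> exp (- x) \<le> 1 / (x::real)"
proof -
  assume x: "x > 0"
  have "x \<le> exp x" using exp_ge_add_one_self[of x] by linarith
  then show ?thesis using x by (simp add: exp_minus inverse_eq_divide frac_le)
qed

text \<open>sin y = (i \<epsilon>/2) exp (-i \<epsilon> y) (1 - exp (2 i \<epsilon> y)), and the
  last exponential is negligible as \<epsilon> \<tau> -> -infinity. Its exponential smallness is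
  weakened to O(1/|\<tau>|), the accuracy that Stirling's formula gives anyway.\<close>

lemma sin_prod_line_asymp:
  fixes \<alpha> :: "'i \<Rightarrow> real" and \<beta> :: "'i \<Rightarrow> complex" and \<epsilon> c :: real
  assumes "finite I" "\<forall>i\<in>I. \<alpha> i > 0" "\<epsilon> = 1 \<or> \<epsilon> = -1"
  shows "\<exists>D. D \<noteq> 0 \<and> (\<exists>K\<ge>0. \<forall>\<tau>. \<epsilon> * \<tau> \<le> -1 \<longrightarrow> (\<exists>x. norm x \<le> K / \<bar>\<tau>\<bar> \<and>
    (\<Prod>i\<in>I. sin (of_real pi * (\<beta> i - of_real (\<alpha> i) * Complex c \<tau>)) / of_real pi) = 
     D * exp (of_real \<epsilon> * \<i> * of_real pi * of_real (\<Sum>i\<in>I. \<alpha> i) * Complex c \<tau>) * (1 + x)))"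
proof -
  define y where "y i \<tau> = of_real pi * (\<beta> i - of_real (\<alpha> i) * Complex c \<tau>)" for i \<tau>
  define f where "f i \<tau> = 1 - exp (2 * of_real \<epsilon> * \<i> * y i \<tau>)" for i \<tau>
  define S where "S = {\<tau>. \<epsilon> * \<tau> \<le> -1}"
  have S1: "\<forall>\<tau>\<in>S. \<bar>\<tau>\<bar> \<ge> 1" using assms(3) by (auto simp: S_def)
  have sin_eq: "sin (y i \<tau>) = of_real \<epsilon> * \<i> / 2 * exp (- of_real \<epsilon> * \<i> * y i \<tau>) * f i \<tau>" for i \<tau>
  proof -
    have "sin (y i \<tau>) = \<i> / 2 * (exp (- (\<i> * y i \<tau>)) - exp (\<i> * y i \<tau>))"
      by (simp add: sin_exp_eq field_simps)
    moreover have "exp (- (\<i> * y i \<tau>)) * exp (2 * \<i> * y i \<tau>) = exp (\<i> * y i \<tau>)"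
      "exp (\<i> * y i \<tau>) * exp (- (2 * \<i> * y i \<tau>)) = exp (- (\<i> * y i \<tau>))"
      by (simp_all flip: exp_add)
    ultimately show ?thesis using assms(3) unfolding f_def by (auto simp: algebra_simps)
  qed
  have "\<exists>K\<ge>0. \<forall>\<tau>\<in>S. norm (f i \<tau> - 1) \<le> K / \<bar>\<tau>\<bar>" if i: "i \<in> I" for i
  proof (intro exI[of _ "exp (2 * pi * \<bar>Im (\<beta> i)\<bar>) / (2 * pi * \<alpha> i)"] conjI ballI)
    have a: "\<alpha> i > 0" using assms i by auto
    show "0 \<le> exp (2 * pi * \<bar>Im (\<beta> i)\<bar>) / (2 * pi * \<alpha> i)" using a by simp
    fix \<tau> assume t: "\<tau> \<in> S"
    have t1: "\<epsilon> * \<tau> = - \<bar>\<tau>\<bar>" "\<bar>\<tau>\<bar> \<ge> 1" using t assms(3) by (auto simp: S_def)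
    have "norm (f i \<tau> - 1) = exp (Re (2 * of_real \<epsilon> * \<i> * y i \<tau>))" by (simp add: f_def)
    also have "Re (2 * of_real \<epsilon> * \<i> * y i \<tau>) = 2 * pi * (\<epsilon> * (- Im (\<beta> i))) + 2 * pi * \<alpha> i * (\<epsilon> * \<tau>)"
      by (simp add: y_def algebra_simps)
    also have "\<dots> \<le> 2 * pi * \<bar>Im (\<beta> i)\<bar> + - (2 * pi * \<alpha> i * \<bar>\<tau>\<bar>)"
      unfolding t1(1) using assms(3) by (auto simp: abs_if)
    finally have "norm (f i \<tau> - 1) \<le> exp (2 * pi * \<bar>Im (\<beta> i)\<bar>) * exp (- (2 * pi * \<alpha> i * \<bar>\<tau>\<bar>))"
      by (simp only: exp_add[symmetric] exp_le_cancel_iff)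
    also have "\<dots> \<le> exp (2 * pi * \<bar>Im (\<beta> i)\<bar>) * (1 / (2 * pi * \<alpha> i * \<bar>\<tau>\<bar>))"
      using a t1 by (intro mult_left_mono exp_minus_le_inverse) auto
    finally show "norm (f i \<tau> - 1) \<le> exp (2 * pi * \<bar>Im (\<beta> i)\<bar>) / (2 * pi * \<alpha> i) / \<bar>\<tau>\<bar>" by (simp add: field_simps)
  qed
  then obtain K where K: "K \<ge> 0" "\<And>\<tau>. \<tau> \<in> S \<Longrightarrow> norm ((\<Prod>i\<in>I. f i \<tau>) - 1) \<le> K / \<bar>\<tau>\<bar>"
    using prod_near_one[OF assms(1) _ S1, of f] by blast
  define D where "D = (\<Prod>i\<in>I. of_real \<epsilon> * \<i> / 2 / of_real pi * exp (- of_real \<epsilon> * \<i> * of_real pi * \<beta> i))"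
  have D0: "D \<noteq> 0" unfolding D_def using assms by (auto simp: prod_zero_iff)
  have prod: "(\<Prod>i\<in>I. sin (y i \<tau>) / of_real pi) =
     D * exp (of_real \<epsilon> * \<i> * of_real pi * of_real (\<Sum>i\<in>I. \<alpha> i) * Complex c \<tau>) * (\<Prod>i\<in>I. f i \<tau>)" for \<tau>
  proof -
    have "sin (y i \<tau>) / of_real pi = (of_real \<epsilon> * \<i> / 2 / of_real pi * exp (- of_real \<epsilon> * \<i> * of_real pi * \<beta> i))
       * exp (of_real \<epsilon> * \<i> * of_real pi * of_real (\<alpha> i) * Complex c \<tau>) * f i \<tau>" for i
    proof -
      have "- of_real \<epsilon> * \<i> * y i \<tau> = - of_real \<epsilon> * \<i> * of_real pi * \<beta> i + of_real \<epsilon> * \<i> * of_real pi * of_real (\<alpha> i) * Complex c \<tau>"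
        by (simp add: y_def algebra_simps)
      then show ?thesis unfolding sin_eq by (simp only: exp_add times_divide_eq_left mult.assoc)
    qed
    then have "(\<Prod>i\<in>I. sin (y i \<tau>) / of_real pi) = D * (\<Prod>i\<in>I. exp (of_real \<epsilon> * \<i> * of_real pi * of_real (\<alpha> i) * Complex c \<tau>)) * (\<Prod>i\<in>I. f i \<tau>)"
      unfolding D_def by (simp only: prod.distrib)
    also have "(\<Prod>i\<in>I. exp (of_real \<epsilon> * \<i> * of_real pi * of_real (\<alpha> i) * Complex c \<tau>)) = exp (of_real \<epsilon> * \<i> * of_real pi * of_real (\<Sum>i\<in>I. \<alpha> i) * Complex c \<tau>)"
      using assms(1) by (simp add: exp_sum sum_distrib_left sum_distrib_right)
    finally show ?thesis .
  qed
  show ?thesis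
  proof (intro exI[of _ D] conjI, rule D0, intro exI[of _ K] conjI allI impI)
    show "K \<ge> 0" by (rule K)
    fix \<tau> assume "\<epsilon> * \<tau> \<le> -1"
    then have t: "\<tau> \<in> S" by (simp add: S_def)
    show "\<exists>x. norm x \<le> K / \<bar>\<tau>\<bar> \<and>
    (\<Prod>i\<in>I. sin (of_real pi * (\<beta> i - of_real (\<alpha> i) * Complex c \<tau>)) / of_real pi) = 
     D * exp (of_real \<epsilon> * \<i> * of_real pi * of_real (\<Sum>i\<in>I. \<alpha> i) * Complex c \<tau>) * (1 + x)"
      by (rule exI[of _ "(\<Prod>i\<in>I. f i \<tau>) - 1"]) (use K(2)[OF t] prod[of \<tau>, unfolded y_def] in simp)
  qed
qed


text \<open>
  The main term has size \<open>|\<tau>|\<^bsup>-5/4\<^esup>\<close> on this line. The two exponentials are the dominant parts of the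
  product of sines from the reflection formula in the lower and in the upper half-plane.
\<close>

lemma functional_factor_line_asymp:
  fixes \<alpha> :: "'i \<Rightarrow> real" and \<beta> \<beta>' :: "'i \<Rightarrow> complex" and c :: real and M :: nat
  assumes I: "finite I" "I \<noteq> {}" "\<forall>i\<in>I. \<alpha> i > 0" and c: "c > 0"
    and reg: "\<forall>i\<in>I. \<alpha> i * (1 + c) + Re (\<beta>' i) > 0" "\<forall>i\<in>I. 1 - Re (\<beta> i) + \<alpha> i * c > 0"
  defines "A \<equiv> \<Sum>i\<in>I. \<alpha> i" and "g \<equiv> 1/2 + of_real (\<Sum>i\<in>I. \<alpha> i) + (\<Sum>i\<in>I. \<beta>' i - \<beta> i) - of_nat M"
  assumes line: "2 * A * c + Re g = - 3/4"
  defines "G \<equiv> \<lambda>\<tau>. (\<Prod>i\<in>I. Gamma (of_real (\<alpha> i) * (1 + Complex c \<tau>) + \<beta>' i) * rGamma (\<beta> i - of_real (\<alpha> i) * Complex c \<tau>)) / Complex c \<tau> ^ M"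
  shows "continuous_on UNIV G"
    and "\<exists>D1 D2. \<exists>k1::real. \<exists>K\<ge>0. D1 \<noteq> 0 \<and> (\<forall>\<tau>. norm (G \<tau> - exp (of_real k1 * Complex c \<tau>) * Gamma (of_real (2 * A) * Complex c \<tau> + g) *
      (D1 * exp (\<i> * of_real pi * of_real A * Complex c \<tau>) + D2 * exp (- (\<i> * of_real pi * of_real A * Complex c \<tau>)))) \<le> K * (1 + \<bar>\<tau>\<bar>) powr (- (9/4)))"
proof -
  define u where "u = Complex c"
  have A: "A > 0" unfolding A_def using I by (intro sum_pos) auto
  \<comment> \<open>The reflection formula turns 1/Gamma (\<beta> - \<alpha> u) into Gamma (\<alpha>
    u + 1 - \<beta>) times a sine. Each index thus carries two Gamma factors, collected over the
    disjoint sum \<open>I <+> I\<close>; hence the slope 2 A and the shift \<open>g\<close>.\<close>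
  define \<gamma> where "\<gamma> = case_sum (\<lambda>i. of_real (\<alpha> i) + \<beta>' i) (\<lambda>i. 1 - \<beta> i)"
  define \<alpha>' where "\<alpha>' = case_sum \<alpha> \<alpha>"
  define P where "P \<tau> = (\<Prod>i\<in>I. Gamma (of_real (\<alpha> i) * u \<tau> + (of_real (\<alpha> i) + \<beta>' i))) * (\<Prod>i\<in>I. Gamma (of_real (\<alpha> i) * u \<tau> + (1 - \<beta> i)))" for \<tau>
  define Sn where "Sn \<tau> = (\<Prod>i\<in>I. sin (of_real pi * (\<beta> i - of_real (\<alpha> i) * u \<tau>)) / of_real pi)" for \<tau>
  define w where "w \<tau> = of_real (2 * A) * u \<tau> + g" for \<tau>
  have Pprod: "(\<Prod>i\<in>I <+> I. Gamma (of_real (\<alpha>' i) * Complex c \<tau> + \<gamma> i)) = P \<tau>" for \<tau>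
    using I(1) by (simp add: P_def prod.Plus \<gamma>_def \<alpha>'_def u_def o_def)
  have asum: "(\<Sum>i\<in>I <+> I. \<alpha>' i) = 2 * A" using I(1) by (simp add: sum.Plus \<alpha>'_def A_def o_def)
  have gsum: "1/2 + (\<Sum>i\<in>I <+> I. \<gamma> i - 1/2) - of_nat M = g"
    using I(1) by (simp add: sum.Plus \<gamma>_def g_def o_def sum.distrib sum_subtractf card_Plus algebra_simps)
  have "\<exists>k0. \<exists>k1::real. \<exists>T0>0. \<exists>K\<ge>0. \<forall>\<tau>. \<bar>\<tau>\<bar> \<ge> T0 \<longrightarrow> (\<exists>\<rho>. norm \<rho> \<le> K / \<bar>\<tau>\<bar> \<and>
    P \<tau> / u \<tau> ^ M = exp (k0 + of_real k1 * u \<tau>) * Gamma (w \<tau>) * exp \<rho>)"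
  proof -
    have "finite (I <+> I)" "I <+> I \<noteq> {}" "\<forall>i\<in>I <+> I. \<alpha>' i > 0" using I by (auto simp: \<alpha>'_def)
    from Gamma_prod_line_eq_Gamma[OF this c, of \<gamma> M] show ?thesis
      unfolding Pprod asum gsum w_def u_def .
  qed
  then obtain k0 and k1 :: real and T0 K0 where T0: "T0 > 0" "K0 \<ge> 0" and
    PG: "\<forall>\<tau>. \<bar>\<tau>\<bar> \<ge> T0 \<longrightarrow> (\<exists>\<rho>. norm \<rho> \<le> K0 / \<bar>\<tau>\<bar> \<and>
    P \<tau> / u \<tau> ^ M = exp (k0 + of_real k1 * u \<tau>) * Gamma (w \<tau>) * exp \<rho>)" by (elim exE conjE) (rule that)
  have Geq: "G \<tau> = P \<tau> / u \<tau> ^ M * Sn \<tau>" for \<tau>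
  proof -
    have "rGamma (\<beta> i - of_real (\<alpha> i) * u \<tau>) = Gamma (of_real (\<alpha> i) * u \<tau> + (1 - \<beta> i)) * (sin (of_real pi * (\<beta> i - of_real (\<alpha> i) * u \<tau>)) / of_real pi)"
      if "i \<in> I" for i
    proof -
      define z where "z = \<beta> i - of_real (\<alpha> i) * u \<tau>"
      have z1: "of_real (\<alpha> i) * u \<tau> + (1 - \<beta> i) = 1 - z" by (simp add: z_def)
      have "Re (1 - z) > 0" using reg(2) that by (simp add: z_def u_def algebra_simps)
      moreover have "v \<notin> \<int>\<^sub>\<le>\<^sub>0" if "Re v > 0" for v using that by (auto elim!: nonpos_Ints_cases)
      ultimately have "1 - z \<notin> \<int>\<^sub>\<le>\<^sub>0" by blast
      then have "rGamma (1 - z) * Gamma (1 - z) = 1" by (simp add: rGamma_inverse_Gamma Gamma_eq_zero_iff)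
      then have "rGamma z = Gamma (1 - z) * (rGamma z * rGamma (1 - z))" by (simp add: mult_ac)
      then show ?thesis unfolding z1 z_def[symmetric] by (simp add: rGamma_reflection_complex)
    qed
    then have "(\<Prod>i\<in>I. rGamma (\<beta> i - of_real (\<alpha> i) * u \<tau>)) = (\<Prod>i\<in>I. Gamma (of_real (\<alpha> i) * u \<tau> + (1 - \<beta> i))) * Sn \<tau>"
      unfolding Sn_def prod.distrib[symmetric] by (intro prod.cong) auto
    then show ?thesis unfolding G_def P_def prod.distrib u_def[symmetric] by (simp add: algebra_simps)
  qed
  from sin_prod_line_asymp[OF I(1,3), of 1 \<beta> c] obtain E1 K1 where E1: "E1 \<noteq> 0" "K1 \<ge> 0" and
    S1: "\<And>\<tau>. \<tau> \<le> -1 \<Longrightarrow> (\<exists>x. norm x \<le> K1 / \<bar>\<tau>\<bar> \<and> Sn \<tau> = E1 * exp (of_real 1 * \<i> * of_real pi * of_real A * u \<tau>) * (1 + x))"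
    unfolding Sn_def u_def A_def by auto
  from sin_prod_line_asymp[OF I(1,3), of "-1" \<beta> c] obtain E2 K2 where E2: "E2 \<noteq> 0" "K2 \<ge> 0" and
    S2: "\<And>\<tau>. - \<tau> \<le> -1 \<Longrightarrow> (\<exists>x. norm x \<le> K2 / \<bar>\<tau>\<bar> \<and> Sn \<tau> = E2 * exp (of_real (-1) * \<i> * of_real pi * of_real A * u \<tau>) * (1 + x))"
    unfolding Sn_def u_def A_def by auto
  define main where "main \<epsilon> \<tau> = exp (of_real k1 * u \<tau>) * Gamma (w \<tau>) * exp (of_real \<epsilon> * \<i> * of_real pi * of_real A * u \<tau>)" for \<epsilon> :: real and \<tau>
  define D1 D2 where "D1 = exp k0 * E1" and "D2 = exp k0 * E2"
  \<comment> \<open>On the half-line where the sine exponential of sign \<epsilon> dominates, a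
    single term describes \<open>G\<close> up to the relative error O(1/|\<tau>|).\<close>
  have asymp: "\<exists>K\<ge>0. \<exists>T\<ge>1. \<forall>\<tau>. \<epsilon> * \<tau> \<le> - T \<longrightarrow> norm (G \<tau> - D * main \<epsilon> \<tau>) \<le> K / \<bar>\<tau>\<bar> * norm (main \<epsilon> \<tau>)"
    if e: "\<epsilon> = 1 \<or> \<epsilon> = -1" and D: "D = exp k0 * E" and Kp: "K \<ge> 0"
     and S: "\<And>\<tau>. \<epsilon> * \<tau> \<le> -1 \<Longrightarrow> (\<exists>x. norm x \<le> K / \<bar>\<tau>\<bar> \<and> Sn \<tau> = E * exp (of_real \<epsilon> * \<i> * of_real pi * of_real A * u \<tau>) * (1 + x))"
    for \<epsilon> :: real and D E K
  proof -
    define T where "T = max 1 (max T0 (2 * K0))"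
    define K' where "K' = norm D * (2 * K0 * (1 + K) + K)"
    show ?thesis
    proof (rule exI[of _ K'], intro conjI, simp add: K'_def T0 Kp, rule exI[of _ T], intro conjI allI impI)
      show "T \<ge> 1" by (simp add: T_def)
      fix \<tau> assume t: "\<epsilon> * \<tau> \<le> - T"
      have t1: "\<bar>\<tau>\<bar> \<ge> T0" "\<bar>\<tau>\<bar> \<ge> 1" "\<bar>\<tau>\<bar> \<ge> 2 * K0" "\<epsilon> * \<tau> \<le> -1" using t e by (auto simp: T_def)
      obtain \<rho> where r: "norm \<rho> \<le> K0 / \<bar>\<tau>\<bar>" "P \<tau> / u \<tau> ^ M = exp (k0 + of_real k1 * u \<tau>) * Gamma (w \<tau>) * exp \<rho>"
        using PG t1 by blast
      obtain x where x: "norm x \<le> K / \<bar>\<tau>\<bar>" "Sn \<tau> = E * exp (of_real \<epsilon> * \<i> * of_real pi * of_real A * u \<tau>) * (1 + x)"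
        using S t1 by blast
      have GD: "G \<tau> - D * main \<epsilon> \<tau> = main \<epsilon> \<tau> * D * ((exp \<rho> - 1) * (1 + x) + x)"
        unfolding Geq r(2) x(2) main_def D by (simp add: exp_add algebra_simps)
      have r1: "norm \<rho> \<le> 1 / 2"
      proof -
        have "K0 / \<bar>\<tau>\<bar> \<le> 1 / 2" using t1 by (simp add: divide_le_eq)
        with r(1) show ?thesis by (rule order_trans)
      qed
      have "norm (exp \<rho> - 1) \<le> 2 * norm \<rho>"
      proof -
        have "norm (exp \<rho> - 1) \<le> 3 / 2 * norm \<rho>" by (rule norm_exp_bounds(2)[OF r1])
        then show ?thesis using norm_ge_zero[of \<rho>] by linarith
      qed
      also have "\<dots> \<le> 2 * K0 / \<bar>\<tau>\<bar>" using r(1) by simp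
      finally have er: "norm (exp \<rho> - 1) \<le> 2 * K0 / \<bar>\<tau>\<bar>" .
      have "norm (1 + x) \<le> 1 + K"
      proof -
        have "K / \<bar>\<tau>\<bar> \<le> K" using Kp t1 by (simp add: divide_le_eq mult_le_cancel_left1)
        then show ?thesis using x(1) norm_triangle_ineq[of 1 x] by simp
      qed
      then have "norm ((exp \<rho> - 1) * (1 + x)) \<le> 2 * K0 / \<bar>\<tau>\<bar> * (1 + K)"
        unfolding norm_mult using T0 er by (intro mult_mono) auto
      then have "norm ((exp \<rho> - 1) * (1 + x) + x) \<le> 2 * K0 / \<bar>\<tau>\<bar> * (1 + K) + K / \<bar>\<tau>\<bar>"
        by (rule norm_triangle_le[OF add_mono[OF _ x(1)]])
      also have "\<dots> = (2 * K0 * (1 + K) + K) / \<bar>\<tau>\<bar>" by (simp add: add_divide_distrib)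
      finally have "norm (main \<epsilon> \<tau> * D) * norm ((exp \<rho> - 1) * (1 + x) + x) \<le> norm (main \<epsilon> \<tau> * D) * ((2 * K0 * (1 + K) + K) / \<bar>\<tau>\<bar>)"
        by (intro mult_left_mono) auto
      then show "norm (G \<tau> - D * main \<epsilon> \<tau>) \<le> K' / \<bar>\<tau>\<bar> * norm (main \<epsilon> \<tau>)"
        unfolding GD norm_mult K'_def by (simp add: mult_ac)
    qed
  qed
  have mainb: "\<exists>K\<ge>0. \<exists>T\<ge>1. \<forall>\<tau>. \<bar>\<tau>\<bar> \<ge> T \<longrightarrow> norm (main \<epsilon> \<tau>) \<le> K * \<bar>\<tau>\<bar> powr (- (5/4))"
    if e: "\<epsilon> = 1 \<or> \<epsilon> = -1" for \<epsilon> :: real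
  proof -
    from norm_Gamma_exp_strip_le[of \<epsilon> "3/4" 0] e obtain K where K: "K > 0" and
      Kb: "\<And>w. \<bar>Re w\<bar> \<le> 3/4 \<Longrightarrow> \<bar>Im w\<bar> \<ge> 7/2 \<Longrightarrow> norm (Gamma w * exp ((of_real \<epsilon> * \<i> * of_real pi / 2) * w)) \<le> K * \<bar>Im w\<bar> powr (Re w - 1/2)"
      by auto
    define C where "C = exp (k1 * c) * norm (exp (- (of_real \<epsilon> * \<i> * of_real pi / 2 * g)))"
    define T where "T = max 1 ((7/2 + \<bar>Im g\<bar>) / A)"
    show ?thesis
    proof (rule exI[of _ "C * K * A powr (- (5/4))"], intro conjI, use K in \<open>simp add: C_def\<close>, rule exI[of _ T], intro conjI allI impI)
      show "T \<ge> 1" by (simp add: T_def)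
      fix \<tau> assume "\<bar>\<tau>\<bar> \<ge> T"
      then have "\<bar>\<tau>\<bar> \<ge> 1" "\<bar>\<tau>\<bar> \<ge> (7/2 + \<bar>Im g\<bar>) / A" unfolding T_def by auto
      then have t: "\<bar>\<tau>\<bar> \<ge> 1" "A * \<bar>\<tau>\<bar> \<ge> 7/2 + \<bar>Im g\<bar>" using A by (auto simp: field_simps)
      have wr: "Re (w \<tau>) = -3/4" using line by (simp add: w_def u_def)
      have "\<bar>Im (w \<tau>)\<bar> \<ge> 2 * A * \<bar>\<tau>\<bar> - \<bar>Im g\<bar>"
        using A abs_triangle_ineq2[of "2 * A * \<tau>" "- Im g"] by (simp add: w_def u_def abs_mult)
      then have wi: "\<bar>Im (w \<tau>)\<bar> \<ge> 7/2" "\<bar>Im (w \<tau>)\<bar> \<ge> A * \<bar>\<tau>\<bar>" using t by linarith+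
      have "main \<epsilon> \<tau> = exp (of_real k1 * u \<tau>) * exp (- (of_real \<epsilon> * \<i> * of_real pi / 2 * g)) * (Gamma (w \<tau>) * exp ((of_real \<epsilon> * \<i> * of_real pi / 2) * w \<tau>))"
      proof -
        have "of_real \<epsilon> * \<i> * of_real pi * of_real A * u \<tau> = - (of_real \<epsilon> * \<i> * of_real pi / 2 * g) + (of_real \<epsilon> * \<i> * of_real pi / 2) * w \<tau>"
          by (simp add: w_def algebra_simps)
        then show ?thesis unfolding main_def by (simp only: exp_add mult_ac)
      qed
      then have "norm (main \<epsilon> \<tau>) = C * norm (Gamma (w \<tau>) * exp ((of_real \<epsilon> * \<i> * of_real pi / 2) * w \<tau>))"
        unfolding C_def by (simp only: norm_mult) (simp add: u_def)
      also have "\<dots> \<le> C * (K * \<bar>Im (w \<tau>)\<bar> powr (-3/4 - 1/2))"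
        using Kb[of "w \<tau>"] wr wi by (intro mult_left_mono) (auto simp: C_def)
      also have "\<dots> \<le> C * (K * (A * \<bar>\<tau>\<bar>) powr (-3/4 - 1/2))"
        using wi A t K by (intro mult_left_mono powr_mono2') (auto simp: C_def)
      also have "\<dots> = C * K * A powr (- (5/4)) * \<bar>\<tau>\<bar> powr (- (5/4))" using A by (simp add: powr_mult)
      finally show "norm (main \<epsilon> \<tau>) \<le> C * K * A powr (- (5/4)) * \<bar>\<tau>\<bar> powr (- (5/4))" .
    qed
  qed
  \<comment> \<open>There the other exponential is smaller by exp (-2 pi A |\<tau>|). Both terms may
    therefore be kept on the whole line, as required for applying Mellin inversion to each of
    them.\<close>
  have swap: "norm (main (- \<epsilon>) \<tau>) \<le> 1 / (2 * pi * A) / \<bar>\<tau>\<bar> * norm (main \<epsilon> \<tau>)"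
    if e: "\<epsilon> = 1 \<or> \<epsilon> = -1" and t: "\<epsilon> * \<tau> \<le> -1" for \<epsilon> \<tau> :: real
  proof -
    have te: "\<epsilon> * \<tau> = - \<bar>\<tau>\<bar>" "\<bar>\<tau>\<bar> > 0" using e t by auto
    have "main (- \<epsilon>) \<tau> = main \<epsilon> \<tau> * exp (- (2 * of_real \<epsilon> * \<i> * of_real pi * of_real A * u \<tau>))"
      unfolding main_def mult.assoc mult_exp_exp by (simp add: algebra_simps)
    then have "norm (main (- \<epsilon>) \<tau>) = norm (main \<epsilon> \<tau>) * exp (- (2 * pi * A * (- (\<epsilon> * \<tau>))))"
      by (simp add: norm_mult u_def mult_ac)
    also have "\<dots> = norm (main \<epsilon> \<tau>) * exp (- (2 * pi * A * \<bar>\<tau>\<bar>))" by (simp only: te minus_minus)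
    also have "\<dots> \<le> norm (main \<epsilon> \<tau>) * (1 / (2 * pi * A * \<bar>\<tau>\<bar>))"
      using A te by (intro mult_left_mono exp_minus_le_inverse) auto
    finally show ?thesis by (simp add: mult_ac)
  qed
  have half: "\<exists>K\<ge>0. \<exists>T\<ge>1. \<forall>\<tau>. \<epsilon> * \<tau> \<le> - T \<longrightarrow> norm (G \<tau> - D * main \<epsilon> \<tau> - D' * main (- \<epsilon>) \<tau>) \<le> K * \<bar>\<tau>\<bar> powr (- (9/4))"
    if e: "\<epsilon> = 1 \<or> \<epsilon> = -1" and D: "D = exp k0 * E" and Kp: "K \<ge> 0"
     and S: "\<And>\<tau>. \<epsilon> * \<tau> \<le> -1 \<Longrightarrow> (\<exists>x. norm x \<le> K / \<bar>\<tau>\<bar> \<and> Sn \<tau> = E * exp (of_real \<epsilon> * \<i> * of_real pi * of_real A * u \<tau>) * (1 + x))"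
    for \<epsilon> :: real and D D' E K
  proof -
    from asymp[OF e D Kp S] obtain Ka Ta where Ka: "Ka \<ge> 0" "Ta \<ge> 1" and
      a: "\<And>\<tau>. \<epsilon> * \<tau> \<le> - Ta \<Longrightarrow> norm (G \<tau> - D * main \<epsilon> \<tau>) \<le> Ka / \<bar>\<tau>\<bar> * norm (main \<epsilon> \<tau>)" by blast
    from mainb[OF e] obtain Km Tm where Km: "Km \<ge> 0" "Tm \<ge> 1" and
      m: "\<And>\<tau>. \<bar>\<tau>\<bar> \<ge> Tm \<Longrightarrow> norm (main \<epsilon> \<tau>) \<le> Km * \<bar>\<tau>\<bar> powr (- (5/4))" by blast
    define K' where "K' = Ka + norm D' * (1 / (2 * pi * A))"
    have K': "K' \<ge> 0" using Ka A by (simp add: K'_def)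
    show ?thesis
    proof (rule exI[of _ "K' * Km"], intro conjI, use K' Km in simp, rule exI[of _ "max Ta Tm"], intro conjI allI impI)
      show "max Ta Tm \<ge> 1" using Ka by simp
      fix \<tau> assume t: "\<epsilon> * \<tau> \<le> - max Ta Tm"
      have tt: "\<epsilon> * \<tau> \<le> - Ta" "\<bar>\<tau>\<bar> \<ge> Tm" "\<epsilon> * \<tau> \<le> -1" "\<bar>\<tau>\<bar> > 0" using t e Ka by auto
      have "norm (G \<tau> - D * main \<epsilon> \<tau> - D' * main (- \<epsilon>) \<tau>) \<le> norm (G \<tau> - D * main \<epsilon> \<tau>) + norm D' * norm (main (- \<epsilon>) \<tau>)"
        using norm_triangle_ineq4[of "G \<tau> - D * main \<epsilon> \<tau>" "D' * main (- \<epsilon>) \<tau>"] by (simp add: norm_mult)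
      also have "\<dots> \<le> Ka / \<bar>\<tau>\<bar> * norm (main \<epsilon> \<tau>) + norm D' * (1 / (2 * pi * A) / \<bar>\<tau>\<bar> * norm (main \<epsilon> \<tau>))"
        by (intro add_mono a mult_left_mono swap e tt) auto
      also have "\<dots> = K' / \<bar>\<tau>\<bar> * norm (main \<epsilon> \<tau>)" by (simp add: K'_def add_divide_distrib distrib_right)
      also have "\<dots> \<le> K' / \<bar>\<tau>\<bar> * (Km * \<bar>\<tau>\<bar> powr (- (5/4)))" using K' by (intro mult_left_mono m tt) auto
      also have "\<dots> = K' * Km * (\<bar>\<tau>\<bar> powr (- 1) * \<bar>\<tau>\<bar> powr (- (5/4)))" using tt by (simp add: powr_minus_divide)
      also have "\<bar>\<tau>\<bar> powr (- 1) * \<bar>\<tau>\<bar> powr (- (5/4)) = \<bar>\<tau>\<bar> powr (- (9/4))" unfolding powr_add[symmetric] by simp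
      finally show "norm (G \<tau> - D * main \<epsilon> \<tau> - D' * main (- \<epsilon>) \<tau>) \<le> K' * Km * \<bar>\<tau>\<bar> powr (- (9/4))" .
    qed
  qed
  from half[of 1 D1 E1 K1 D2] S1 E1 obtain Ka Ta where Ka: "Ka \<ge> 0" "Ta \<ge> 1" and
    a: "\<And>\<tau>. \<tau> \<le> - Ta \<Longrightarrow> norm (G \<tau> - D1 * main 1 \<tau> - D2 * main (- 1) \<tau>) \<le> Ka * \<bar>\<tau>\<bar> powr (- (9/4))"
    unfolding D1_def by auto
  from half[of "-1" D2 E2 K2 D1] S2 E2 obtain Kb Tb where Kb: "Kb \<ge> 0" "Tb \<ge> 1" and
    b: "\<And>\<tau>. - \<tau> \<le> - Tb \<Longrightarrow> norm (G \<tau> - D2 * main (- 1) \<tau> - D1 * main 1 \<tau>) \<le> Kb * \<bar>\<tau>\<bar> powr (- (9/4))"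
    unfolding D2_def by auto
  have u0: "u \<tau> \<noteq> 0" for \<tau> using c by (simp add: u_def complex_eq_iff)
  have contu: "continuous_on UNIV u" unfolding u_def by (rule continuous_on_Complex_line)
  have contG: "continuous_on UNIV G"
  proof -
    have "continuous_on UNIV (\<lambda>\<tau>. Gamma (of_real (\<alpha> i) * (1 + u \<tau>) + \<beta>' i))" if i: "i \<in> I" for i
    proof (rule continuous_on_compose2[OF continuous_on_Gamma[of "{z. Re z > 0}"]])
      show "continuous_on UNIV (\<lambda>\<tau>. of_real (\<alpha> i) * (1 + u \<tau>) + \<beta>' i)" by (intro continuous_intros contu)
      show "(\<lambda>\<tau>. of_real (\<alpha> i) * (1 + u \<tau>) + \<beta>' i) ` UNIV \<subseteq> {z. Re z > 0}" using reg(1) i by (auto simp: u_def)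
    qed (auto elim!: nonpos_Ints_cases)
    moreover have "continuous_on UNIV (\<lambda>\<tau>. rGamma (\<beta> i - of_real (\<alpha> i) * u \<tau>))" for i
      by (rule continuous_on_compose2[OF continuous_on_rGamma[of UNIV]]) (auto intro!: continuous_intros contu)
    ultimately show ?thesis unfolding G_def u_def[symmetric] using u0
      by (intro continuous_on_divide continuous_on_prod continuous_on_mult continuous_on_power contu) auto
  qed
  have contm: "continuous_on UNIV (main \<epsilon>)" for \<epsilon>
  proof -
    have "continuous_on UNIV (\<lambda>\<tau>. Gamma (w \<tau>))"
    proof (rule continuous_on_compose2[OF continuous_on_Gamma[of "{z. Re z = -3/4}"]])
      show "continuous_on UNIV w" unfolding w_def by (intro continuous_intros contu)
      show "w ` UNIV \<subseteq> {z. Re z = -3/4}" using line by (auto simp: w_def u_def)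
      have False if "- (3/4) = - real n" for n :: nat
      proof -
        have "real 3 = real (4 * n)" using that by simp
        then have "3 = 4 * n" by (simp only: of_nat_eq_iff)
        then show False by presburger
      qed
      then show "{z. Re z = -3/4} \<inter> \<int>\<^sub>\<le>\<^sub>0 = {}" by (auto elim!: nonpos_Ints_cases')
    qed
    then show ?thesis unfolding main_def by (intro continuous_intros contu)
  qed
  have "\<exists>K\<ge>0. \<forall>\<tau>. norm (G \<tau> - D1 * main 1 \<tau> - D2 * main (- 1) \<tau>) \<le> K * (1 + \<bar>\<tau>\<bar>) powr (- (9/4))"
  proof (rule line_bound_extend)
    show "continuous_on UNIV (\<lambda>\<tau>. G \<tau> - D1 * main 1 \<tau> - D2 * main (- 1) \<tau>)" by (intro continuous_intros contG contm)
    show "max Ta Tb > 0" using Ka by simp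
    fix \<tau> :: real assume t: "\<bar>\<tau>\<bar> \<ge> max Ta Tb"
    have "norm (G \<tau> - D1 * main 1 \<tau> - D2 * main (- 1) \<tau>) \<le> max Ka Kb * \<bar>\<tau>\<bar> powr (- (9/4))"
    proof (cases "\<tau> \<le> 0")
      case True
      then have "norm (G \<tau> - D1 * main 1 \<tau> - D2 * main (- 1) \<tau>) \<le> Ka * \<bar>\<tau>\<bar> powr (- (9/4))" using t by (intro a) auto
      also have "\<dots> \<le> max Ka Kb * \<bar>\<tau>\<bar> powr (- (9/4))" by (intro mult_right_mono) auto
      finally show ?thesis .
    next
      case False
      then have "norm (G \<tau> - D2 * main (- 1) \<tau> - D1 * main 1 \<tau>) \<le> Kb * \<bar>\<tau>\<bar> powr (- (9/4))" using t by (intro b) auto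
      also have "\<dots> \<le> max Ka Kb * \<bar>\<tau>\<bar> powr (- (9/4))" by (intro mult_right_mono) auto
      finally show ?thesis by (simp add: algebra_simps)
    qed
    then show "norm (G \<tau> - D1 * main 1 \<tau> - D2 * main (- 1) \<tau>) \<le> max Ka Kb * \<bar>\<tau>\<bar> powr (- (9/4))" .
  qed auto
  then obtain K where K: "K \<ge> 0" "\<And>\<tau>. norm (G \<tau> - D1 * main 1 \<tau> - D2 * main (- 1) \<tau>) \<le> K * (1 + \<bar>\<tau>\<bar>) powr (- (9/4))" by blast
  show "continuous_on UNIV G" by (rule contG)
  show "\<exists>D1 D2. \<exists>k1::real. \<exists>K\<ge>0. D1 \<noteq> 0 \<and> (\<forall>\<tau>. norm (G \<tau> - exp (of_real k1 * Complex c \<tau>) * Gamma (of_real (2 * A) * Complex c \<tau> + g) *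
      (D1 * exp (\<i> * of_real pi * of_real A * Complex c \<tau>) + D2 * exp (- (\<i> * of_real pi * of_real A * Complex c \<tau>)))) \<le> K * (1 + \<bar>\<tau>\<bar>) powr (- (9/4)))"
  proof (rule exI[of _ D1], rule exI[of _ D2], rule exI[of _ k1], rule exI[of _ K], intro conjI allI)
    show "K \<ge> 0" by (rule K)
    show "D1 \<noteq> 0" using E1 by (simp add: D1_def)
    fix \<tau>
    have "exp (of_real k1 * Complex c \<tau>) * Gamma (of_real (2 * A) * Complex c \<tau> + g) *
      (D1 * exp (\<i> * of_real pi * of_real A * Complex c \<tau>) + D2 * exp (- (\<i> * of_real pi * of_real A * Complex c \<tau>)))
      = D1 * main 1 \<tau> + D2 * main (- 1) \<tau>"
      by (simp add: main_def w_def u_def algebra_simps)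
    then show "norm (G \<tau> - exp (of_real k1 * Complex c \<tau>) * Gamma (of_real (2 * A) * Complex c \<tau> + g) *
      (D1 * exp (\<i> * of_real pi * of_real A * Complex c \<tau>) + D2 * exp (- (\<i> * of_real pi * of_real A * Complex c \<tau>)))) \<le> K * (1 + \<bar>\<tau>\<bar>) powr (- (9/4))"
      using K(2)[of \<tau>] by (simp only: diff_diff_eq)
  qed
qed

subsection \<open>Mean values of almost periodic functions\<close>

lemma has_integral_exp_ii:
  fixes \<omega> a b :: real assumes "\<omega> \<noteq> 0" "a \<le> b"
  shows "((\<lambda>T. exp (\<i> * of_real (\<omega> * T))) has_integral (exp (\<i> * of_real (\<omega> * b)) - exp (\<i> * of_real (\<omega> * a))) / (\<i> * of_real \<omega>)) {a..b}"
proof -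
  have "((\<lambda>T. exp (\<i> * of_real (\<omega> * T))) has_integral exp (\<i> * of_real (\<omega> * b)) / (\<i> * of_real \<omega>) - exp (\<i> * of_real (\<omega> * a)) / (\<i> * of_real \<omega>)) {a..b}"
  proof (rule fundamental_theorem_of_calculus[OF assms(2)])
    fix x assume "x \<in> {a..b}"
    have "((\<lambda>z. exp (\<i> * of_real \<omega> * z) / (\<i> * of_real \<omega>)) has_field_derivative
        exp (\<i> * of_real \<omega> * of_real x) * (\<i> * of_real \<omega>) / (\<i> * of_real \<omega>)) (at (of_real x))"
      by (intro DERIV_cdivide) (auto intro!: derivative_eq_intros)
    from has_vector_derivative_real_field[OF this, of "{a..b}"] assms
    show "((\<lambda>T. exp (\<i> * of_real (\<omega> * T)) / (\<i> * of_real \<omega>)) has_vector_derivative exp (\<i> * of_real (\<omega> * x))) (at x within {a..b})"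
      by (simp add: mult.assoc)
  qed
  then show ?thesis by (simp add: diff_divide_distrib)
qed

lemma norm_integral_exp_ii_le:
  fixes \<omega> a b :: real assumes "\<omega> \<noteq> 0"
  shows "norm ((exp (\<i> * of_real (\<omega> * b)) - exp (\<i> * of_real (\<omega> * a))) / (\<i> * of_real \<omega>)) \<le> 2 / \<bar>\<omega>\<bar>"
proof -
  have "norm (exp (\<i> * of_real (\<omega> * b)) - exp (\<i> * of_real (\<omega> * a))) \<le> 2"
    using norm_triangle_ineq4[of "exp (\<i> * of_real (\<omega> * b))" "exp (\<i> * of_real (\<omega> * a))"] by simp
  then show ?thesis by (simp add: norm_divide norm_mult divide_right_mono)
qed

text \<open>Averaging the sum times exp (-i \<nu>_0 T) over a long interval isolates
  \<open>p 0\<close>: as \<nu>_0 is positive and least, all other frequencies \<nu>_n - \<nu>_0 and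
  -(\<nu>_n + \<nu>_0) are nonzero, and their integrals are bounded whatever the position
  \<open>Y\<close>, which is not controlled.\<close>

lemma almost_periodic_coefficient_zero:
  fixes p q :: "nat \<Rightarrow> complex" and \<nu> :: "nat \<Rightarrow> real"
  assumes mono: "strict_mono \<nu>" and pos: "\<nu> 0 > 0"
    and sp: "summable (\<lambda>n. norm (p n))" and sq: "summable (\<lambda>n. norm (q n))"
    and small: "\<And>L e. L > 0 \<Longrightarrow> e > 0 \<Longrightarrow> \<exists>Y. \<forall>T\<in>{Y..Y+L}.
       norm (\<Sum>n. p n * exp (\<i> * of_real (\<nu> n * T)) + q n * exp (- (\<i> * of_real (\<nu> n * T)))) \<le> e"
  shows "p 0 = 0"
proof -
  define r where "r n = norm (p n) + norm (q n)" for n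
  define f where "f n T = p n * exp (\<i> * of_real (\<nu> n * T)) + q n * exp (- (\<i> * of_real (\<nu> n * T)))" for n T
  have sr: "summable r" unfolding r_def by (intro summable_add sp sq)
  have fr: "norm (f n T) \<le> r n" for n T
    unfolding f_def r_def by (intro norm_triangle_le add_mono) (auto simp: norm_mult)
  have sf: "summable (\<lambda>n. f n T)" for T
    by (rule summable_comparison_test'[OF sr]) (use fr in auto)
  have nu: "\<nu> n > \<nu> 0" if "n > 0" for n using mono that by (auto simp: strict_mono_def)
  have nu0: "\<nu> n + \<nu> 0 > 0" for n using nu[of n] pos by (cases n) auto
  have "norm (p 0) \<le> 3 * e" if e: "e > 0" for e
  proof -
    obtain K0 where K0: "\<And>K. K \<ge> K0 \<Longrightarrow> norm (\<Sum>n. r (n + K)) < e" using suminf_exist_split[OF e sr] by blast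
    define K where "K = Suc K0"
    have tail: "norm (\<Sum>n. f (n + K) T) \<le> e" for T
    proof -
      have "norm (\<Sum>n. f (n + K) T) \<le> (\<Sum>n. r (n + K))"
        using fr by (intro norm_suminf_le summable_ignore_initial_segment[OF sr]) auto
      also have "\<dots> \<le> norm (\<Sum>n. r (n + K))" by simp
      also have "\<dots> \<le> e" using K0[of K] by (simp add: K_def)
      finally show ?thesis .
    qed
    \<comment> \<open>\<open>C\<close> bounds the integrals of the oscillating terms below
      \<open>K\<close> over any interval. \<open>L\<close> is then chosen so that C \<le> e L; with
      2 e L from the smallness of the partial sum this yields 3 e.\<close>
    define C where "C = (\<Sum>n\<in>{1..<K}. norm (p n) * (2 / (\<nu> n - \<nu> 0))) + (\<Sum>n<K. norm (q n) * (2 / (\<nu> n + \<nu> 0)))"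
    have C0: "C \<ge> 0" unfolding C_def
    proof (rule add_nonneg_nonneg)
      show "(\<Sum>n\<in>{1..<K}. norm (p n) * (2 / (\<nu> n - \<nu> 0))) \<ge> 0"
        using less_imp_le[OF nu] by (intro sum_nonneg mult_nonneg_nonneg divide_nonneg_nonneg) auto
      show "(\<Sum>n<K. norm (q n) * (2 / (\<nu> n + \<nu> 0))) \<ge> 0"
        using less_imp_le[OF nu0] by (intro sum_nonneg mult_nonneg_nonneg divide_nonneg_nonneg) auto
    qed
    define L where "L = C / e + 1"
    have L: "L > 0" "C \<le> e * L" using C0 e by (auto simp: L_def field_simps intro: add_nonneg_pos)
    obtain Y where Y: "\<And>T. T \<in> {Y..Y+L} \<Longrightarrow> norm (\<Sum>n. f n T) \<le> e"
      using small[OF L(1) e] unfolding f_def by blast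
    define E where "E \<omega> = (exp (\<i> * of_real (\<omega> * (Y + L))) - exp (\<i> * of_real (\<omega> * Y))) / (\<i> * of_real \<omega>)" for \<omega> :: real
    define h where "h T = (\<Sum>n<K. f n T) * exp (- (\<i> * of_real (\<nu> 0 * T)))" for T
    have hb: "norm (h T) \<le> 2 * e" if "T \<in> {Y..Y+L}" for T
    proof -
      have "(\<Sum>n. f n T) = (\<Sum>n. f (n + K) T) + (\<Sum>n<K. f n T)" by (rule suminf_split_initial_segment[OF sf])
      then have "(\<Sum>n<K. f n T) = (\<Sum>n. f n T) - (\<Sum>n. f (n + K) T)" by simp
      also have "norm \<dots> \<le> e + e" using Y[OF that] tail[of T] by (intro order.trans[OF norm_triangle_ineq4] add_mono)
      finally show ?thesis by (simp add: h_def norm_mult)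
    qed
    have split: "(\<Sum>n<K. F n) = F 0 + (\<Sum>n\<in>{1..<K}. F n)" for F :: "nat \<Rightarrow> complex"
    proof -
      have "{..<K} = insert 0 {1..<K}" by (auto simp: K_def)
      then show ?thesis by simp
    qed
    have heq: "h T = p 0 + (\<Sum>n\<in>{1..<K}. p n * exp (\<i> * of_real ((\<nu> n - \<nu> 0) * T))) + (\<Sum>n<K. q n * exp (\<i> * of_real ((- (\<nu> n + \<nu> 0)) * T)))" for T
    proof -
      have "h T = (\<Sum>n<K. p n * exp (\<i> * of_real (\<nu> n * T)) * exp (- (\<i> * of_real (\<nu> 0 * T)))) + (\<Sum>n<K. q n * exp (- (\<i> * of_real (\<nu> n * T))) * exp (- (\<i> * of_real (\<nu> 0 * T))))"
        by (simp add: h_def f_def sum_distrib_right sum.distrib distrib_right)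
      also have "(\<Sum>n<K. q n * exp (- (\<i> * of_real (\<nu> n * T))) * exp (- (\<i> * of_real (\<nu> 0 * T)))) = (\<Sum>n<K. q n * exp (\<i> * of_real ((- (\<nu> n + \<nu> 0)) * T)))"
        by (intro sum.cong refl) (simp add: mult.assoc mult_exp_exp algebra_simps)
      also have "(\<Sum>n<K. p n * exp (\<i> * of_real (\<nu> n * T)) * exp (- (\<i> * of_real (\<nu> 0 * T)))) = (\<Sum>n<K. p n * exp (\<i> * of_real ((\<nu> n - \<nu> 0) * T)))"
        by (intro sum.cong refl) (simp add: mult.assoc mult_exp_exp algebra_simps)
      also have "\<dots> = p 0 + (\<Sum>n\<in>{1..<K}. p n * exp (\<i> * of_real ((\<nu> n - \<nu> 0) * T)))" by (subst split) simp
      finally show ?thesis .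
    qed
    have "(h has_integral (L *\<^sub>R p 0 + (\<Sum>n\<in>{1..<K}. p n * E (\<nu> n - \<nu> 0)) + (\<Sum>n<K. q n * E (- (\<nu> n + \<nu> 0))))) {Y..Y+L}"
      unfolding heq[abs_def]
    proof (intro has_integral_add has_integral_sum has_integral_mult_right)
      show "((\<lambda>T. p 0) has_integral L *\<^sub>R p 0) {Y..Y+L}" using has_integral_const_real[of "p 0" Y "Y+L"] L by simp
      show "((\<lambda>T. exp (\<i> * of_real ((\<nu> n - \<nu> 0) * T))) has_integral E (\<nu> n - \<nu> 0)) {Y..Y+L}" if "n \<in> {1..<K}" for n
        unfolding E_def using nu[of n] that L by (intro has_integral_exp_ii) auto
      show "((\<lambda>T. exp (\<i> * of_real ((- (\<nu> n + \<nu> 0)) * T))) has_integral E (- (\<nu> n + \<nu> 0))) {Y..Y+L}" for n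
        unfolding E_def using nu0[of n] L by (intro has_integral_exp_ii) auto
    qed auto
    from has_integral_bound_real[of "2 * e" "{}", OF _ _ this] hb e L
    have "norm (L *\<^sub>R p 0 + (\<Sum>n\<in>{1..<K}. p n * E (\<nu> n - \<nu> 0)) + (\<Sum>n<K. q n * E (- (\<nu> n + \<nu> 0)))) \<le> 2 * e * L"
      by simp
    moreover have "norm ((\<Sum>n\<in>{1..<K}. p n * E (\<nu> n - \<nu> 0)) + (\<Sum>n<K. q n * E (- (\<nu> n + \<nu> 0)))) \<le> C"
      unfolding C_def
    proof (intro norm_triangle_le add_mono sum_norm_le)
      fix n assume n: "n \<in> {1..<K}"
      have "norm (E (\<nu> n - \<nu> 0)) \<le> 2 / \<bar>\<nu> n - \<nu> 0\<bar>" unfolding E_def using nu[of n] n by (intro norm_integral_exp_ii_le) auto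
      also have "\<dots> = 2 / (\<nu> n - \<nu> 0)" using nu[of n] n by simp
      finally show "norm (p n * E (\<nu> n - \<nu> 0)) \<le> norm (p n) * (2 / (\<nu> n - \<nu> 0))"
        unfolding norm_mult by (rule mult_left_mono) simp
    next
      fix n
      have "norm (E (- (\<nu> n + \<nu> 0))) \<le> 2 / \<bar>- (\<nu> n + \<nu> 0)\<bar>" unfolding E_def using nu0[of n] by (intro norm_integral_exp_ii_le) auto
      also have "\<dots> = 2 / (\<nu> n + \<nu> 0)" using nu0[of n] by simp
      finally show "norm (q n * E (- (\<nu> n + \<nu> 0))) \<le> norm (q n) * (2 / (\<nu> n + \<nu> 0))"
        unfolding norm_mult by (rule mult_left_mono) simp
    qed
    ultimately have "norm (L *\<^sub>R p 0) \<le> 2 * e * L + C"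
      using norm_triangle_ineq4[of "L *\<^sub>R p 0 + ((\<Sum>n\<in>{1..<K}. p n * E (\<nu> n - \<nu> 0)) + (\<Sum>n<K. q n * E (- (\<nu> n + \<nu> 0))))"
         "(\<Sum>n\<in>{1..<K}. p n * E (\<nu> n - \<nu> 0)) + (\<Sum>n<K. q n * E (- (\<nu> n + \<nu> 0)))"] by (simp add: add.assoc)
    then have "L * norm (p 0) \<le> 2 * e * L + C" using L by simp
    moreover have "L * (3 * e) = 2 * e * L + e * L" by (simp add: algebra_simps)
    ultimately have "L * norm (p 0) \<le> L * (3 * e)" using L(2) by linarith
    then show ?thesis using L(1) by (simp only: mult_le_cancel_left_pos)
  qed
  from this[of "norm (p 0) / 4"] show ?thesis by (cases "p 0 = 0") auto
qed

subsection \<open>From the right line to the left line\<close>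

lemma of_real_powr_eq_exp: "x > 0 \<Longrightarrow> complex_of_real x powr s = exp (of_real (ln x) * s)"
  by (simp add: powr_def Ln_of_real mult.commute)

lemma norm_dirichlet_term:
  "x > 0 \<Longrightarrow> norm (a * complex_of_real x powr (- s)) = norm a * x powr (- Re s)"
  by (simp add: norm_mult norm_powr_real_powr)

text \<open>On a vertical line the moduli of the terms do not depend on t, so absolute convergence
  at one point justifies integrating term by term against any integrable weight.\<close>

lemma gen_dirichlet_line_integral:
  fixes a :: "nat \<Rightarrow> complex" and lam :: "nat \<Rightarrow> real" and W :: "real \<Rightarrow> complex"
  assumes pos: "\<And>n. lam n > 0" and summ: "summable (\<lambda>n. norm (a n) * lam n powr (- \<sigma>))"
    and W: "integrable lborel W"
  shows "integrable lborel (\<lambda>t. gen_dirichlet a lam (Complex \<sigma> t) * W t)"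
    and "(\<lambda>n. LINT t|lborel. a n * complex_of_real (lam n) powr (- Complex \<sigma> t) * W t) sums
      (LINT t|lborel. gen_dirichlet a lam (Complex \<sigma> t) * W t)"
proof -
  define f where "f n t = a n * complex_of_real (lam n) powr (- Complex \<sigma> t) * W t" for n t
  have nf: "norm (f n t) = (norm (a n) * lam n powr (- \<sigma>)) * norm (W t)" for n t
    unfolding f_def norm_mult[of _ "W t"] norm_dirichlet_term[OF pos] by simp
  have int: "integrable lborel (f n)" for n
  proof (rule Bochner_Integration.integrable_bound)
    show "integrable lborel (\<lambda>t. (norm (a n) * lam n powr (- \<sigma>)) * norm (W t))"
      by (intro integrable_mult_right integrable_norm W)
    have "continuous_on UNIV (\<lambda>t. a n * complex_of_real (lam n) powr (- Complex \<sigma> t))"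
      unfolding of_real_powr_eq_exp[OF pos] by (intro continuous_intros)
    then have "(\<lambda>t. a n * complex_of_real (lam n) powr (- Complex \<sigma> t)) \<in> borel_measurable lborel"
      by (simp add: borel_measurable_continuous_onI)
    then show "f n \<in> borel_measurable lborel"
      unfolding f_def by (rule borel_measurable_times) (use W in auto)
    show "AE t in lborel. norm (f n t) \<le> norm ((norm (a n) * lam n powr (- \<sigma>)) * norm (W t))"
      by (simp add: nf)
  qed
  have sm: "AE t in lborel. summable (\<lambda>n. norm (f n t))"
    unfolding nf by (intro AE_I2 summable_mult2 summ)
  have sm2: "summable (\<lambda>n. LINT t|lborel. norm (f n t))"
    unfolding nf by (simp add: summable_mult2 summ)
  have eq: "(\<Sum>n. f n t) = gen_dirichlet a lam (Complex \<sigma> t) * W t" for t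
  proof -
    have "summable (\<lambda>n. a n * complex_of_real (lam n) powr (- Complex \<sigma> t))"
      by (rule summable_norm_cancel) (use summ in \<open>simp add: norm_dirichlet_term[OF pos]\<close>)
    from suminf_mult2[OF this, of "W t"] show ?thesis by (simp add: f_def gen_dirichlet_def)
  qed
  show "integrable lborel (\<lambda>t. gen_dirichlet a lam (Complex \<sigma> t) * W t)"
    using integrable_suminf[OF int sm sm2] unfolding eq .
  show "(\<lambda>n. LINT t|lborel. a n * complex_of_real (lam n) powr (- Complex \<sigma> t) * W t) sums
      (LINT t|lborel. gen_dirichlet a lam (Complex \<sigma> t) * W t)"
    using sums_integral[OF int sm sm2] unfolding eq unfolding f_def .
qed

text \<open>The n-th term is \<open>a n\<close> times the spline at L - ln (lam n). The gap
  condition puts this argument outside [-N h, 0], so one of the two vanishing lemmas for the kernel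
  applies to each term.\<close>

lemma gen_dirichlet_diff_kernel_integral_zero:
  fixes a :: "nat \<Rightarrow> complex" and lam :: "nat \<Rightarrow> real"
  assumes pos: "\<And>n. lam n > 0" and summ: "summable (\<lambda>n. norm (a n) * lam n powr (- \<sigma>))"
    and h: "h > 0" and sig: "\<sigma> \<ge> 1" and MN: "M \<ge> 2" "N \<ge> M"
    and gap: "\<And>n. ln (lam n) < L \<or> L + real N * h < ln (lam n)"
  shows "(LINT t|lborel. gen_dirichlet a lam (Complex \<sigma> t) * (diff_kernel h N M (Complex \<sigma> t) * exp (of_real L * Complex \<sigma> t))) = 0"
proof -
  let ?W = "\<lambda>t. diff_kernel h N M (Complex \<sigma> t) * exp (of_real L * Complex \<sigma> t)"
  have W: "integrable lborel ?W" using sig MN by (intro integrable_diff_kernel_exp) auto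
  have "(LINT t|lborel. a n * complex_of_real (lam n) powr (- Complex \<sigma> t) * ?W t) = 0" for n
  proof -
    have "a n * complex_of_real (lam n) powr (- Complex \<sigma> t) * ?W t =
       a n * (diff_kernel h N M (Complex \<sigma> t) * exp (of_real (L - ln (lam n)) * Complex \<sigma> t))" for t
    proof -
      have "exp (of_real (L - ln (lam n)) * Complex \<sigma> t) = exp (of_real (ln (lam n)) * - Complex \<sigma> t) * exp (of_real L * Complex \<sigma> t)"
        unfolding mult_exp_exp by (simp add: algebra_simps)
      then show ?thesis by (simp add: of_real_powr_eq_exp[OF pos] mult_ac)
    qed
    then have "(LINT t|lborel. a n * complex_of_real (lam n) powr (- Complex \<sigma> t) * ?W t) =
       a n * (LINT t|lborel. diff_kernel h N M (Complex \<sigma> t) * exp (of_real (L - ln (lam n)) * Complex \<sigma> t))"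
      by (simp only: integral_mult_right_zero)
    also have "(LINT t|lborel. diff_kernel h N M (Complex \<sigma> t) * exp (of_real (L - ln (lam n)) * Complex \<sigma> t)) = 0"
      using gap[of n]
    proof
      assume "ln (lam n) < L"
      then show ?thesis using h sig MN by (intro diff_kernel_integral_zero_left) auto
    next
      assume "L + real N * h < ln (lam n)"
      then show ?thesis using h sig MN by (intro diff_kernel_integral_zero_right) auto
    qed
    finally show ?thesis by simp
  qed
  with gen_dirichlet_line_integral(2)[OF pos summ W] have "(\<lambda>n. 0) sums (LINT t|lborel. gen_dirichlet a lam (Complex \<sigma> t) * ?W t)"
    by (simp only:)
  then show ?thesis using sums_unique2 sums_zero by blast
qed

text \<open>|exp (\<delta> s^2)| = exp (\<delta> (\<sigma>^2 - t^2)) is at most exp (\<sigma>^2) for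
  0 < \<delta> \<le> 1, which gives an integrable majorant uniform in \<delta> = 1/(n + 1).\<close>

lemma integral_gaussian_regularisation_tendsto:
  fixes f :: "complex \<Rightarrow> complex"
  assumes "integrable lborel (\<lambda>t. f (Complex \<sigma> t))"
  shows "\<And>n. integrable lborel (\<lambda>t. f (Complex \<sigma> t) * exp (of_real (1 / real (Suc n)) * Complex \<sigma> t ^ 2))"
    and "(\<lambda>n. LINT t|lborel. f (Complex \<sigma> t) * exp (of_real (1 / real (Suc n)) * Complex \<sigma> t ^ 2)) \<longlonglongrightarrow> (LINT t|lborel. f (Complex \<sigma> t))"
proof -
  let ?g = "\<lambda>n t. f (Complex \<sigma> t) * exp (of_real (1 / real (Suc n)) * Complex \<sigma> t ^ 2)"
  have meas: "?g n \<in> borel_measurable lborel" for n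
  proof (rule borel_measurable_times)
    show "(\<lambda>t. f (Complex \<sigma> t)) \<in> borel_measurable lborel" using assms by auto
    have "continuous_on UNIV (\<lambda>t. exp (of_real (1 / real (Suc n)) * Complex \<sigma> t ^ 2))" by (intro continuous_intros)
    then show "(\<lambda>t. exp (of_real (1 / real (Suc n)) * Complex \<sigma> t ^ 2)) \<in> borel_measurable lborel"
      by (simp add: borel_measurable_continuous_onI)
  qed
  have bd: "norm (?g n t) \<le> norm (f (Complex \<sigma> t)) * exp (\<sigma>\<^sup>2)" for n t
  proof -
    have "Re (of_real (1 / real (Suc n)) * Complex \<sigma> t ^ 2) = (1 / real (Suc n)) * (\<sigma>\<^sup>2 - t\<^sup>2)"
      by (simp add: power2_eq_square)
    also have "\<dots> \<le> (1 / real (Suc n)) * \<sigma>\<^sup>2" by (intro mult_left_mono) auto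
    also have "\<dots> \<le> 1 * \<sigma>\<^sup>2" by (intro mult_right_mono) auto
    finally have "exp (Re (of_real (1 / real (Suc n)) * Complex \<sigma> t ^ 2)) \<le> exp (\<sigma>\<^sup>2)" by simp
    then show ?thesis unfolding norm_mult norm_exp_eq_Re by (intro mult_left_mono) auto
  qed
  have w: "integrable lborel (\<lambda>t. norm (f (Complex \<sigma> t)) * exp (\<sigma>\<^sup>2))"
    by (intro integrable_mult_left integrable_norm assms)
  show "integrable lborel (?g n)" for n
    by (rule Bochner_Integration.integrable_bound[OF w meas]) (use bd in \<open>auto intro!: AE_I2\<close>)
  show "(\<lambda>n. LINT t|lborel. ?g n t) \<longlonglongrightarrow> (LINT t|lborel. f (Complex \<sigma> t))"
  proof (rule integral_dominated_convergence[OF _ meas w])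
    show "(\<lambda>t. f (Complex \<sigma> t)) \<in> borel_measurable lborel" using assms by auto
    show "AE t in lborel. (\<lambda>n. ?g n t) \<longlonglongrightarrow> f (Complex \<sigma> t)"
    proof (rule AE_I2)
      fix t
      have lim: "(\<lambda>n. complex_of_real (1 / real (Suc n))) \<longlonglongrightarrow> of_real 0"
        by (intro tendsto_of_real LIMSEQ_Suc[OF lim_1_over_n])
      have "(\<lambda>n. ?g n t) \<longlonglongrightarrow> f (Complex \<sigma> t) * exp (of_real 0 * Complex \<sigma> t ^ 2)"
        by (intro tendsto_mult tendsto_exp tendsto_const lim)
      then show "(\<lambda>n. ?g n t) \<longlonglongrightarrow> f (Complex \<sigma> t)" by simp
    qed
    show "AE t in lborel. norm (?g n t) \<le> norm (f (Complex \<sigma> t)) * exp (\<sigma>\<^sup>2)" for n using bd by simp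
  qed
qed

text \<open>
  The decay hypothesis controls \<open>\<Delta>\<phi>\<close> but not \<open>\<phi>\<close> in the strip, so the shift is carried out with the
  additional factor \<open>exp(\<delta>s\<^sup>2)\<close>, and then \<open>\<delta>\<close> tends to \<open>0\<close>.
\<close>

lemma diff_kernel_left_line_bound:
  fixes \<Phi> :: "complex \<Rightarrow> complex"
  assumes R: "R > 0" "c > R" "\<sigma>1 > R" and P: "finite P" "P \<subseteq> ball 0 R" and hol: "\<Phi> holomorphic_on UNIV - P"
    and M: "M \<ge> 2"
    and growth: "\<And>\<delta> e. \<delta> > 0 \<Longrightarrow> e > 0 \<Longrightarrow> \<exists>T. \<forall>\<sigma> t. - c \<le> \<sigma> \<and> \<sigma> \<le> \<sigma>1 \<and> \<bar>t\<bar> \<ge> T \<longrightarrow>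
        norm (\<Phi> (Complex \<sigma> t)) * exp (- \<delta> * t\<^sup>2) \<le> e"
  shows "\<exists>B. \<forall>h L. h > 0 \<and> h * R \<le> 1/2 \<and> L \<ge> 0 \<and>
     integrable lborel (\<lambda>t. \<Phi> (Complex \<sigma>1 t) * (diff_kernel h N M (Complex \<sigma>1 t) * exp (of_real L * Complex \<sigma>1 t))) \<and>
     integrable lborel (\<lambda>t. \<Phi> (Complex (- c) t) * (diff_kernel h N M (Complex (- c) t) * exp (of_real L * Complex (- c) t))) \<and>
     (LINT t|lborel. \<Phi> (Complex \<sigma>1 t) * (diff_kernel h N M (Complex \<sigma>1 t) * exp (of_real L * Complex \<sigma>1 t))) = 0 \<longrightarrow>
     norm (LINT t|lborel. \<Phi> (Complex (- c) t) * (diff_kernel h N M (Complex (- c) t) * exp (of_real L * Complex (- c) t))) \<le> B * h ^ N * exp (L * R)"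
proof -
  have "sphere 0 R \<subseteq> UNIV - P" using P by auto
  then have "continuous_on (sphere 0 R) \<Phi>" using holomorphic_on_imp_continuous_on[OF hol] continuous_on_subset by blast
  then have "bounded (\<Phi> ` sphere 0 R)" by (intro compact_imp_bounded compact_continuous_image) auto
  then obtain B0 where "\<forall>x\<in>\<Phi> ` sphere 0 R. norm x \<le> B0" unfolding bounded_iff by blast
  then have B0: "\<And>s. norm s = R \<Longrightarrow> norm (\<Phi> s) \<le> B0" by simp
  have "norm (\<Phi> (of_real R)) \<le> B0" using R by (intro B0) simp
  then have B0': "B0 \<ge> 0" by (rule order_trans[OF norm_ge_zero])
  \<comment> \<open>Maximum of \<Phi> on the circle, kernel bound without its h^N, Gaussian bound
    for \<delta> \<le> 1, and length of the circle. The parts depending on h and L stay outside,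
    since both will vary with T.\<close>
  define B where "B = B0 * ((2 * R) ^ N / R ^ M) * exp (R\<^sup>2) * (2 * pi * R)"
  show ?thesis
  proof (rule exI[of _ B], intro allI impI, elim conjE)
    fix h L :: real
    let ?f = "\<lambda>s. \<Phi> s * (diff_kernel h N M s * exp (of_real L * s))"
    assume h: "h > 0" "h * R \<le> 1/2" and L: "L \<ge> 0"
      and i1: "integrable lborel (\<lambda>t. ?f (Complex \<sigma>1 t))" and i2: "integrable lborel (\<lambda>t. ?f (Complex (- c) t))"
      and z: "(LINT t|lborel. ?f (Complex \<sigma>1 t)) = 0"
    define \<delta> where "\<delta> n = 1 / real (Suc n)" for n
    have \<delta>: "\<delta> n > 0" "\<delta> n \<le> 1" for n by (auto simp: \<delta>_def)
    let ?g = "\<lambda>n s. ?f s * exp (of_real (\<delta> n) * s ^ 2)"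
    note r1 = integral_gaussian_regularisation_tendsto[where f = ?f, OF i1, folded \<delta>_def]
    note r2 = integral_gaussian_regularisation_tendsto[where f = ?f, OF i2, folded \<delta>_def]
    have gen: "norm y \<le> norm x + K" if "norm (x - y) \<le> K" for x y :: complex and K
      using that norm_triangle_sub[of y x] by (simp add: norm_minus_commute)
    have bd: "norm (LINT t|lborel. ?g n (Complex (- c) t)) \<le> norm (LINT t|lborel. ?g n (Complex \<sigma>1 t)) + B * h ^ N * exp (L * R)" for n
    proof -
      have eq: "\<i> * (LINT t|lborel. ?g n (Complex \<sigma>1 t)) - \<i> * (LINT t|lborel. ?g n (Complex (- c) t)) = contour_integral (circlepath 0 R) (?g n)"
      \<comment> \<open>Besides the singularities of \<Phi> the circle has to enclose 0, the pole of
        1/s^M.\<close>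
      proof (rule vertical_line_integral_shift_circle[where S = UNIV and P = "insert 0 P"])
        show "?g n holomorphic_on UNIV - insert 0 P"
          unfolding diff_kernel_def by (intro holomorphic_intros holomorphic_on_subset[OF hol]) auto
        show "integrable lborel (\<lambda>t. ?g n (Complex (- c) t))" by (rule r2(1))
        show "integrable lborel (\<lambda>t. ?g n (Complex \<sigma>1 t))" by (rule r1(1))
        fix e :: real assume e: "e > 0"
        define m where "m = max c \<sigma>1"
        define C where "C = (exp (h * \<sigma>1) + 1) ^ N * 4 * exp (L * \<sigma>1) * exp (m\<^sup>2)"
        have C: "C > 0" unfolding C_def by (simp add: add_pos_pos)
        obtain T where T: "\<And>\<sigma> t. - c \<le> \<sigma> \<Longrightarrow> \<sigma> \<le> \<sigma>1 \<Longrightarrow> \<bar>t\<bar> \<ge> T \<Longrightarrow> norm (\<Phi> (Complex \<sigma> t)) * exp (- \<delta> n * t\<^sup>2) \<le> e / C"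
          using growth[OF \<delta>(1)[of n], of "e / C"] e C by auto
        show "\<exists>T. \<forall>\<sigma> t. - c \<le> \<sigma> \<and> \<sigma> \<le> \<sigma>1 \<and> T \<le> \<bar>t\<bar> \<longrightarrow> norm (?g n (Complex \<sigma> t)) \<le> e"
        proof (intro exI[of _ "max T 1"] allI impI)
          fix \<sigma> t assume A: "- c \<le> \<sigma> \<and> \<sigma> \<le> \<sigma>1 \<and> max T 1 \<le> \<bar>t\<bar>"
          have n1: "norm (Complex \<sigma> t) \<ge> 1" using A abs_Im_le_cmod[of "Complex \<sigma> t"] by simp
          have k: "norm (diff_kernel h N M (Complex \<sigma> t)) \<le> (exp (h * \<sigma>1) + 1) ^ N * 4"
          proof -
            have "norm (diff_kernel h N M (Complex \<sigma> t)) \<le> (exp (h * \<sigma>) + 1) ^ N * (4 * (1 + \<bar>t\<bar>) powr (- 2))"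
              using norm_diff_kernel_le[OF n1 M, of h N] by simp
            also have "\<dots> \<le> (exp (h * \<sigma>1) + 1) ^ N * (4 * 1)"
              using A h by (intro mult_mono power_mono add_mono) (auto simp: powr_le_one_le powr_minus_divide)
            finally show ?thesis by simp
          qed
          have x: "norm (exp (of_real L * Complex \<sigma> t)) \<le> exp (L * \<sigma>1)" using A L by (auto intro: mult_left_mono)
          have s2: "\<sigma>\<^sup>2 \<le> m\<^sup>2" using A R by (intro power2_le_iff_abs_le[THEN iffD2]) (auto simp: m_def)
          have y: "norm (exp (of_real (\<delta> n) * Complex \<sigma> t ^ 2)) \<le> exp (m\<^sup>2) * exp (- \<delta> n * t\<^sup>2)"
          proof -
            have "Re (of_real (\<delta> n) * Complex \<sigma> t ^ 2) = \<delta> n * \<sigma>\<^sup>2 + - \<delta> n * t\<^sup>2"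
              by (simp add: power2_eq_square algebra_simps)
            also have "\<delta> n * \<sigma>\<^sup>2 \<le> 1 * m\<^sup>2" using \<delta>[of n] s2 by (intro mult_mono) auto
            finally have "exp (Re (of_real (\<delta> n) * Complex \<sigma> t ^ 2)) \<le> exp (m\<^sup>2 + - \<delta> n * t\<^sup>2)" by simp
            then show ?thesis by (simp only: norm_exp_eq_Re exp_add)
          qed
          have "norm (?g n (Complex \<sigma> t)) \<le> norm (\<Phi> (Complex \<sigma> t)) * (((exp (h * \<sigma>1) + 1) ^ N * 4) * exp (L * \<sigma>1)) * (exp (m\<^sup>2) * exp (- \<delta> n * t\<^sup>2))"
            unfolding norm_mult using k x y by (intro mult_mono) auto
          also have "\<dots> = C * (norm (\<Phi> (Complex \<sigma> t)) * exp (- \<delta> n * t\<^sup>2))" by (simp add: C_def mult_ac)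
          also have "\<dots> \<le> C * (e / C)" using C A by (intro mult_left_mono T) auto
          finally show "norm (?g n (Complex \<sigma> t)) \<le> e" using C by simp
        qed
      qed (use R P in auto)
      have "norm (contour_integral (circlepath 0 R) (?g n)) \<le> (B0 * ((2 * R * h) ^ N / R ^ M) * exp (L * R) * exp (R\<^sup>2)) * (2 * pi * R)"
      proof (rule has_contour_integral_bound_circlepath)
        have "?g n contour_integrable_on circlepath 0 R"
        proof (rule contour_integrable_holomorphic_simple)
          show "?g n holomorphic_on UNIV - insert 0 P"
            unfolding diff_kernel_def by (intro holomorphic_intros holomorphic_on_subset[OF hol]) auto
          show "open (UNIV - insert 0 P)" using P by (simp add: open_Diff finite_imp_closed)
          show "path_image (circlepath 0 R) \<subseteq> UNIV - insert 0 P" using P R by auto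
        qed auto
        then show "(?g n has_contour_integral contour_integral (circlepath 0 R) (?g n)) (circlepath 0 R)"
          by (rule has_contour_integral_integral)
        show "0 \<le> B0 * ((2 * R * h) ^ N / R ^ M) * exp (L * R) * exp (R\<^sup>2)" using B0' R h by simp
        show "0 < R" by (rule R)
        fix s assume "cmod (s - 0) = R"
        then have s: "norm s = R" by simp
        have re: "Re s \<le> R" using complex_Re_le_cmod[of s] s by simp
        \<comment> \<open>Here h R \<le> 1/2 enters: on the circle each factor exp (h s) - 1 is at
          most 2 R h, so the kernel is O(h^N).\<close>
        have "norm (of_real h * s) \<le> 1/2" using h s by (simp add: norm_mult)
        then have "norm (exp (of_real h * s) - 1) \<le> 3/2 * norm (of_real h * s)" by (rule norm_exp_bounds(2))
        also have "\<dots> \<le> 2 * R * h" using h R s by (simp add: norm_mult)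
        finally have k: "norm (diff_kernel h N M s) \<le> (2 * R * h) ^ N / R ^ M"
          unfolding diff_kernel_def norm_divide norm_power s using R by (intro divide_right_mono power_mono) auto
        have x: "norm (exp (of_real L * s)) \<le> exp (L * R)" using re L by (auto intro: mult_left_mono)
        have y: "norm (exp (of_real (\<delta> n) * s ^ 2)) \<le> exp (R\<^sup>2)"
        proof -
          have "norm (exp (of_real (\<delta> n) * s ^ 2)) \<le> exp (norm (of_real (\<delta> n) * s ^ 2))" by (rule norm_exp)
          also have "norm (of_real (\<delta> n) * s ^ 2) = \<delta> n * R\<^sup>2" using \<delta>[of n] s by (simp add: norm_mult norm_power)
          also have "\<delta> n * R\<^sup>2 \<le> 1 * R\<^sup>2" using \<delta>[of n] by (intro mult_right_mono) auto
          finally show ?thesis by simp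
        qed
        have "norm (?g n s) \<le> B0 * ((2 * R * h) ^ N / R ^ M * exp (L * R)) * exp (R\<^sup>2)"
          unfolding norm_mult using B0[OF s] k x y B0' R h by (intro mult_mono) auto
        then show "norm (?g n s) \<le> B0 * ((2 * R * h) ^ N / R ^ M) * exp (L * R) * exp (R\<^sup>2)" by (simp add: mult.assoc)
      qed
      also have "\<dots> = B * h ^ N * exp (L * R)" by (simp add: B_def power_mult_distrib mult_ac)
      finally have "norm (\<i> * (LINT t|lborel. ?g n (Complex \<sigma>1 t)) - \<i> * (LINT t|lborel. ?g n (Complex (- c) t))) \<le> B * h ^ N * exp (L * R)"
        unfolding eq .
      then have "norm (\<i> * (LINT t|lborel. ?g n (Complex (- c) t))) \<le> norm (\<i> * (LINT t|lborel. ?g n (Complex \<sigma>1 t))) + B * h ^ N * exp (L * R)"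
        by (rule gen)
      then show ?thesis by (simp only: norm_mult norm_ii mult_1)
    qed
    have "norm (LINT t|lborel. ?f (Complex (- c) t)) \<le> norm (LINT t|lborel. ?f (Complex \<sigma>1 t)) + B * h ^ N * exp (L * R)"
      by (rule LIMSEQ_le[OF tendsto_norm[OF r2(2)] tendsto_add[OF tendsto_norm[OF r1(2)] tendsto_const]]) (use bd in auto)
    then show "norm (LINT t|lborel. ?f (Complex (- c) t)) \<le> B * h ^ N * exp (L * R)" by (simp only: z norm_zero add_0)
  qed
qed

subsection \<open>The dual sum\<close>

lemma rGamma_prod_vertical_le:
  fixes \<alpha> :: "'i \<Rightarrow> real" and \<beta> :: "'i \<Rightarrow> complex" and m :: real
  assumes "finite I" "\<forall>i\<in>I. \<alpha> i > 0" "m \<ge> 0"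
  shows "\<exists>K\<ge>0. \<exists>T\<ge>1. \<forall>\<sigma> t. \<bar>\<sigma>\<bar> \<le> m \<and> \<bar>t\<bar> \<ge> T \<longrightarrow>
    norm (\<Prod>i\<in>I. rGamma (of_real (\<alpha> i) * Complex \<sigma> t + \<beta> i)) \<le> exp (K * (\<bar>t\<bar> * sqrt \<bar>t\<bar>))"
  using assms(1,2)
proof (induction I rule: finite_induct)
  case empty
  show ?case by (rule exI[of _ 0], simp, rule exI[of _ 1], simp)
next
  case (insert j I)
  have j: "\<alpha> j > 0" and "\<forall>i\<in>I. \<alpha> i > 0" using insert.prems by auto
  from insert.IH[OF this(2)] obtain K T where K: "K \<ge> 0" "T \<ge> 1" and
    b: "\<And>\<sigma> t. \<bar>\<sigma>\<bar> \<le> m \<Longrightarrow> \<bar>t\<bar> \<ge> T \<Longrightarrow> norm (\<Prod>i\<in>I. rGamma (of_real (\<alpha> i) * Complex \<sigma> t + \<beta> i)) \<le> exp (K * (\<bar>t\<bar> * sqrt \<bar>t\<bar>))" by blast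
  define m' where "m' = \<alpha> j * m + \<bar>Re (\<beta> j)\<bar>"
  have "m' \<ge> 0" using j assms by (simp add: m'_def)
  from norm_rGamma_vertical_le[OF this] obtain K' where K': "K' > 0" and
    b': "\<And>z. \<bar>Re z\<bar> \<le> m' \<Longrightarrow> \<bar>Im z\<bar> \<ge> 2 * m' + 2 \<Longrightarrow> norm (rGamma z) \<le> exp (K' * (\<bar>Im z\<bar> * sqrt \<bar>Im z\<bar>))" by blast
  define q where "q = \<alpha> j + \<bar>Im (\<beta> j)\<bar>"
  have q: "q > 0" using j by (simp add: q_def)
  define T' where "T' = max T ((2 * m' + 2 + \<bar>Im (\<beta> j)\<bar>) / \<alpha> j)"
  show ?case
  proof (rule exI[of _ "K + K' * (q * sqrt q)"], intro conjI, use K K' q in simp, rule exI[of _ T'], intro conjI allI impI)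
    show "T' \<ge> 1" using K by (simp add: T'_def)
    fix \<sigma> t :: real assume A: "\<bar>\<sigma>\<bar> \<le> m \<and> \<bar>t\<bar> \<ge> T'"
    then have "\<bar>t\<bar> \<ge> (2 * m' + 2 + \<bar>Im (\<beta> j)\<bar>) / \<alpha> j" "\<bar>t\<bar> \<ge> T" unfolding T'_def by auto
    then have t: "\<alpha> j * \<bar>t\<bar> \<ge> 2 * m' + 2 + \<bar>Im (\<beta> j)\<bar>" "\<bar>t\<bar> \<ge> T" "\<bar>t\<bar> \<ge> 1" using j K by (auto simp: field_simps)
    define z where "z = of_real (\<alpha> j) * Complex \<sigma> t + \<beta> j"
    have re: "\<bar>Re z\<bar> \<le> m'"
    proof -
      have "\<bar>\<alpha> j * \<sigma>\<bar> \<le> \<alpha> j * m" using A j by (simp add: abs_mult)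
      then show ?thesis by (simp add: z_def m'_def)
    qed
    have ab: "\<bar>\<alpha> j * t\<bar> = \<alpha> j * \<bar>t\<bar>" using j by (simp add: abs_mult)
    have im: "\<bar>Im z\<bar> \<ge> 2 * m' + 2" using t(1) ab by (simp add: z_def)
    have im2: "\<bar>Im z\<bar> \<le> q * \<bar>t\<bar>"
    proof -
      have "\<bar>Im z\<bar> \<le> \<alpha> j * \<bar>t\<bar> + \<bar>Im (\<beta> j)\<bar> * 1" using ab by (simp add: z_def)
      also have "\<dots> \<le> \<alpha> j * \<bar>t\<bar> + \<bar>Im (\<beta> j)\<bar> * \<bar>t\<bar>" using t by (intro add_left_mono mult_left_mono) auto
      finally show ?thesis by (simp add: q_def distrib_right)
    qed
    have "norm (rGamma z) \<le> exp (K' * (\<bar>Im z\<bar> * sqrt \<bar>Im z\<bar>))" by (rule b'[OF re im])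
    also have "\<dots> \<le> exp (K' * (q * \<bar>t\<bar> * sqrt (q * \<bar>t\<bar>)))"
      unfolding exp_le_cancel_iff using K' im2 q by (intro mult_left_mono mult_mono real_sqrt_le_mono) auto
    also have "K' * (q * \<bar>t\<bar> * sqrt (q * \<bar>t\<bar>)) = K' * (q * sqrt q) * (\<bar>t\<bar> * sqrt \<bar>t\<bar>)" by (simp add: real_sqrt_mult)
    finally have z: "norm (rGamma z) \<le> exp (K' * (q * sqrt q) * (\<bar>t\<bar> * sqrt \<bar>t\<bar>))" .
    have "norm (\<Prod>i\<in>insert j I. rGamma (of_real (\<alpha> i) * Complex \<sigma> t + \<beta> i)) =
       norm (rGamma z) * norm (\<Prod>i\<in>I. rGamma (of_real (\<alpha> i) * Complex \<sigma> t + \<beta> i))"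
      using insert.hyps by (simp add: z_def norm_mult)
    also have "\<dots> \<le> exp (K' * (q * sqrt q) * (\<bar>t\<bar> * sqrt \<bar>t\<bar>)) * exp (K * (\<bar>t\<bar> * sqrt \<bar>t\<bar>))"
      using A t by (intro mult_mono z b) auto
    also have "\<dots> = exp ((K + K' * (q * sqrt q)) * (\<bar>t\<bar> * sqrt \<bar>t\<bar>))" by (simp flip: exp_add add: algebra_simps)
    finally show "norm (\<Prod>i\<in>insert j I. rGamma (of_real (\<alpha> i) * Complex \<sigma> t + \<beta> i)) \<le> exp ((K + K' * (q * sqrt q)) * (\<bar>t\<bar> * sqrt \<bar>t\<bar>))" .
  qed
qed

text \<open>Multiplying the completed function by the reciprocal Gamma product recovers the
  Dirichlet series at the price exp (K |t|^(3/2)). The Gaussian absorbs this once sqrt |t| \<ge>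
  K/\<delta>, which is the reason for (K/\<delta>)^2 in the witness.\<close>

lemma decay_times_rGamma_prod:
  fixes \<alpha> :: "'i \<Rightarrow> real" and \<beta> :: "'i \<Rightarrow> complex" and F :: "complex \<Rightarrow> complex"
  assumes "finite I" "\<forall>i\<in>I. \<alpha> i > 0" and "\<delta> > 0" "e > 0"
    and F: "\<And>bl br e. e > 0 \<Longrightarrow> \<exists>T. \<forall>\<sigma> t. bl \<le> \<sigma> \<and> \<sigma> \<le> br \<and> \<bar>t\<bar> \<ge> T \<longrightarrow> norm (F (Complex \<sigma> t)) < e"
  shows "\<exists>T. \<forall>\<sigma> t. bl \<le> \<sigma> \<and> \<sigma> \<le> br \<and> \<bar>t\<bar> \<ge> T \<longrightarrow>
     norm (F (Complex \<sigma> t) * (\<Prod>i\<in>I. rGamma (of_real (\<alpha> i) * Complex \<sigma> t + \<beta> i))) * exp (- \<delta> * t\<^sup>2) \<le> e"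
proof -
  define m where "m = max \<bar>bl\<bar> \<bar>br\<bar>"
  have m: "m \<ge> 0" by (simp add: m_def)
  obtain K T where K: "K \<ge> 0" "T \<ge> 1" and
    b: "\<And>\<sigma> t. \<bar>\<sigma>\<bar> \<le> m \<Longrightarrow> \<bar>t\<bar> \<ge> T \<Longrightarrow> norm (\<Prod>i\<in>I. rGamma (of_real (\<alpha> i) * Complex \<sigma> t + \<beta> i)) \<le> exp (K * (\<bar>t\<bar> * sqrt \<bar>t\<bar>))"
    using rGamma_prod_vertical_le[OF assms(1,2) m, of \<beta>] by blast
  obtain T1 where T1: "\<And>\<sigma> t. bl \<le> \<sigma> \<Longrightarrow> \<sigma> \<le> br \<Longrightarrow> \<bar>t\<bar> \<ge> T1 \<Longrightarrow> norm (F (Complex \<sigma> t)) < e"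
    using F[OF assms(4), of bl br] by blast
  show ?thesis
  proof (intro exI[of _ "max (max T T1) ((K / \<delta>)\<^sup>2)"] allI impI)
    fix \<sigma> t assume A: "bl \<le> \<sigma> \<and> \<sigma> \<le> br \<and> max (max T T1) ((K / \<delta>)\<^sup>2) \<le> \<bar>t\<bar>"
    have "K / \<delta> \<le> sqrt \<bar>t\<bar>" using A by (intro real_le_rsqrt) auto
    then have "K \<le> \<delta> * sqrt \<bar>t\<bar>" using assms(3) by (simp add: field_simps)
    then have "K * (\<bar>t\<bar> * sqrt \<bar>t\<bar>) \<le> (\<delta> * sqrt \<bar>t\<bar>) * (\<bar>t\<bar> * sqrt \<bar>t\<bar>)" by (intro mult_right_mono) auto
    also have "\<dots> = \<delta> * (sqrt \<bar>t\<bar> * sqrt \<bar>t\<bar>) * \<bar>t\<bar>" by (simp only: mult_ac)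
    also have "sqrt \<bar>t\<bar> * sqrt \<bar>t\<bar> = \<bar>t\<bar>" by simp
    also have "\<delta> * \<bar>t\<bar> * \<bar>t\<bar> = \<delta> * t\<^sup>2" by (simp add: power2_eq_square)
    finally have le: "K * (\<bar>t\<bar> * sqrt \<bar>t\<bar>) \<le> \<delta> * t\<^sup>2" .
    have "norm (F (Complex \<sigma> t) * (\<Prod>i\<in>I. rGamma (of_real (\<alpha> i) * Complex \<sigma> t + \<beta> i))) * exp (- \<delta> * t\<^sup>2)
       \<le> (e * exp (\<delta> * t\<^sup>2)) * exp (- \<delta> * t\<^sup>2)"
    proof (intro mult_right_mono)
      have "norm (\<Prod>i\<in>I. rGamma (of_real (\<alpha> i) * Complex \<sigma> t + \<beta> i)) \<le> exp (\<delta> * t\<^sup>2)"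
        using A le by (intro order.trans[OF b]) (auto simp: m_def)
      then show "norm (F (Complex \<sigma> t) * (\<Prod>i\<in>I. rGamma (of_real (\<alpha> i) * Complex \<sigma> t + \<beta> i))) \<le> e * exp (\<delta> * t\<^sup>2)"
        unfolding norm_mult using T1[of \<sigma> t] A assms(4) by (intro mult_mono) auto
    qed auto
    also have "\<dots> = e" by (simp add: mult.assoc mult_exp_exp)
    finally show "norm (F (Complex \<sigma> t) * (\<Prod>i\<in>I. rGamma (of_real (\<alpha> i) * Complex \<sigma> t + \<beta> i))) * exp (- \<delta> * t\<^sup>2) \<le> e" .
  qed
qed

text \<open>The substitution w = 2 A u + g maps the line to Re w = -3/4 and reduces the integral to
  \<open>Gamma_inverse_Mellin\<close> with X = exp Z. \<open>Z\<close> absorbs both the exponent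
  \<open>Y\<close> and the linear exponent \<open>k1\<close> from Stirling's formula.\<close>

lemma main_term_transform:
  fixes A c \<epsilon> Y k1 :: real and g :: complex
  assumes A: "A > 0" and line: "2 * A * c + Re g = - 3/4" and eps: "\<bar>\<epsilon>\<bar> = 1"
  defines "m \<equiv> \<lambda>\<tau>. exp (of_real k1 * Complex c \<tau>) * Gamma (of_real (2 * A) * Complex c \<tau> + g) * exp (of_real \<epsilon> * (\<i> * of_real pi * of_real A * Complex c \<tau>))"
    and "Z \<equiv> (Y - k1) / (2 * A)"
  shows "integrable lborel (\<lambda>\<tau>. m \<tau> * exp (- (of_real Y * Complex c \<tau>)))"
    and "(LINT \<tau>|lborel. m \<tau> * exp (- (of_real Y * Complex c \<tau>))) =
      of_real (pi / A) * exp (- (of_real \<epsilon> * \<i> * of_real pi / 2 * g)) * exp (of_real Z * g) * (exp (\<i> * of_real (\<epsilon> * exp Z)) - 1)"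
proof -
  define \<zeta> where "\<zeta> = of_real \<epsilon> * \<i> * of_real pi / 2 - complex_of_real Z"
  define f where "f t = Gamma (Complex (-3/4) t) * exp (\<zeta> * Complex (-3/4) t)" for t
  have ni: "-3/4 \<noteq> - real n" for n
  proof
    assume "-3/4 = - real n"
    then have "real (4 * n) = real 3" by simp
    then have "4 * n = 3" by (simp only: of_nat_eq_iff)
    then show False by presburger
  qed
  have int: "integrable lborel f"
  proof -
    from Gamma_exp_line_bound[OF eps _ ni, of Z] obtain C where C: "\<And>t. norm (f t) \<le> C * (1 + \<bar>t\<bar>) powr (- (1/2 - (-3/4)))"
      unfolding f_def \<zeta>_def by auto
    show ?thesis
    proof (rule integrable_line_bound[OF _ _ C])
      show "continuous_on UNIV f" unfolding f_def by (intro continuous_intros continuous_on_Gamma_line ni)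
    qed simp
  qed
  have val: "(LINT t|lborel. f t) = 2 * of_real pi * (exp (\<i> * of_real (\<epsilon> * exp Z)) - 1)"
    using Gamma_inverse_Mellin[OF eps, of "exp Z"] by (simp add: f_def \<zeta>_def)
  have eq: "m \<tau> * exp (- (of_real Y * Complex c \<tau>)) = exp (- (\<zeta> * g)) * f (Im g + 2 * A * \<tau>)" for \<tau>
  proof -
    have w: "of_real (2 * A) * Complex c \<tau> + g = Complex (-3/4) (Im g + 2 * A * \<tau>)"
      using line by (simp add: complex_eq_iff)
    have "m \<tau> * exp (- (of_real Y * Complex c \<tau>)) = Gamma (of_real (2 * A) * Complex c \<tau> + g) *
      exp (of_real k1 * Complex c \<tau> + of_real \<epsilon> * (\<i> * of_real pi * of_real A * Complex c \<tau>) + - (of_real Y * Complex c \<tau>))"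
      by (simp only: m_def exp_add mult_ac)
    also have "of_real k1 * Complex c \<tau> + of_real \<epsilon> * (\<i> * of_real pi * of_real A * Complex c \<tau>) + - (of_real Y * Complex c \<tau>) =
      - (\<zeta> * g) + \<zeta> * (of_real (2 * A) * Complex c \<tau> + g)"
    proof -
      have z: "of_real Z * of_real (2 * A) = (of_real (Y - k1) :: complex)"
        using A by (simp only: of_real_mult[symmetric] of_real_eq_iff) (simp add: Z_def)
      have "\<zeta> * (of_real (2 * A) * Complex c \<tau>) = of_real \<epsilon> * \<i> * of_real pi * of_real A * Complex c \<tau> - (of_real Z * of_real (2 * A)) * Complex c \<tau>"
        unfolding \<zeta>_def by (simp add: algebra_simps)
      then have "\<zeta> * (of_real (2 * A) * Complex c \<tau>) = of_real \<epsilon> * \<i> * of_real pi * of_real A * Complex c \<tau> - of_real (Y - k1) * Complex c \<tau>"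
        by (simp only: z)
      then show ?thesis by (simp add: algebra_simps)
    qed
    finally show ?thesis unfolding w f_def by (simp only: exp_add mult_ac)
  qed
  have A2: "2 * A \<noteq> 0" using A by simp
  have "integrable lborel (\<lambda>\<tau>. f (Im g + 2 * A * \<tau>))"
    by (rule lborel_integrable_real_affine[OF int A2])
  then show "integrable lborel (\<lambda>\<tau>. m \<tau> * exp (- (of_real Y * Complex c \<tau>)))" unfolding eq by (intro integrable_mult_right)
  have "(LINT t|lborel. f t) = of_real (2 * A) * (LINT \<tau>|lborel. f (Im g + 2 * A * \<tau>))"
    using lborel_integral_real_affine[OF A2, of f "Im g"] A by (simp add: scaleR_conv_of_real)
  moreover have q: "complex_of_real (2 * A) * of_real (pi / A) = 2 * of_real pi" using A by simp
  ultimately have "of_real (2 * A) * (LINT \<tau>|lborel. f (Im g + 2 * A * \<tau>)) = of_real (2 * A) * (of_real (pi / A) * (exp (\<i> * of_real (\<epsilon> * exp Z)) - 1))"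
    unfolding val mult.assoc[symmetric] q by (simp only:)
  then have v2: "(LINT \<tau>|lborel. f (Im g + 2 * A * \<tau>)) = of_real (pi / A) * (exp (\<i> * of_real (\<epsilon> * exp Z)) - 1)"
    using A by (subst (asm) mult_left_cancel) auto
  have "- (\<zeta> * g) = - (of_real \<epsilon> * \<i> * of_real pi / 2 * g) + of_real Z * g" by (simp add: \<zeta>_def algebra_simps)
  then show "(LINT \<tau>|lborel. m \<tau> * exp (- (of_real Y * Complex c \<tau>))) =
      of_real (pi / A) * exp (- (of_real \<epsilon> * \<i> * of_real pi / 2 * g)) * exp (of_real Z * g) * (exp (\<i> * of_real (\<epsilon> * exp Z)) - 1)"
    unfolding eq integral_mult_right_zero v2 by (simp only: exp_add mult_ac)
qed

text \<open>With nodes X_j = T exp (j \<eta>/T), this is the N-th difference of X^g (exp (i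
  \<epsilon> \<nu> X) - 1) over the nodes, divided by T^g: what the numerator of the kernel makes of
  the inverse transform of the main term.\<close>

definition osc_sum :: "real \<Rightarrow> complex \<Rightarrow> nat \<Rightarrow> real \<Rightarrow> real \<Rightarrow> real \<Rightarrow> complex" where
  "osc_sum \<epsilon> g N \<eta> T \<nu> = (\<Sum>j\<le>N. of_nat (N choose j) * (-1) ^ (N - j) * exp (of_real (real j * \<eta> / T) * g) *
     (exp (\<i> * of_real (\<epsilon> * (\<nu> * (T * exp (real j * \<eta> / T))))) - 1))"

lemma norm_exp_ii_diff_le: "norm (exp (\<i> * of_real x) - exp (\<i> * of_real y)) \<le> \<bar>x - y\<bar>"
proof -
  have "exp (\<i> * of_real x) - exp (\<i> * of_real y) = exp (\<i> * of_real y) * (exp (\<i> * of_real (x - y)) - 1)"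
    by (simp add: algebra_simps mult_exp_exp)
  then have "norm (exp (\<i> * of_real x) - exp (\<i> * of_real y)) = norm (exp (\<i> * of_real (x - y)) - 1)" by (simp add: norm_mult)
  also have "\<dots> = 2 * \<bar>sin ((x - y) / 2)\<bar>" by (rule dist_exp_i_1)
  also have "\<dots> \<le> \<bar>x - y\<bar>" using abs_sin_x_le_abs_x[of "(x - y) / 2"] by simp
  finally show ?thesis .
qed

text \<open>T exp (j \<eta>/T) = T + j \<eta> + O(1/T), so the steps become additive; the weights
  (X_j/T)^g are 1 + O(1/T), and the constants -1 cancel because N \<ge> 1. An error O(1/T) in a node
  moves the phase by O(\<nu>/T), whence the factor 1 + \<nu>.\<close>

lemma osc_sum_approx:
  fixes \<epsilon> \<eta> :: real and g :: complex and N :: nat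
  assumes eps: "\<bar>\<epsilon>\<bar> = 1" and eta: "\<eta> > 0" and N: "N \<ge> 1"
  shows "\<exists>C\<ge>0. \<exists>T0\<ge>1. \<forall>T\<ge>T0. \<forall>\<nu>\<ge>0.
    norm (osc_sum \<epsilon> g N \<eta> T \<nu> - (exp (\<i> * of_real (\<epsilon> * (\<nu> * \<eta>))) - 1) ^ N * exp (\<i> * of_real (\<epsilon> * (\<nu> * T)))) \<le> C * (1 + \<nu>) / T"
proof -
  define y where "y = real N * \<eta>"
  have y0: "y > 0" using N eta by (simp add: y_def)
  define C where "C = 2 ^ N * (3 * (y * norm g) + y\<^sup>2)"
  define T0 where "T0 = 1 + y + 2 * (y * norm g)"
  show ?thesis
  proof (rule exI[of _ C], intro conjI, simp add: C_def less_imp_le[OF y0], rule exI[of _ T0], intro conjI allI impI)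
    show "T0 \<ge> 1" using y0 by (simp add: T0_def)
    fix T \<nu> :: real assume T: "T \<ge> T0" and \<nu>: "\<nu> \<ge> 0"
    have "y * norm g \<ge> 0" using y0 by simp
    then have T1: "T \<ge> 1" "T \<ge> y" "T \<ge> 2 * (y * norm g)" using T y0 unfolding T0_def by linarith+
    have T0: "T > 0" using T1 by simp
    define X where "X j = exp (\<i> * of_real (\<epsilon> * (\<nu> * (T * exp (real j * \<eta> / T)))))" for j :: nat
    define V where "V j = exp (\<i> * of_real (\<epsilon> * (\<nu> * (T + real j * \<eta>))))" for j :: nat
    define k where "k j = (of_nat (N choose j) * (-1) ^ (N - j) :: complex)" for j
    have bin: "(\<Sum>j\<le>N. k j * z ^ j) = (z - 1) ^ N" for z
      using binomial_ring[of z "-1" N] by (simp add: k_def mult_ac)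
    have "(exp (\<i> * of_real (\<epsilon> * (\<nu> * \<eta>))) - 1) ^ N * exp (\<i> * of_real (\<epsilon> * (\<nu> * T))) = (\<Sum>j\<le>N. k j * V j)"
    proof -
      have "V j = exp (\<i> * of_real (\<epsilon> * (\<nu> * \<eta>))) ^ j * exp (\<i> * of_real (\<epsilon> * (\<nu> * T)))" for j
        unfolding V_def exp_of_nat_mult[symmetric] mult_exp_exp by (rule arg_cong[of _ _ exp]) (simp add: algebra_simps)
      then show ?thesis unfolding bin[symmetric] sum_distrib_right by (simp add: mult.assoc)
    qed
    also have "\<dots> = (\<Sum>j\<le>N. k j * V j) - (\<Sum>j\<le>N. k j * 1 ^ j)" unfolding bin using N by simp
    also have "\<dots> = (\<Sum>j\<le>N. k j * (V j - 1))" by (simp add: sum_subtractf right_diff_distrib)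
    finally have t: "(exp (\<i> * of_real (\<epsilon> * (\<nu> * \<eta>))) - 1) ^ N * exp (\<i> * of_real (\<epsilon> * (\<nu> * T))) = (\<Sum>j\<le>N. k j * (V j - 1))" .
    have "osc_sum \<epsilon> g N \<eta> T \<nu> - (\<Sum>j\<le>N. k j * (V j - 1)) =
       (\<Sum>j\<le>N. k j * ((exp (of_real (real j * \<eta> / T) * g) - 1) * (X j - 1) + (X j - V j)))"
      unfolding osc_sum_def X_def[symmetric] k_def[symmetric] sum_subtractf[symmetric]
      by (intro sum.cong refl) (simp add: algebra_simps)
    also have "norm \<dots> \<le> (\<Sum>j\<le>N. real (N choose j) * ((3 * (y * norm g) + y\<^sup>2) * (1 + \<nu>) / T))"
    proof (rule sum_norm_le)
      fix j assume "j \<in> {..N}"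
      then have j: "j \<le> N" by simp
      define x where "x = real j * \<eta>"
      have x: "0 \<le> x" "x \<le> y" using j eta by (auto simp: x_def y_def)
      have "norm (of_real (x / T) * g) = x * norm g / T" using x T0 by (simp add: norm_mult norm_divide)
      also have "\<dots> \<le> y * norm g / T" using x T0 by (intro divide_right_mono mult_right_mono) auto
      finally have ng: "norm (of_real (x / T) * g) \<le> y * norm g / T" .
      have "y * norm g / T \<le> 1/2" using T1 T0 by (simp add: divide_le_eq)
      with ng have "norm (of_real (x / T) * g) \<le> 1/2" by linarith
      then have "norm (exp (of_real (x / T) * g) - 1) \<le> 3/2 * norm (of_real (x / T) * g)" by (rule norm_exp_bounds(2))
      also have "\<dots> \<le> 3/2 * (y * norm g / T)" using ng by simp
      finally have e1: "norm (exp (of_real (x / T) * g) - 1) \<le> 3/2 * (y * norm g / T)" .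
      have e2: "norm (X j - 1) \<le> 2" using norm_triangle_ineq4[of "X j" 1] by (simp add: X_def)
      have "norm (X j - V j) \<le> \<bar>\<epsilon> * (\<nu> * (T * exp (x / T))) - \<epsilon> * (\<nu> * (T + x))\<bar>"
        unfolding X_def V_def x_def by (rule norm_exp_ii_diff_le)
      also have "\<dots> = \<bar>\<epsilon>\<bar> * \<bar>\<nu>\<bar> * \<bar>T * exp (x / T) - (T + x)\<bar>" by (simp only: right_diff_distrib[symmetric] abs_mult mult.assoc)
      also have "\<dots> = \<nu> * \<bar>T * exp (x / T) - (T + x)\<bar>" using eps \<nu> by simp
      also have "\<bar>T * exp (x / T) - (T + x)\<bar> \<le> y\<^sup>2 / T"
      proof -
        have xT: "0 \<le> x / T" "x / T \<le> 1" using x T1 T0 by auto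
        have "1 + x / T \<le> exp (x / T)" by (rule exp_ge_add_one_self)
        moreover have "exp (x / T) \<le> 1 + x / T + (x / T)\<^sup>2" using xT by (rule exp_bound)
        ultimately have "0 \<le> T * (exp (x / T) - (1 + x / T))" "T * (exp (x / T) - (1 + x / T)) \<le> T * (x / T)\<^sup>2"
          using T0 by (auto intro!: mult_left_mono)
        moreover have "T * (exp (x / T) - (1 + x / T)) = T * exp (x / T) - (T + x)" using T0 by (simp add: algebra_simps)
        moreover have "T * (x / T)\<^sup>2 = x\<^sup>2 / T" using T0 by (simp add: power2_eq_square)
        moreover have "x\<^sup>2 / T \<le> y\<^sup>2 / T" using x T0 by (intro divide_right_mono power_mono) auto
        ultimately show ?thesis by linarith
      qed
      finally have e3: "norm (X j - V j) \<le> \<nu> * (y\<^sup>2 / T)" using \<nu> by (simp add: mult_left_mono)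
      have "norm ((exp (of_real (x / T) * g) - 1) * (X j - 1) + (X j - V j)) \<le> 3/2 * (y * norm g / T) * 2 + \<nu> * (y\<^sup>2 / T)"
        by (intro norm_triangle_le add_mono e3) (use e1 e2 in \<open>simp only: norm_mult, intro mult_mono, auto intro: order_trans[OF norm_ge_zero]\<close>)
      also have "\<dots> = (3 * (y * norm g) + \<nu> * y\<^sup>2) / T" by (simp add: add_divide_distrib)
      also have "\<dots> \<le> ((3 * (y * norm g) + y\<^sup>2) * (1 + \<nu>)) / T"
        using T0 \<nu> y0 by (intro divide_right_mono) (auto simp: algebra_simps)
      finally have "real (N choose j) * norm ((exp (of_real (x / T) * g) - 1) * (X j - 1) + (X j - V j)) \<le> real (N choose j) * ((3 * (y * norm g) + y\<^sup>2) * (1 + \<nu>) / T)"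
        by (intro mult_left_mono) auto
      moreover have "norm (k j) = real (N choose j)" by (simp add: k_def norm_mult norm_power)
      ultimately show "norm (k j * ((exp (of_real (real j * \<eta> / T) * g) - 1) * (X j - 1) + (X j - V j))) \<le> real (N choose j) * ((3 * (y * norm g) + y\<^sup>2) * (1 + \<nu>) / T)"
        by (simp only: norm_mult x_def)
    qed
    also have "\<dots> = (\<Sum>j\<le>N. real (N choose j)) * ((3 * (y * norm g) + y\<^sup>2) * (1 + \<nu>) / T)" by (rule sum_distrib_right[symmetric])
    also have "(\<Sum>j\<le>N. real (N choose j)) = 2 ^ N" using choose_row_sum[of N] by (metis of_nat_sum of_nat_numeral of_nat_power)
    also have "2 ^ N * ((3 * (y * norm g) + y\<^sup>2) * (1 + \<nu>) / T) = C * (1 + \<nu>) / T" by (simp add: C_def)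
    finally show "norm (osc_sum \<epsilon> g N \<eta> T \<nu> - (exp (\<i> * of_real (\<epsilon> * (\<nu> * \<eta>))) - 1) ^ N * exp (\<i> * of_real (\<epsilon> * (\<nu> * T)))) \<le> C * (1 + \<nu>) / T"
      unfolding t .
  qed
qed

text \<open>Two bounds, because one factor of the N-th power is estimated linearly, to gain h, and
  the others trivially by 2. The 4 makes the linear bound cover |z| > 1/2 as well.\<close>

lemma norm_exp_minus_one_le_left:
  fixes z :: complex assumes "Re z \<le> 0"
  shows "norm (exp z - 1) \<le> 2" "norm (exp z - 1) \<le> 4 * norm z"
proof -
  have "norm (exp z) \<le> 1" using assms by simp
  then show 2: "norm (exp z - 1) \<le> 2" using norm_triangle_ineq4[of "exp z" 1] norm_one[where 'a = complex] by linarith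
  show "norm (exp z - 1) \<le> 4 * norm z"
  proof (cases "norm z \<le> 1/2")
    case True
    then show ?thesis using norm_exp_bounds(2)[OF True] norm_ge_zero[of z] by linarith
  next
    case False
    then show ?thesis using 2 by linarith
  qed
qed

lemma norm_gen_dirichlet_line_le:
  assumes pos: "\<And>n. lam n > 0" and summ: "summable (\<lambda>n. norm (a n) * lam n powr (- \<sigma>))"
  shows "norm (gen_dirichlet a lam (Complex \<sigma> t)) \<le> (\<Sum>n. norm (a n) * lam n powr (- \<sigma>))"
  unfolding gen_dirichlet_def by (rule norm_suminf_le[OF _ summ]) (simp add: norm_dirichlet_term[OF pos])

text \<open>Since \<open>G\<close> minus its main term is O(|\<tau>|^(-9/4)), one kernel factor can
  be traded through |exp (-h u) - 1| \<le> 4 h |u|: the power |\<tau>|^(-5/4) is still integrable,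
  and h contributes 1/T. Against T^(Re g) = T^(-2 A c - 3/4) the error is thus smaller by
  T^(-1/4).\<close>

lemma left_line_main_term:
  fixes b :: "nat \<Rightarrow> complex" and mu :: "nat \<Rightarrow> real" and c A k1 \<eta> K :: real and g D1 D2 :: complex
    and G :: "real \<Rightarrow> complex" and N :: nat
  assumes mu_pos: "\<And>n. mu n > 0" and summ: "summable (\<lambda>n. norm (b n) * mu n powr (- (1 + c)))"
    and A: "A > 0" and c: "c > 0" and line: "2 * A * c + Re g = - 3/4" and N: "N \<ge> 1" and eta: "\<eta> > 0"
    and contG: "continuous_on UNIV G" and K: "K \<ge> 0"
    and Gb: "\<And>\<tau>. norm (G \<tau> - exp (of_real k1 * Complex c \<tau>) * Gamma (of_real (2 * A) * Complex c \<tau> + g) *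
      (D1 * exp (\<i> * of_real pi * of_real A * Complex c \<tau>) + D2 * exp (- (\<i> * of_real pi * of_real A * Complex c \<tau>)))) \<le> K * (1 + \<bar>\<tau>\<bar>) powr (- (9/4))"
  defines "\<nu> \<equiv> \<lambda>n. exp ((ln (mu n) - k1) / (2 * A))"
    and "P \<equiv> \<lambda>D \<epsilon> n. b n * of_real (inverse (mu n)) * exp (of_real ((ln (mu n) - k1) / (2 * A)) * g) *
       (of_real (pi / A) * exp (- (of_real \<epsilon> * \<i> * of_real pi / 2 * g)) * D)"
    and "kk \<equiv> \<lambda>T \<tau>. (exp (- (of_real (2 * A * \<eta> / T) * Complex c \<tau>)) - 1) ^ N * exp (- (of_real (2 * A * ln T) * Complex c \<tau>))"
  shows "\<exists>C\<ge>0. \<forall>T\<ge>1. integrable lborel (\<lambda>\<tau>. gen_dirichlet b mu (Complex (1 + c) \<tau>) * (G \<tau> * kk T \<tau>)) \<and>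
     norm ((LINT \<tau>|lborel. gen_dirichlet b mu (Complex (1 + c) \<tau>) * (G \<tau> * kk T \<tau>)) -
       exp (of_real (ln T) * g) * (\<Sum>n. P D1 1 n * osc_sum 1 g N \<eta> T (\<nu> n) + P D2 (- 1) n * osc_sum (- 1) g N \<eta> T (\<nu> n)))
      \<le> C / T * T powr (- (2 * A * c))"
proof -
  define m where "m \<epsilon> \<tau> = exp (of_real k1 * Complex c \<tau>) * Gamma (of_real (2 * A) * Complex c \<tau> + g) * exp (of_real \<epsilon> * (\<i> * of_real pi * of_real A * Complex c \<tau>))" for \<epsilon> :: real and \<tau>
  define main where "main \<tau> = D1 * m 1 \<tau> + D2 * m (- 1) \<tau>" for \<tau>
  have Gb': "norm (G \<tau> - main \<tau>) \<le> K * (1 + \<bar>\<tau>\<bar>) powr (- (9/4))" for \<tau>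
    using Gb[of \<tau>] by (simp add: main_def m_def algebra_simps)
  define \<Psi> where "\<Psi> = (\<Sum>n. norm (b n) * mu n powr (- (1 + c)))"
  have \<Psi>0: "\<Psi> \<ge> 0" unfolding \<Psi>_def by (intro suminf_nonneg summ) auto
  define J where "J = integral\<^sup>L lborel (\<lambda>t::real. (1 + \<bar>t\<bar>) powr (- (5/4)) :: real)"
  have J0: "J \<ge> 0" unfolding J_def by (intro integral_nonneg_AE) auto
  define C0 where "C0 = K * (2 ^ N * (4 * (2 * A * \<eta>) * (c + 1)))"
  have C00: "C0 \<ge> 0" using K A eta c by (simp add: C0_def)
  note tr = main_term_transform[OF A line, where ?k1.0 = k1, folded m_def]
  show ?thesis
  proof (rule exI[of _ "\<Psi> * C0 * J"], intro conjI allI impI)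
    show "0 \<le> \<Psi> * C0 * J" using \<Psi>0 C00 J0 by simp
    fix T :: real assume T: "T \<ge> 1"
    define h where "h = 2 * A * \<eta> / T"
    define L where "L = 2 * A * ln T"
    define X where "X = T powr (- (2 * A * c))"
    have h: "h > 0" using A eta T by (simp add: h_def)
    have kk: "kk T \<tau> = (exp (- (of_real h * Complex c \<tau>)) - 1) ^ N * exp (- (of_real L * Complex c \<tau>))" for \<tau>
      unfolding kk_def h_def L_def ..
    have nX: "norm (exp (- (of_real L * Complex c \<tau>))) = X" for \<tau>
      using T by (simp add: X_def L_def powr_def)
    have nkk: "norm (kk T \<tau>) \<le> 2 ^ N * (4 * h * (c + 1)) * (1 + \<bar>\<tau>\<bar>) * X" for \<tau>
    proof -
      define z where "z = - (of_real h * Complex c \<tau>)"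
      have re: "Re z \<le> 0" using h c by (simp add: z_def)
      have nz: "norm z \<le> h * ((c + 1) * (1 + \<bar>\<tau>\<bar>))"
      proof -
        have "norm (Complex c \<tau>) \<le> c + \<bar>\<tau>\<bar>" using cmod_le[of "Complex c \<tau>"] c by simp
        also have "\<dots> \<le> (c + 1) * (1 + \<bar>\<tau>\<bar>)" using c by (simp add: algebra_simps)
        finally show ?thesis using h by (simp add: z_def norm_mult)
      qed
      obtain N' where N': "N = Suc N'" using N by (cases N) auto
      have "norm (exp z - 1) ^ N = norm (exp z - 1) * norm (exp z - 1) ^ N'" by (simp add: N')
      also have "\<dots> \<le> (4 * (h * ((c + 1) * (1 + \<bar>\<tau>\<bar>)))) * 2 ^ N'"
        using norm_exp_minus_one_le_left[OF re] nz h c by (intro mult_mono power_mono) auto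
      also have "\<dots> \<le> (4 * (h * ((c + 1) * (1 + \<bar>\<tau>\<bar>)))) * 2 ^ N"
        using h c by (intro mult_left_mono) (auto simp: N')
      finally have "norm (exp z - 1) ^ N \<le> 2 ^ N * (4 * h * (c + 1)) * (1 + \<bar>\<tau>\<bar>)" by (simp only: mult_ac)
      then have "norm (exp z - 1) ^ N * X \<le> 2 ^ N * (4 * h * (c + 1)) * (1 + \<bar>\<tau>\<bar>) * X"
        by (intro mult_right_mono) (auto simp: X_def)
      then show ?thesis unfolding kk norm_mult norm_power nX z_def .
    qed
    \<comment> \<open>The binomial expansion writes the kernel as a combination of pure
      exponentials, and \<open>main_term_transform\<close> evaluates the integral for each of
      them.\<close>
    have kksum: "kk T \<tau> = (\<Sum>j\<le>N. of_nat (N choose j) * (-1) ^ (N - j) * exp (- (of_real (L + real j * h) * Complex c \<tau>)))" for \<tau>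
    proof -
      have b1: "(exp (- (of_real h * Complex c \<tau>)) - 1) ^ N = (\<Sum>j\<le>N. of_nat (N choose j) * exp (- (of_real h * Complex c \<tau>)) ^ j * (-1) ^ (N - j))"
        using binomial_ring[of "exp (- (of_real h * Complex c \<tau>))" "-1" N] by simp
      have b2: "exp (- (of_real (L + real j * h) * Complex c \<tau>)) = exp (- (of_real h * Complex c \<tau>)) ^ j * exp (- (of_real L * Complex c \<tau>))" for j
        unfolding exp_of_nat_mult[symmetric] mult_exp_exp by (rule arg_cong[of _ _ exp]) (simp add: algebra_simps)
      show ?thesis unfolding kk b1 b2 sum_distrib_right by (simp only: mult_ac)
    qed
    have contkk: "continuous_on UNIV (kk T)" unfolding kk by (intro continuous_intros)
    have intm: "integrable lborel (\<lambda>\<tau>. main \<tau> * kk T \<tau>)"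
    proof -
      have "main \<tau> * kk T \<tau> = (\<Sum>j\<le>N. of_nat (N choose j) * (-1) ^ (N - j) * (D1 * (m 1 \<tau> * exp (- (of_real (L + real j * h) * Complex c \<tau>)))
          + D2 * (m (- 1) \<tau> * exp (- (of_real (L + real j * h) * Complex c \<tau>)))))" for \<tau>
        unfolding kksum main_def sum_distrib_left by (intro sum.cong refl) (simp add: algebra_simps)
      then show ?thesis
        by (simp only:) (intro Bochner_Integration.integrable_sum integrable_mult_right Bochner_Integration.integrable_add tr(1), auto)
    qed
    have Eb: "norm ((G \<tau> - main \<tau>) * kk T \<tau>) \<le> C0 / T * X * (1 + \<bar>\<tau>\<bar>) powr (- (5/4))" for \<tau>
    proof -
      have "norm ((G \<tau> - main \<tau>) * kk T \<tau>) \<le> (K * (1 + \<bar>\<tau>\<bar>) powr (- (9/4))) * (2 ^ N * (4 * h * (c + 1)) * (1 + \<bar>\<tau>\<bar>) * X)"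
        unfolding norm_mult using Gb'[of \<tau>] nkk[of \<tau>] K by (intro mult_mono) auto
      also have "\<dots> = C0 / T * X * ((1 + \<bar>\<tau>\<bar>) powr (- (9/4)) * (1 + \<bar>\<tau>\<bar>) powr 1)" by (simp add: C0_def h_def)
      also have "(1 + \<bar>\<tau>\<bar>) powr (- (9/4)) * (1 + \<bar>\<tau>\<bar>) powr 1 = (1 + \<bar>\<tau>\<bar>) powr (- (5/4))"
        unfolding powr_add[symmetric] by simp
      finally show ?thesis .
    qed
    have intE: "integrable lborel (\<lambda>\<tau>. (G \<tau> - main \<tau>) * kk T \<tau>)"
    proof (rule Bochner_Integration.integrable_bound)
      show "integrable lborel (\<lambda>\<tau>::real. C0 / T * X * (1 + \<bar>\<tau>\<bar>) powr (- (5/4)))"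
        by (intro integrable_mult_right integrable_one_plus_abs_powr) simp
      have "(\<lambda>\<tau>. G \<tau> * kk T \<tau>) \<in> borel_measurable lborel"
        using continuous_on_mult[OF contG contkk] by (simp add: borel_measurable_continuous_onI)
      then have "(\<lambda>\<tau>. G \<tau> * kk T \<tau> - main \<tau> * kk T \<tau>) \<in> borel_measurable lborel"
        by (rule borel_measurable_diff) (use intm in auto)
      then show "(\<lambda>\<tau>. (G \<tau> - main \<tau>) * kk T \<tau>) \<in> borel_measurable lborel" by (simp only: left_diff_distrib)
      show "AE \<tau> in lborel. norm ((G \<tau> - main \<tau>) * kk T \<tau>) \<le> norm (C0 / T * X * (1 + \<bar>\<tau>\<bar>) powr (- (5/4)))"
        by (intro AE_I2 order.trans[OF Eb]) (simp only: real_norm_def abs_ge_self)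
    qed
    let ?\<psi> = "\<lambda>\<tau>. gen_dirichlet b mu (Complex (1 + c) \<tau>)"
    note pE = gen_dirichlet_line_integral[OF mu_pos summ intE]
    note pm = gen_dirichlet_line_integral[OF mu_pos summ intm]
    have split: "?\<psi> \<tau> * (G \<tau> * kk T \<tau>) = ?\<psi> \<tau> * ((G \<tau> - main \<tau>) * kk T \<tau>) + ?\<psi> \<tau> * (main \<tau> * kk T \<tau>)" for \<tau>
      by (simp add: algebra_simps)
    show "integrable lborel (\<lambda>\<tau>. ?\<psi> \<tau> * (G \<tau> * kk T \<tau>))"
      unfolding split by (intro Bochner_Integration.integrable_add pE(1) pm(1))
    have IE: "norm (LINT \<tau>|lborel. ?\<psi> \<tau> * ((G \<tau> - main \<tau>) * kk T \<tau>)) \<le> (\<Psi> * (C0 / T * X)) * J"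
      unfolding J_def
    proof (rule norm_integral_line_le[OF _ pE(1)])
      fix \<tau>
      have "norm (?\<psi> \<tau> * ((G \<tau> - main \<tau>) * kk T \<tau>)) \<le> \<Psi> * (C0 / T * X * (1 + \<bar>\<tau>\<bar>) powr (- (5/4)))"
        unfolding norm_mult[of "?\<psi> \<tau>"] using norm_gen_dirichlet_line_le[OF mu_pos summ] Eb[of \<tau>] \<Psi>0
        by (intro mult_mono) (auto simp: \<Psi>_def)
      then show "norm (?\<psi> \<tau> * ((G \<tau> - main \<tau>) * kk T \<tau>)) \<le> \<Psi> * (C0 / T * X) * (1 + \<bar>\<tau>\<bar>) powr (- (5/4))" by (simp only: mult.assoc)
    qed simp
    let ?x = "\<lambda>n. P D1 1 n * osc_sum 1 g N \<eta> T (\<nu> n) + P D2 (- 1) n * osc_sum (- 1) g N \<eta> T (\<nu> n)"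
    let ?e = "exp (of_real (ln T) * g)"
    have summand: "(LINT \<tau>|lborel. b n * complex_of_real (mu n) powr (- Complex (1 + c) \<tau>) * (main \<tau> * kk T \<tau>)) = ?e * ?x n" for n
    proof -
      define Y where "Y j = L + real j * h + ln (mu n)" for j :: nat
      define w where "w j = b n * of_real (inverse (mu n)) * (of_nat (N choose j) * (-1) ^ (N - j))" for j
      have "b n * complex_of_real (mu n) powr (- Complex (1 + c) \<tau>) * (main \<tau> * kk T \<tau>) =
        (\<Sum>j\<le>N. w j * (D1 * (m 1 \<tau> * exp (- (of_real (Y j) * Complex c \<tau>))) + D2 * (m (- 1) \<tau> * exp (- (of_real (Y j) * Complex c \<tau>)))))" for \<tau>
      proof -
        have "Complex (1 + c) \<tau> = 1 + Complex c \<tau>" by (simp add: complex_eq_iff)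
        then have "complex_of_real (mu n) powr (- Complex (1 + c) \<tau>) = exp (- of_real (ln (mu n))) * exp (- (of_real (ln (mu n)) * Complex c \<tau>))"
          unfolding of_real_powr_eq_exp[OF mu_pos] mult_exp_exp by (simp add: algebra_simps)
        also have "exp (- of_real (ln (mu n))) = complex_of_real (inverse (mu n))"
        proof -
          have "exp (- complex_of_real (ln (mu n))) = of_real (exp (- ln (mu n)))" by (simp only: of_real_minus[symmetric] exp_of_real)
          also have "exp (- ln (mu n)) = inverse (mu n)" using mu_pos[of n] by (simp add: exp_minus)
          finally show ?thesis .
        qed
        finally have pw: "complex_of_real (mu n) powr (- Complex (1 + c) \<tau>) = of_real (inverse (mu n)) * exp (- (of_real (ln (mu n)) * Complex c \<tau>))" .
        have ex: "exp (- (of_real (Y j) * Complex c \<tau>)) = exp (- (of_real (ln (mu n)) * Complex c \<tau>)) * exp (- (of_real (L + real j * h) * Complex c \<tau>))" for j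
          unfolding Y_def mult_exp_exp by (rule arg_cong[of _ _ exp]) (simp add: algebra_simps)
        show ?thesis unfolding pw ex kksum main_def w_def sum_distrib_left
          by (intro sum.cong refl) (simp only: distrib_left distrib_right mult_ac)
      qed
      then have "(LINT \<tau>|lborel. b n * complex_of_real (mu n) powr (- Complex (1 + c) \<tau>) * (main \<tau> * kk T \<tau>)) =
         (LINT \<tau>|lborel. (\<Sum>j\<le>N. w j * (D1 * (m 1 \<tau> * exp (- (of_real (Y j) * Complex c \<tau>))) + D2 * (m (- 1) \<tau> * exp (- (of_real (Y j) * Complex c \<tau>))))))"
        by (simp only:)
      also have "\<dots> = (\<Sum>j\<le>N. (LINT \<tau>|lborel. w j * (D1 * (m 1 \<tau> * exp (- (of_real (Y j) * Complex c \<tau>))) + D2 * (m (- 1) \<tau> * exp (- (of_real (Y j) * Complex c \<tau>))))))"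
        by (rule Bochner_Integration.integral_sum) (intro integrable_mult_right Bochner_Integration.integrable_add tr(1), auto)
      also have "\<dots> = (\<Sum>j\<le>N. w j * (D1 * (LINT \<tau>|lborel. m 1 \<tau> * exp (- (of_real (Y j) * Complex c \<tau>))) + D2 * (LINT \<tau>|lborel. m (- 1) \<tau> * exp (- (of_real (Y j) * Complex c \<tau>)))))"
      proof (rule sum.cong[OF refl])
        fix j
        have i1: "integrable lborel (\<lambda>\<tau>. D1 * (m 1 \<tau> * exp (- (of_real (Y j) * Complex c \<tau>))))"
          "integrable lborel (\<lambda>\<tau>. D2 * (m (- 1) \<tau> * exp (- (of_real (Y j) * Complex c \<tau>))))"
          by (intro integrable_mult_right tr(1), simp)+
        show "(LINT \<tau>|lborel. w j * (D1 * (m 1 \<tau> * exp (- (of_real (Y j) * Complex c \<tau>))) + D2 * (m (- 1) \<tau> * exp (- (of_real (Y j) * Complex c \<tau>))))) =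
          w j * (D1 * (LINT \<tau>|lborel. m 1 \<tau> * exp (- (of_real (Y j) * Complex c \<tau>))) + D2 * (LINT \<tau>|lborel. m (- 1) \<tau> * exp (- (of_real (Y j) * Complex c \<tau>))))"
          unfolding integral_mult_right_zero[of _ "w j"] Bochner_Integration.integral_add[OF i1] integral_mult_right_zero ..
      qed
      also have "\<dots> = (\<Sum>j\<le>N. ?e * (P D1 1 n * (of_nat (N choose j) * (-1) ^ (N - j) * exp (of_real (real j * \<eta> / T) * g) *
           (exp (\<i> * of_real (1 * (\<nu> n * (T * exp (real j * \<eta> / T))))) - 1)) + P D2 (- 1) n * (of_nat (N choose j) * (-1) ^ (N - j) * exp (of_real (real j * \<eta> / T) * g) *
           (exp (\<i> * of_real ((- 1) * (\<nu> n * (T * exp (real j * \<eta> / T))))) - 1))))"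
      proof (rule sum.cong[OF refl])
        fix j
        define Z where "Z = (Y j - k1) / (2 * A)"
        \<comment> \<open>Dividing by 2 A undoes the factor 2 A in \<open>L\<close> and
          \<open>h\<close>; so exp Z is the frequency \<open>\<nu> n\<close> times the node T exp (j
          \<eta>/T).\<close>
        have Zeq: "Z = ln T + real j * \<eta> / T + (ln (mu n) - k1) / (2 * A)"
          unfolding Z_def Y_def L_def h_def using A T by (simp add: field_simps)
        have eZ: "exp Z = \<nu> n * (T * exp (real j * \<eta> / T))" unfolding Zeq \<nu>_def using T by (simp add: exp_add)
        have eZg: "exp (of_real Z * g) = ?e * exp (of_real (real j * \<eta> / T) * g) * exp (of_real ((ln (mu n) - k1) / (2 * A)) * g)"
          unfolding Zeq mult_exp_exp by (rule arg_cong[of _ _ exp]) (simp add: algebra_simps)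
        show "w j * (D1 * (LINT \<tau>|lborel. m 1 \<tau> * exp (- (of_real (Y j) * Complex c \<tau>))) + D2 * (LINT \<tau>|lborel. m (- 1) \<tau> * exp (- (of_real (Y j) * Complex c \<tau>)))) =
          ?e * (P D1 1 n * (of_nat (N choose j) * (-1) ^ (N - j) * exp (of_real (real j * \<eta> / T) * g) *
           (exp (\<i> * of_real (1 * (\<nu> n * (T * exp (real j * \<eta> / T))))) - 1)) + P D2 (- 1) n * (of_nat (N choose j) * (-1) ^ (N - j) * exp (of_real (real j * \<eta> / T) * g) *
           (exp (\<i> * of_real ((- 1) * (\<nu> n * (T * exp (real j * \<eta> / T))))) - 1)))"
          unfolding tr(2)[of 1, simplified abs_one, OF refl] tr(2)[of "-1", simplified abs_minus_cancel abs_one, OF refl] Z_def[symmetric] eZ eZg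
          unfolding w_def P_def by (simp only: distrib_left mult_ac)
      qed
      also have "\<dots> = ?e * ?x n" unfolding osc_sum_def by (simp only: sum_distrib_left[symmetric] sum.distrib)
      finally show ?thesis .
    qed
    have "(\<lambda>n. ?e * ?x n) sums (LINT \<tau>|lborel. ?\<psi> \<tau> * (main \<tau> * kk T \<tau>))"
      using pm(2) unfolding summand .
    from sums_divide[OF this, of ?e] have "?x sums ((LINT \<tau>|lborel. ?\<psi> \<tau> * (main \<tau> * kk T \<tau>)) / ?e)" by simp
    from sums_unique[OF this] have "?e * (\<Sum>n. ?x n) = ?e * ((LINT \<tau>|lborel. ?\<psi> \<tau> * (main \<tau> * kk T \<tau>)) / ?e)"
      by (simp only:)
    then have Im: "(LINT \<tau>|lborel. ?\<psi> \<tau> * (main \<tau> * kk T \<tau>)) = ?e * (\<Sum>n. ?x n)" by simp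
    have "(LINT \<tau>|lborel. ?\<psi> \<tau> * (G \<tau> * kk T \<tau>)) - ?e * (\<Sum>n. ?x n) = (LINT \<tau>|lborel. ?\<psi> \<tau> * ((G \<tau> - main \<tau>) * kk T \<tau>))"
      unfolding split Bochner_Integration.integral_add[OF pE(1) pm(1)] Im by simp
    then show "norm ((LINT \<tau>|lborel. ?\<psi> \<tau> * (G \<tau> * kk T \<tau>)) - ?e * (\<Sum>n. ?x n)) \<le> \<Psi> * C0 * J / T * T powr (- (2 * A * c))"
      using IE unfolding X_def by (simp add: mult_ac)
  qed
qed

subsection \<open>Exponential sums in gaps\<close>

lemma Re_pos_not_nonpos_Int: "Re z > 0 \<Longrightarrow> z \<notin> \<int>\<^sub>\<le>\<^sub>0"
  by (auto elim!: nonpos_Ints_cases)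

text \<open>In a gap the integral on the right line is 0, so the one on the left line is no larger
  than the contribution of the poles. Dividing its main term by T^g and replacing each
  \<open>osc_sum\<close> by its limit form leaves the almost periodic sum, with coefficients
  independent of T.\<close>

lemma gap_exponential_sum_small:
  fixes a b :: "nat \<Rightarrow> complex" and lam mu :: "nat \<Rightarrow> real"
    and sigma_star :: real and d :: nat and alpha :: "nat \<Rightarrow> real"
    and beta beta' :: "nat \<Rightarrow> complex" and omega :: complex
    and F :: "complex \<Rightarrow> complex" and R :: real
  assumes b0: "b 0 \<noteq> 0"
    and lam_pos: "\<And>n. lam n > 0"
    and mu_mono: "strict_mono mu" and mu_pos: "\<And>n. mu n > 0"
    and sigma_pos: "sigma_star > 0"
    and abs_a: "\<And>s. Re s \<ge> sigma_star \<Longrightarrow> summable (\<lambda>n. norm (a n * complex_of_real (lam n) powr (- s)))"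
    and abs_b: "\<And>s. Re s \<ge> sigma_star \<Longrightarrow> summable (\<lambda>n. norm (b n * complex_of_real (mu n) powr (- s)))"
    and d_pos: "d \<ge> 1" and alpha_pos: "\<And>\<nu>. \<nu> \<in> {1..d} \<Longrightarrow> alpha \<nu> > 0"
    and omega_norm: "norm omega = 1"
    and F_mero: "F meromorphic_on UNIV"
    and F_right: "\<And>s. Re s \<ge> sigma_star \<Longrightarrow> gamma_regular d alpha beta s \<Longrightarrow>
                    F s = gamma_factor d alpha beta s * gen_dirichlet a lam s"
    and F_left: "\<And>s. Re (1 - s) \<ge> sigma_star \<Longrightarrow> gamma_regular d alpha beta' (1 - s) \<Longrightarrow>
                    F s = omega * gamma_factor d alpha beta' (1 - s) * gen_dirichlet b mu (1 - s)"
    and R_pos: "R > 0"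
    and F_sing: "\<And>z. norm z \<ge> R \<Longrightarrow> F analytic_on {z}"
    and F_decay: "\<And>bl br e. e > 0 \<Longrightarrow> \<exists>T. \<forall>\<sigma> t. bl \<le> \<sigma> \<and> \<sigma> \<le> br \<and> \<bar>t\<bar> \<ge> T \<longrightarrow>
                    norm (F (Complex \<sigma> t)) < e"
  defines "A \<equiv> \<Sum>\<nu>=1..d. alpha \<nu>"
  shows "\<exists>(\<nu> :: nat \<Rightarrow> real) p q (N :: nat) (\<eta> :: real). strict_mono \<nu> \<and> \<nu> 0 > 0 \<and>
    summable (\<lambda>n. norm (p n)) \<and> summable (\<lambda>n. norm (q n)) \<and> p 0 \<noteq> 0 \<and> \<eta> > 0 \<and>
    (\<forall>e>0. \<exists>T0. \<forall>T\<ge>T0. (\<forall>n. ln (lam n) < 2 * A * ln T \<or> 2 * A * ln T + real N * (2 * A * \<eta> / T) < ln (lam n)) \<longrightarrow>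
       norm (\<Sum>n. p n * exp (\<i> * of_real (\<nu> n * T)) + q n * exp (- (\<i> * of_real (\<nu> n * T)))) \<le> e)"
proof -
  define I where "I = {1..d}"
  have I: "finite I" "I \<noteq> {}" "\<forall>i\<in>I. alpha i > 0" using d_pos alpha_pos by (auto simp: I_def)
  have AI: "A = (\<Sum>i\<in>I. alpha i)" by (simp add: A_def I_def)
  have A: "A > 0" unfolding AI using I by (intro sum_pos) auto
  define S where "S = (\<Sum>i\<in>I. beta' i - beta i)"
  \<comment> \<open>Large enough for all Gamma arguments on the two lines, including those from the
    reflection formula, to have positive real part.\<close>
  define sg where "sg = (\<Sum>i\<in>I. (\<bar>Re (beta i)\<bar> + \<bar>Re (beta' i)\<bar> + 1) / alpha i)"
  have sg0: "sg \<ge> 0" unfolding sg_def using I by (intro sum_nonneg divide_nonneg_nonneg) (auto intro: less_imp_le)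
  have sg: "alpha i * sg \<ge> \<bar>Re (beta i)\<bar> + \<bar>Re (beta' i)\<bar> + 1" if "i \<in> I" for i
  proof -
    have "(\<bar>Re (beta i)\<bar> + \<bar>Re (beta' i)\<bar> + 1) / alpha i \<le> sg"
      unfolding sg_def using that I by (intro member_le_sum divide_nonneg_nonneg) (auto intro: less_imp_le)
    then show ?thesis using I that by (simp add: pos_divide_le_eq mult.commute)
  qed
  \<comment> \<open>The right line: beyond the poles, inside absolute convergence, and at least 1
    for the kernel bounds. The 1/(8 A) makes the sum of w n * \<nu> n converge, because (Re g +
    1)/(2 A) = 1/(8 A) - c.\<close>
  define c0 where "c0 = R + 1 + sigma_star + 1 / (8 * A) + sg"
  have c0: "c0 > R" "c0 \<ge> 1" "c0 \<ge> sigma_star" "c0 \<ge> sigma_star + 1 / (8 * A)" "c0 \<ge> sg"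
  proof -
    have "1 / (8 * A) \<ge> 0" using A by simp
    then show "c0 > R" "c0 \<ge> 1" "c0 \<ge> sigma_star" "c0 \<ge> sigma_star + 1 / (8 * A)" "c0 \<ge> sg"
      unfolding c0_def using R_pos sigma_pos sg0 by linarith+
  qed
  \<comment> \<open>The equation 2 A c + Re g = -3/4 ties c to the integer \<open>M\<close> hidden
    in \<open>g\<close>. So \<open>M\<close> is first rounded up, and c \<ge> c0 is then computed
    from it; the + 2 secures M \<ge> 2.\<close>
  define M where "M = nat \<lceil>2 * A * c0 + 5/4 + A + Re S\<rceil> + 2"
  define c where "c = (real M - 5/4 - A - Re S) / (2 * A)"
  have cc0: "c \<ge> c0"
  proof -
    have "real M \<ge> 2 * A * c0 + 5/4 + A + Re S" unfolding M_def by linarith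
    then show ?thesis unfolding c_def using A by (simp add: pos_le_divide_eq mult.commute)
  qed
  have M2: "M \<ge> 2" by (simp add: M_def)
  have cR: "c > R" "c \<ge> 1" "c > 0" using cc0 c0 by linarith+
  define g where "g = 1/2 + of_real A + S - of_nat M"
  have line: "2 * A * c + Re g = - 3/4" using A by (simp add: c_def g_def)
  have reg: "alpha i * x + Re (beta i) > 0" "alpha i * (1 + x) + Re (beta' i) > 0" "1 - Re (beta i) + alpha i * x > 0"
    if "i \<in> I" "x \<ge> c0" for i x
  proof -
    have "alpha i * sg \<le> alpha i * x" "alpha i > 0" using that c0 I by (auto intro: mult_left_mono)
    moreover have "alpha i * (1 + x) = alpha i + alpha i * x" by (simp add: algebra_simps)
    ultimately show "alpha i * x + Re (beta i) > 0" "alpha i * (1 + x) + Re (beta' i) > 0" "1 - Re (beta i) + alpha i * x > 0"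
      using sg[OF that(1)] by linarith+
  qed
  define G where "G \<tau> = (\<Prod>i\<in>I. Gamma (of_real (alpha i) * (1 + Complex c \<tau>) + beta' i) * rGamma (beta i - of_real (alpha i) * Complex c \<tau>)) / Complex c \<tau> ^ M" for \<tau>
  have reg1: "\<forall>i\<in>I. alpha i * (1 + c) + Re (beta' i) > 0" and reg2: "\<forall>i\<in>I. 1 - Re (beta i) + alpha i * c > 0"
    using reg cc0 by blast+
  note factor = functional_factor_line_asymp[OF I cR(3) reg1 reg2, of M, folded AI S_def, folded g_def, OF line, folded G_def]
  have contG: "continuous_on UNIV G" using factor(1) by (simp only: G_def[abs_def])
  obtain D1 D2 and k1 K :: real where D1: "D1 \<noteq> 0" and K: "K \<ge> 0" and
    Gb: "\<And>\<tau>. norm (G \<tau> - exp (of_real k1 * Complex c \<tau>) * Gamma (of_real (2 * A) * Complex c \<tau> + g) *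
      (D1 * exp (\<i> * of_real pi * of_real A * Complex c \<tau>) + D2 * exp (- (\<i> * of_real pi * of_real A * Complex c \<tau>)))) \<le> K * (1 + \<bar>\<tau>\<bar>) powr (- (9/4))"
    using factor(2) by blast
  \<comment> \<open>N \<ge> M makes the spline vanish on both sides of its support; the second
    summand makes the pole contribution T^(2 A R - N) at most T^(Re g - 1).\<close>
  define N where "N = M + nat \<lceil>2 * A * R - Re g + 1\<rceil>"
  have N: "N \<ge> M" "N \<ge> 1" "real N \<ge> 2 * A * R - Re g + 1" using M2 unfolding N_def by linarith+
  define \<nu> where "\<nu> n = exp ((ln (mu n) - k1) / (2 * A))" for n
  \<comment> \<open>With \<nu> 0 * \<eta> = pi the difference factor at the lowest frequency is
    (-2)^N, so \<open>p 0\<close> inherits b 0 \<noteq> 0.\<close>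
  define \<eta> where "\<eta> = pi / \<nu> 0"
  have eta: "\<eta> > 0" by (simp add: \<eta>_def \<nu>_def)
  define P where "P D \<epsilon> n = b n * of_real (inverse (mu n)) * exp (of_real ((ln (mu n) - k1) / (2 * A)) * g) *
       (of_real (pi / A) * exp (- (of_real \<epsilon> * \<i> * of_real pi / 2 * g)) * D)" for D and \<epsilon> :: real and n
  define kk where "kk T \<tau> = (exp (- (of_real (2 * A * \<eta> / T) * Complex c \<tau>)) - 1) ^ N * exp (- (of_real (2 * A * ln T) * Complex c \<tau>))" for T \<tau>
  have sa: "summable (\<lambda>n. norm (a n) * lam n powr (- x))" if "x \<ge> sigma_star" for x
    using abs_a[of "of_real x"] that unfolding norm_dirichlet_term[OF lam_pos] by simp
  have sb: "summable (\<lambda>n. norm (b n) * mu n powr (- x))" if "x \<ge> sigma_star" for x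
    using abs_b[of "of_real x"] that unfolding norm_dirichlet_term[OF mu_pos] by simp
  have sbc: "summable (\<lambda>n. norm (b n) * mu n powr (- (1 + c)))" using cc0 c0 by (intro sb) linarith
  obtain C where C: "C \<ge> 0" and
    int_left: "\<And>T. T \<ge> 1 \<Longrightarrow> integrable lborel (\<lambda>\<tau>. gen_dirichlet b mu (Complex (1 + c) \<tau>) * (G \<tau> * kk T \<tau>))" and
    left: "\<And>T. T \<ge> 1 \<Longrightarrow> norm ((LINT \<tau>|lborel. gen_dirichlet b mu (Complex (1 + c) \<tau>) * (G \<tau> * kk T \<tau>)) -
       exp (of_real (ln T) * g) * (\<Sum>n. P D1 1 n * osc_sum 1 g N \<eta> T (\<nu> n) + P D2 (- 1) n * osc_sum (- 1) g N \<eta> T (\<nu> n)))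
      \<le> C / T * T powr (- (2 * A * c))"
    using left_line_main_term[OF mu_pos sbc A cR(3) line N(2) eta contG K Gb, folded kk_def \<nu>_def P_def] by blast
  \<comment> \<open>The continuation of the Dirichlet series. Multiplying by the entire functions
    \<open>rGamma\<close> instead of dividing by Gamma ensures that no singularities beyond those of
    \<open>F\<close> arise.\<close>
  define \<Phi> where "\<Phi> s = F s * (\<Prod>i\<in>I. rGamma (of_real (alpha i) * s + beta i))" for s
  define Q where "Q = {z. \<not> F analytic_on {z}}"
  have QR: "Q \<subseteq> ball 0 R"
  proof
    fix z assume "z \<in> Q"
    then have "\<not> norm z \<ge> R" using F_sing unfolding Q_def by blast
    then show "z \<in> ball 0 R" by simp
  qed
  have Qfin: "finite Q"
  proof -
    have "Q sparse_in UNIV" unfolding Q_def by (rule meromorphic_on_imp_sparse_singularities[OF F_mero])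
    then have "Q sparse_in cball 0 R" by (rule sparse_in_subset) auto
    then have "finite (cball 0 R \<inter> Q)" by (rule sparse_in_compact_finite) auto
    moreover have "cball 0 R \<inter> Q = Q" using QR by auto
    ultimately show ?thesis by simp
  qed
  have hol: "\<Phi> holomorphic_on UNIV - Q"
  proof -
    have "F analytic_on UNIV - Q" by (subst analytic_on_analytic_at) (auto simp: Q_def)
    then have "F holomorphic_on UNIV - Q" by (rule analytic_imp_holomorphic)
    then show ?thesis unfolding \<Phi>_def by (intro holomorphic_intros)
  qed
  have growth: "\<exists>T. \<forall>\<sigma> t. - c \<le> \<sigma> \<and> \<sigma> \<le> c0 \<and> \<bar>t\<bar> \<ge> T \<longrightarrow> norm (\<Phi> (Complex \<sigma> t)) * exp (- \<delta> * t\<^sup>2) \<le> e"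
    if "\<delta> > 0" "e > 0" for \<delta> e
    unfolding \<Phi>_def using decay_times_rGamma_prod[OF I(1,3) that F_decay] by blast
  obtain B where B: "\<And>h L. h > 0 \<Longrightarrow> h * R \<le> 1/2 \<Longrightarrow> L \<ge> 0 \<Longrightarrow>
     integrable lborel (\<lambda>t. \<Phi> (Complex c0 t) * (diff_kernel h N M (Complex c0 t) * exp (of_real L * Complex c0 t))) \<Longrightarrow>
     integrable lborel (\<lambda>t. \<Phi> (Complex (- c) t) * (diff_kernel h N M (Complex (- c) t) * exp (of_real L * Complex (- c) t))) \<Longrightarrow>
     (LINT t|lborel. \<Phi> (Complex c0 t) * (diff_kernel h N M (Complex c0 t) * exp (of_real L * Complex c0 t))) = 0 \<Longrightarrow>
     norm (LINT t|lborel. \<Phi> (Complex (- c) t) * (diff_kernel h N M (Complex (- c) t) * exp (of_real L * Complex (- c) t))) \<le> B * h ^ N * exp (L * R)"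
    using diff_kernel_left_line_bound[OF R_pos cR(1) c0(1) Qfin QR hol M2 growth, of N] by blast
  have GrG: "Gamma z * rGamma z = 1" if "Re z > 0" for z
    using Re_pos_not_nonpos_Int[OF that] by (simp add: rGamma_inverse_Gamma Gamma_eq_zero_iff)
  have right_eq: "\<Phi> (Complex c0 t) = gen_dirichlet a lam (Complex c0 t)" for t
  proof -
    have re: "Re (of_real (alpha i) * Complex c0 t + beta i) > 0" if "i \<in> I" for i using reg(1)[OF that, of c0] by simp
    have "gamma_regular d alpha beta (Complex c0 t)"
      unfolding gamma_regular_def I_def[symmetric] using re Re_pos_not_nonpos_Int by blast
    then have "F (Complex c0 t) = gamma_factor d alpha beta (Complex c0 t) * gen_dirichlet a lam (Complex c0 t)"
      using c0 by (intro F_right) auto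
    moreover have "gamma_factor d alpha beta (Complex c0 t) * (\<Prod>i\<in>I. rGamma (of_real (alpha i) * Complex c0 t + beta i)) = 1"
      unfolding gamma_factor_def I_def[symmetric] prod.distrib[symmetric] by (rule prod.neutral) (use GrG re in blast)
    ultimately show ?thesis unfolding \<Phi>_def by (simp add: mult.commute mult.left_commute)
  qed
  \<comment> \<open>With s = -u the imaginary part changes sign, hence the arguments -t; the sign
    (-1)^M comes from replacing s^M by u^M.\<close>
  have left_eq: "\<Phi> (Complex (- c) t) * (diff_kernel (2 * A * \<eta> / T) N M (Complex (- c) t) * exp (of_real (2 * A * ln T) * Complex (- c) t)) =
      omega * (- 1) ^ M * (gen_dirichlet b mu (Complex (1 + c) (- t)) * (G (- t) * kk T (- t)))" for t T
  proof -
    define u where "u = Complex c (- t)"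
    have s: "Complex (- c) t = - u" by (simp add: u_def complex_eq_iff)
    have u1: "1 - - u = Complex (1 + c) (- t)" "1 + u = Complex (1 + c) (- t)" by (simp_all add: u_def complex_eq_iff)
    have u0: "u \<noteq> 0" using cR by (simp add: u_def complex_eq_iff)
    have "Re (of_real (alpha i) * (1 - - u) + beta' i) > 0" if "i \<in> I" for i using reg(2)[OF that cc0] by (simp add: u_def)
    then have "gamma_regular d alpha beta' (1 - - u)"
      unfolding gamma_regular_def I_def[symmetric] using Re_pos_not_nonpos_Int by blast
    then have F: "F (- u) = omega * gamma_factor d alpha beta' (1 - - u) * gen_dirichlet b mu (1 - - u)"
      using c0 cc0 by (intro F_left) (auto simp: u_def)
    have "G (- t) * u ^ M = gamma_factor d alpha beta' (1 - - u) * (\<Prod>i\<in>I. rGamma (of_real (alpha i) * - u + beta i))"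
      using u0 unfolding G_def u_def[symmetric] gamma_factor_def I_def[symmetric] prod.distrib by simp
    then have q1: "\<Phi> (- u) = omega * gen_dirichlet b mu (1 - - u) * (G (- t) * u ^ M)"
      unfolding \<Phi>_def F by (simp add: mult_ac)
    have q2: "diff_kernel (2 * A * \<eta> / T) N M (- u) * exp (of_real (2 * A * ln T) * - u) = kk T (- t) / (- u) ^ M"
      unfolding diff_kernel_def kk_def u_def[symmetric] by simp
    have q3: "u ^ M / (- u) ^ M = (- 1) ^ M" using u0 by (simp add: power_minus[of u] power_one_over[symmetric])
    have "\<Phi> (- u) * (diff_kernel (2 * A * \<eta> / T) N M (- u) * exp (of_real (2 * A * ln T) * - u)) =
        omega * (u ^ M / (- u) ^ M) * (gen_dirichlet b mu (1 - - u) * (G (- t) * kk T (- t)))"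
      unfolding q1 q2 by simp
    then show ?thesis unfolding s q3 u1 .
  qed
  obtain C1 T1 where C1: "C1 \<ge> 0" "T1 \<ge> 1" and osc1: "\<And>T v. T \<ge> T1 \<Longrightarrow> v \<ge> 0 \<Longrightarrow>
     norm (osc_sum 1 g N \<eta> T v - (exp (\<i> * of_real (1 * (v * \<eta>))) - 1) ^ N * exp (\<i> * of_real (1 * (v * T)))) \<le> C1 * (1 + v) / T"
    using osc_sum_approx[of 1 \<eta> N g] eta N(2) by auto
  obtain C2 T2 where C2: "C2 \<ge> 0" "T2 \<ge> 1" and osc2: "\<And>T v. T \<ge> T2 \<Longrightarrow> v \<ge> 0 \<Longrightarrow>
     norm (osc_sum (- 1) g N \<eta> T v - (exp (\<i> * of_real ((- 1) * (v * \<eta>))) - 1) ^ N * exp (\<i> * of_real ((- 1) * (v * T)))) \<le> C2 * (1 + v) / T"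
    using osc_sum_approx[of "- 1" \<eta> N g] eta N(2) by (auto simp del: of_real_mult)
  define p where "p n = P D1 1 n * (exp (\<i> * of_real (\<nu> n * \<eta>)) - 1) ^ N" for n
  define q where "q n = P D2 (- 1) n * (exp (- (\<i> * of_real (\<nu> n * \<eta>))) - 1) ^ N" for n
  \<comment> \<open>The common size of the coefficients, up to constants. The factor 1 + \<nu> in
    \<open>osc_sum_approx\<close> requires the sum of w n * (1 + \<nu> n), not just that of w n, to
    converge.\<close>
  define w where "w n = norm (b n) * inverse (mu n) * exp ((ln (mu n) - k1) / (2 * A) * Re g)" for n
  define Pc where "Pc D \<epsilon> = norm (of_real (pi / A) * exp (- (of_real \<epsilon> * \<i> * of_real pi / 2 * g)) * D)" for D and \<epsilon> :: real
  have nP: "norm (P D \<epsilon> n) = w n * Pc D \<epsilon>" for D \<epsilon> n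
    unfolding P_def w_def Pc_def norm_mult using mu_pos[of n] by (simp add: norm_inverse)
  have pw: "inverse (mu n) * exp ((ln (mu n) - k1) / (2 * A) * r) = exp (- (k1 / (2 * A) * r)) * mu n powr (- (1 - r / (2 * A)))" for n r
  proof -
    have "inverse (mu n) = exp (- ln (mu n))" using mu_pos[of n] by (simp add: exp_minus)
    then have "inverse (mu n) * exp ((ln (mu n) - k1) / (2 * A) * r) = exp (- ln (mu n) + (ln (mu n) - k1) / (2 * A) * r)"
      by (simp only: exp_add)
    also have "- ln (mu n) + (ln (mu n) - k1) / (2 * A) * r = - (k1 / (2 * A) * r) + - (1 - r / (2 * A)) * ln (mu n)"
      by (simp add: algebra_simps diff_divide_distrib)
    also have "exp \<dots> = exp (- (k1 / (2 * A) * r)) * mu n powr (- (1 - r / (2 * A)))"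
      using mu_pos[of n] by (simp only: exp_add powr_def) simp
    finally show ?thesis .
  qed
  have sw: "summable w"
  proof -
    have "1 - Re g / (2 * A) \<ge> sigma_star"
    proof -
      have "Re g / (2 * A) \<le> 0 / (2 * A) - c" using line A by (simp add: field_simps)
      then show ?thesis using cc0 c0 by simp
    qed
    from summable_mult[OF sb[OF this], of "exp (- (k1 / (2 * A) * Re g))"] show ?thesis
      unfolding w_def mult.assoc pw by (simp add: mult_ac)
  qed
  have sw\<nu>: "summable (\<lambda>n. w n * \<nu> n)"
  proof -
    have "1 - (Re g + 1) / (2 * A) \<ge> sigma_star"
    proof -
      have "Re g + 1 = 1 / (8 * A) * (2 * A) - c * (2 * A)" using line A by (simp add: field_simps)
      then have "(Re g + 1) / (2 * A) = 1 / (8 * A) - c" using A by (simp only: left_diff_distrib[symmetric]) simp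
      then show ?thesis using cc0 c0 by simp
    qed
    from summable_mult[OF sb[OF this], of "exp (- (k1 / (2 * A) * (Re g + 1)))"]
    have "summable (\<lambda>n. norm (b n) * (inverse (mu n) * exp ((ln (mu n) - k1) / (2 * A) * (Re g + 1))))"
      unfolding pw by (simp add: mult_ac)
    moreover have "w n * \<nu> n = norm (b n) * (inverse (mu n) * exp ((ln (mu n) - k1) / (2 * A) * (Re g + 1)))" for n
      unfolding w_def \<nu>_def by (simp add: distrib_left exp_add)
    ultimately show ?thesis by simp
  qed
  have swp: "summable (\<lambda>n. w n * (1 + \<nu> n))" using summable_add[OF sw sw\<nu>] by (simp add: distrib_left)
  have w0: "w n \<ge> 0" for n using mu_pos[of n] by (simp add: w_def less_imp_le)
  have Pc0: "Pc D \<epsilon> \<ge> 0" for D \<epsilon> by (simp add: Pc_def)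
  have \<nu>0: "\<nu> n > 0" for n by (simp add: \<nu>_def)
  have ex2: "norm (exp (\<i> * of_real x) - 1) \<le> 2" for x
    using norm_triangle_ineq4[of "exp (\<i> * of_real x)" 1] by simp
  have ex2': "norm (exp (- (\<i> * of_real x)) - 1) \<le> 2" for x
    using ex2[of "- x"] by simp
  have sp: "summable (\<lambda>n. norm (p n))"
  proof (rule summable_comparison_test'[OF summable_mult2[OF sw, of "Pc D1 1 * 2 ^ N"]])
    fix n :: nat
    have "norm (p n) \<le> (w n * Pc D1 1) * 2 ^ N" unfolding p_def norm_mult nP norm_power
      by (intro mult_left_mono power_mono ex2) (auto simp: w0 Pc_def)
    then show "norm (norm (p n)) \<le> w n * (Pc D1 1 * 2 ^ N)" by (simp add: mult_ac)
  qed
  have sq: "summable (\<lambda>n. norm (q n))"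
  proof (rule summable_comparison_test'[OF summable_mult2[OF sw, of "Pc D2 (- 1) * 2 ^ N"]])
    fix n :: nat
    have "norm (q n) \<le> (w n * Pc D2 (- 1)) * 2 ^ N" unfolding q_def norm_mult nP norm_power
      by (intro mult_left_mono power_mono ex2') (auto simp: w0 Pc_def)
    then show "norm (norm (q n)) \<le> w n * (Pc D2 (- 1) * 2 ^ N)" by (simp add: mult_ac)
  qed
  have p0: "p 0 \<noteq> 0"
  proof -
    have "\<nu> 0 * \<eta> = pi" using \<nu>0[of 0] by (simp add: \<eta>_def)
    then have "exp (\<i> * of_real (\<nu> 0 * \<eta>)) = -1" by simp
    then show ?thesis unfolding p_def P_def using b0 D1 A mu_pos[of 0] by simp
  qed
  have \<nu>mono: "strict_mono \<nu>"
    unfolding strict_mono_def \<nu>_def using mu_mono mu_pos A by (auto simp: strict_mono_def divide_strict_right_mono)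
  define W where "W = (\<Sum>n. w n * (1 + \<nu> n)) * (Pc D1 1 * C1 + Pc D2 (- 1) * C2)"
  define B' where "B' = \<bar>B\<bar> * (2 * A * \<eta>) ^ N"
  \<comment> \<open>The three terms stem from the poles, from the error in Stirling's formula, and
    from replacing multiplicative by additive differences. T \<ge> 4 A \<eta> R is the condition h R
    \<le> 1/2.\<close>
  have bound: "norm (\<Sum>n. p n * exp (\<i> * of_real (\<nu> n * T)) + q n * exp (- (\<i> * of_real (\<nu> n * T)))) \<le> B' / T + C * T powr (- (1/4)) + W / T"
    if T: "T \<ge> T1" "T \<ge> T2" "T \<ge> 4 * A * \<eta> * R" and gap: "\<And>n. ln (lam n) < 2 * A * ln T \<or> 2 * A * ln T + real N * (2 * A * \<eta> / T) < ln (lam n)" for T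
  proof -
    have Tge: "T \<ge> 1" "T > 0" using T C1 by linarith+
    define h where "h = 2 * A * \<eta> / T"
    define L where "L = 2 * A * ln T"
    have h: "h > 0" using A eta Tge by (simp add: h_def)
    have hR: "h * R \<le> 1/2" using T(3) Tge by (simp add: h_def divide_le_eq mult_ac)
    have L: "L \<ge> 0" using A Tge by (simp add: L_def)
    define V where "V = (LINT \<tau>|lborel. gen_dirichlet b mu (Complex (1 + c) \<tau>) * (G \<tau> * kk T \<tau>))"
    define f where "f \<tau> = omega * (- 1) ^ M * (gen_dirichlet b mu (Complex (1 + c) \<tau>) * (G \<tau> * kk T \<tau>))" for \<tau>
    have intf: "integrable lborel f" unfolding f_def by (intro integrable_mult_right int_left Tge)
    have leq: "(\<lambda>t. \<Phi> (Complex (- c) t) * (diff_kernel h N M (Complex (- c) t) * exp (of_real L * Complex (- c) t))) = (\<lambda>t. f (- t))"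
      unfolding h_def L_def f_def left_eq ..
    have "norm (LINT t|lborel. f (- t)) \<le> B * h ^ N * exp (L * R)"
      unfolding leq[symmetric, THEN fun_cong]
    proof (rule B[OF h hR L])
      show "integrable lborel (\<lambda>t. \<Phi> (Complex c0 t) * (diff_kernel h N M (Complex c0 t) * exp (of_real L * Complex c0 t)))"
        unfolding right_eq using c0 M2
        by (intro gen_dirichlet_line_integral(1)[OF lam_pos sa] integrable_diff_kernel_exp) auto
      show "integrable lborel (\<lambda>t. \<Phi> (Complex (- c) t) * (diff_kernel h N M (Complex (- c) t) * exp (of_real L * Complex (- c) t)))"
        unfolding leq using lborel_integrable_real_affine[OF intf, of "-1" 0] by simp
      show "(LINT t|lborel. \<Phi> (Complex c0 t) * (diff_kernel h N M (Complex c0 t) * exp (of_real L * Complex c0 t))) = 0"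
        unfolding right_eq using c0 M2 N h gap unfolding h_def[symmetric] L_def[symmetric]
        by (intro gen_dirichlet_diff_kernel_integral_zero[OF lam_pos sa]) auto
    qed
    moreover have "(LINT t|lborel. f (- t)) = omega * (- 1) ^ M * V"
    proof -
      have "(LINT t|lborel. f (- t)) = (LINT t|lborel. f t)" using lborel_integral_real_affine[of "-1" f 0] by simp
      also have "\<dots> = omega * (- 1) ^ M * V" unfolding f_def V_def by (rule integral_mult_right_zero)
      finally show ?thesis .
    qed
    moreover have "norm (omega * (- 1) ^ M * V) = norm V" by (simp add: norm_mult norm_power omega_norm)
    ultimately have "norm V \<le> B * h ^ N * exp (L * R)" by simp
    also have "\<dots> \<le> \<bar>B\<bar> * h ^ N * exp (L * R)" using h by (intro mult_right_mono) auto
    also have "\<dots> = B' * (T powr (- real N) * T powr (2 * A * R))"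
    proof -
      have "h ^ N = (2 * A * \<eta>) ^ N * T powr (- real N)"
        using Tge by (simp add: h_def power_divide powr_minus_divide powr_realpow)
      moreover have "exp (L * R) = T powr (2 * A * R)" using Tge by (simp add: L_def powr_def mult_ac)
      ultimately show ?thesis unfolding B'_def by (simp only: mult_ac)
    qed
    finally have V1: "norm V \<le> B' * (T powr (- real N) * T powr (2 * A * R))" .
    define e where "e = exp (of_real (ln T) * g)"
    have ne: "norm e = T powr Re g" using Tge by (simp add: e_def powr_def mult.commute)
    define x where "x n = P D1 1 n * osc_sum 1 g N \<eta> T (\<nu> n) + P D2 (- 1) n * osc_sum (- 1) g N \<eta> T (\<nu> n)" for n
    define y where "y n = p n * exp (\<i> * of_real (\<nu> n * T)) + q n * exp (- (\<i> * of_real (\<nu> n * T)))" for n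
    have "norm (e * suminf x) \<le> norm V + norm (V - e * suminf x)"
      using norm_triangle_ineq4[of V "V - e * suminf x"] by simp
    also have "\<dots> \<le> B' * (T powr (- real N) * T powr (2 * A * R)) + C / T * T powr (- (2 * A * c))"
      using V1 left[OF Tge(1)] unfolding V_def e_def x_def by (intro add_mono)
    finally have "T powr Re g * norm (suminf x) \<le> B' * (T powr (- real N) * T powr (2 * A * R)) + C / T * T powr (- (2 * A * c))"
      by (simp only: norm_mult ne)
    then have "T powr (- Re g) * (T powr Re g * norm (suminf x)) \<le> T powr (- Re g) * (B' * (T powr (- real N) * T powr (2 * A * R)) + C / T * T powr (- (2 * A * c)))"
      by (intro mult_left_mono) auto
    also have "T powr (- Re g) * (T powr Re g * norm (suminf x)) = norm (suminf x)"
      using Tge by (simp add: mult.assoc[symmetric] powr_add[symmetric])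
    also have "T powr (- Re g) * (B' * (T powr (- real N) * T powr (2 * A * R)) + C / T * T powr (- (2 * A * c))) =
       B' * (T powr (- Re g) * T powr (- real N) * T powr (2 * A * R)) + C * (T powr (- Re g) * T powr (- 1) * T powr (- (2 * A * c)))"
      using Tge by (simp add: distrib_left powr_minus_divide)
    also have "T powr (- Re g) * T powr (- real N) * T powr (2 * A * R) = T powr (- Re g + - real N + 2 * A * R)"
      by (simp only: powr_add)
    also have "T powr (- Re g) * T powr (- 1) * T powr (- (2 * A * c)) = T powr (- Re g + - 1 + - (2 * A * c))"
      by (simp only: powr_add)
    also have "- Re g + - 1 + - (2 * A * c) = - (1/4)"
    proof -
      have "- Re g = 3/4 + 2 * A * c" using line by (simp add: algebra_simps)
      then show ?thesis by simp
    qed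
    also have "B' * T powr (- Re g + - real N + 2 * A * R) \<le> B' * T powr (- 1)"
      using N(3) Tge A eta by (intro mult_left_mono powr_mono) (auto simp: B'_def)
    finally have sx: "norm (suminf x) \<le> B' / T + C * T powr (- (1/4))" using Tge by (simp add: powr_minus_divide)
    have dl: "norm (x n - y n) \<le> w n * (1 + \<nu> n) * ((Pc D1 1 * C1 + Pc D2 (- 1) * C2) / T)" for n
    proof -
      have "x n - y n = P D1 1 n * (osc_sum 1 g N \<eta> T (\<nu> n) - (exp (\<i> * of_real (1 * (\<nu> n * \<eta>))) - 1) ^ N * exp (\<i> * of_real (1 * (\<nu> n * T)))) +
         P D2 (- 1) n * (osc_sum (- 1) g N \<eta> T (\<nu> n) - (exp (\<i> * of_real ((- 1) * (\<nu> n * \<eta>))) - 1) ^ N * exp (\<i> * of_real ((- 1) * (\<nu> n * T))))"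
        unfolding x_def y_def p_def q_def by (simp add: right_diff_distrib mult.assoc)
      also have "norm \<dots> \<le> (w n * Pc D1 1) * (C1 * (1 + \<nu> n) / T) + (w n * Pc D2 (- 1)) * (C2 * (1 + \<nu> n) / T)"
      proof (intro norm_triangle_le add_mono)
        have v: "\<nu> n \<ge> 0" using \<nu>0[of n] by simp
        show "norm (P D1 1 n * (osc_sum 1 g N \<eta> T (\<nu> n) - (exp (\<i> * of_real (1 * (\<nu> n * \<eta>))) - 1) ^ N * exp (\<i> * of_real (1 * (\<nu> n * T)))))
            \<le> (w n * Pc D1 1) * (C1 * (1 + \<nu> n) / T)"
          unfolding norm_mult[of "P D1 1 n"] nP by (rule mult_left_mono[OF osc1[OF T(1) v] mult_nonneg_nonneg[OF w0 Pc0]])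
        show "norm (P D2 (- 1) n * (osc_sum (- 1) g N \<eta> T (\<nu> n) - (exp (\<i> * of_real ((- 1) * (\<nu> n * \<eta>))) - 1) ^ N * exp (\<i> * of_real ((- 1) * (\<nu> n * T)))))
            \<le> (w n * Pc D2 (- 1)) * (C2 * (1 + \<nu> n) / T)"
          unfolding norm_mult[of "P D2 (- 1) n"] nP by (rule mult_left_mono[OF osc2[OF T(2) v] mult_nonneg_nonneg[OF w0 Pc0]])
      qed
      also have "\<dots> = w n * (1 + \<nu> n) * ((Pc D1 1 * C1 + Pc D2 (- 1) * C2) / T)" by (simp add: add_divide_distrib distrib_left mult_ac)
      finally show ?thesis .
    qed
    have sd: "summable (\<lambda>n. norm (x n - y n))"
      by (rule summable_comparison_test'[OF summable_mult2[OF swp, of "(Pc D1 1 * C1 + Pc D2 (- 1) * C2) / T"], of 0])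
        (simp only: real_norm_def abs_norm_cancel dl)
    have sd2: "norm (\<Sum>n. x n - y n) \<le> W / T"
    proof -
      have "norm (\<Sum>n. x n - y n) \<le> (\<Sum>n. w n * (1 + \<nu> n) * ((Pc D1 1 * C1 + Pc D2 (- 1) * C2) / T))"
        by (rule norm_suminf_le[OF dl summable_mult2[OF swp]])
      also have "\<dots> = W / T" unfolding suminf_mult2[OF swp, symmetric] W_def by simp
      finally show ?thesis .
    qed
    have sy: "summable y"
    proof (rule summable_norm_cancel, rule summable_comparison_test'[OF summable_add[OF sp sq]])
      show "norm (norm (y n)) \<le> norm (p n) + norm (q n)" for n
        unfolding y_def using norm_triangle_ineq[of "p n * exp (\<i> * of_real (\<nu> n * T))" "q n * exp (- (\<i> * of_real (\<nu> n * T)))"] by (simp add: norm_mult)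
    qed
    have sxs: "summable x" using summable_add[OF sy summable_norm_cancel[OF sd]] by simp
    have "suminf y = suminf x - (\<Sum>n. x n - y n)" unfolding suminf_diff[OF sxs sy, symmetric] by simp
    also have "norm \<dots> \<le> norm (suminf x) + norm (\<Sum>n. x n - y n)" by (rule norm_triangle_ineq4)
    also have "\<dots> \<le> (B' / T + C * T powr (- (1/4))) + W / T" by (intro add_mono sx sd2)
    finally show ?thesis unfolding y_def .
  qed
  have lim: "((\<lambda>T. B' / T + C * T powr (- (1/4)) + W / T) \<longlongrightarrow> 0 + C * 0 + 0) at_top"
    by (intro tendsto_intros tendsto_neg_powr tendsto_divide_0[OF tendsto_const] filterlim_at_top_imp_at_infinity filterlim_ident) auto
  show ?thesis
  proof (rule exI[of _ \<nu>], rule exI[of _ p], rule exI[of _ q], rule exI[of _ N], rule exI[of _ \<eta>], intro conjI allI impI)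
    show "strict_mono \<nu>" "\<nu> 0 > 0" "summable (\<lambda>n. norm (p n))" "summable (\<lambda>n. norm (q n))" "p 0 \<noteq> 0" "\<eta> > 0"
      by (fact \<nu>mono \<nu>0 sp sq p0 eta)+
    fix e :: real assume e: "e > 0"
    have "eventually (\<lambda>T. B' / T + C * T powr (- (1/4)) + W / T < e) at_top"
      using order_tendstoD(2)[OF lim] e by simp
    then obtain T3 where T3: "\<And>T. T \<ge> T3 \<Longrightarrow> B' / T + C * T powr (- (1/4)) + W / T < e" by (auto simp: eventually_at_top_linorder)
    show "\<exists>T0. \<forall>T\<ge>T0. (\<forall>n. ln (lam n) < 2 * A * ln T \<or> 2 * A * ln T + real N * (2 * A * \<eta> / T) < ln (lam n)) \<longrightarrow>
       norm (\<Sum>n. p n * exp (\<i> * of_real (\<nu> n * T)) + q n * exp (- (\<i> * of_real (\<nu> n * T)))) \<le> e"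
    proof (rule exI[of _ "max (max T1 T2) (max T3 (4 * A * \<eta> * R))"], intro allI impI)
      fix T assume T: "T \<ge> max (max T1 T2) (max T3 (4 * A * \<eta> * R))"
        and gap: "\<forall>n. ln (lam n) < 2 * A * ln T \<or> 2 * A * ln T + real N * (2 * A * \<eta> / T) < ln (lam n)"
      have "norm (\<Sum>n. p n * exp (\<i> * of_real (\<nu> n * T)) + q n * exp (- (\<i> * of_real (\<nu> n * T)))) \<le> B' / T + C * T powr (- (1/4)) + W / T"
        using T gap by (intro bound) auto
      also have "\<dots> \<le> e" using T3[of T] T by simp
      finally show "norm (\<Sum>n. p n * exp (\<i> * of_real (\<nu> n * T)) + q n * exp (- (\<i> * of_real (\<nu> n * T)))) \<le> e" .
    qed
  qed
qed

section \<open>From bounded gaps of \<open>\<kappa>\<close> to the gaps of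
  \<open>lam\<close>\<close>

lemma powr_diff_le_tangent:
  fixes x y q :: real assumes "0 < x" "x < y" "0 < q" "q < 1"
  shows "y powr q - x powr q \<le> q * x powr (q - 1) * (y - x)"
proof -
  have "\<exists>z>x. z < y \<and> y powr q - x powr q = (y - x) * (q * z powr (q - 1))"
    using assms by (intro MVT2) (auto intro!: derivative_eq_intros)
  then obtain z where z: "z > x" "y powr q - x powr q = (y - x) * (q * z powr (q - 1))" by blast
  have "z powr (q - 1) \<le> x powr (q - 1)" using z assms by (intro powr_mono2') auto
  then have "(y - x) * (q * z powr (q - 1)) \<le> (y - x) * (q * x powr (q - 1))"
    using assms by (intro mult_left_mono) auto
  then show ?thesis using z by (simp add: mult_ac)
qed

theorem theorem3:
  fixes a b :: "nat \<Rightarrow> complex" and lam mu :: "nat \<Rightarrow> real"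
    and sigma_star :: real and d :: nat and alpha :: "nat \<Rightarrow> real"
    and beta beta' :: "nat \<Rightarrow> complex" and omega :: complex
    and F :: "complex \<Rightarrow> complex" and R :: real
  assumes a0: "a 0 \<noteq> 0" and b0: "b 0 \<noteq> 0"
    and lam_mono: "strict_mono lam" and lam_pos: "lam 0 > 0" and lam_lim: "filterlim lam at_top sequentially"
    and mu_mono: "strict_mono mu" and mu_pos: "mu 0 > 0" and mu_lim: "filterlim mu at_top sequentially"
    \<comment> \<open>(A1)\<close>
    and sigma_pos: "sigma_star > 0"
    and abs_a: "\<And>s. Re s \<ge> sigma_star \<Longrightarrow> summable (\<lambda>n. norm (a n * complex_of_real (lam n) powr (- s)))"
    and abs_b: "\<And>s. Re s \<ge> sigma_star \<Longrightarrow> summable (\<lambda>n. norm (b n * complex_of_real (mu n) powr (- s)))"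
    \<comment> \<open>(A2)\<close>
    and d_pos: "d \<ge> 1" and alpha_pos: "\<And>\<nu>. \<nu> \<in> {1..d} \<Longrightarrow> alpha \<nu> > 0"
    and omega_norm: "norm omega = 1"
    \<comment> \<open>(A2)+(A3): F is the meromorphic continuation of Delta(s) phi(s) and satisfies the functional equation\<close>
    and F_mero: "F meromorphic_on UNIV"
    and F_right: "\<And>s. Re s \<ge> sigma_star \<Longrightarrow> gamma_regular d alpha beta s \<Longrightarrow>
                    F s = gamma_factor d alpha beta s * gen_dirichlet a lam s"
    and F_left: "\<And>s. Re (1 - s) \<ge> sigma_star \<Longrightarrow> gamma_regular d alpha beta' (1 - s) \<Longrightarrow>
                    F s = omega * gamma_factor d alpha beta' (1 - s) * gen_dirichlet b mu (1 - s)"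
    \<comment> \<open>(A3)\<close>
    and R_pos: "R > 0"
    and F_sing: "\<And>z. norm z \<ge> R \<Longrightarrow> F analytic_on {z}"
    and F_decay: "\<And>bl br e. e > 0 \<Longrightarrow> \<exists>T. \<forall>\<sigma> t. bl \<le> \<sigma> \<and> \<sigma> \<le> br \<and> \<bar>t\<bar> \<ge> T \<longrightarrow>
                    norm (F (Complex \<sigma> t)) < e"
    \<comment> \<open>0 < 2A < 1\<close>
    and A_bounds: "0 < 2 * (\<Sum>\<nu>=1..d. alpha \<nu>)" "2 * (\<Sum>\<nu>=1..d. alpha \<nu>) < 1"
    \<comment> \<open>conditions (a), (b), (c)\<close>
    and cond:
      "let A = (\<Sum>\<nu>=1..d. alpha \<nu>); B = (\<Sum>\<nu>=1..d. beta \<nu>); B' = (\<Sum>\<nu>=1..d. beta' \<nu>);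
           w = complex_of_real (1 / (4 * A)) - 1 / 2 - (B - B') / complex_of_real (2 * A);
           theta = - Re w; xi = Im w;
           theta0 = 1 - theta + 1 / (2 * A);
           Phi = (\<lambda>s. F s / gamma_factor d alpha beta s)
       in (\<exists>G. G holomorphic_on UNIV \<and> (\<forall>s. Re s \<ge> sigma_star \<longrightarrow> G s = gen_dirichlet a lam s))
          \<or> (xi = 0 \<and> (\<forall>z. is_pole Phi z \<longrightarrow> z \<in> \<real>))
          \<or> (\<forall>z. is_pole Phi z \<longrightarrow> Re z < theta0)"
  shows "\<exists>C. \<exists>N. \<forall>n\<ge>N. lam (Suc n) - lam n \<le> C * lam n powr (1 - 1 / (2 * (\<Sum>\<nu>=1..d. alpha \<nu>)))"
proof -
  define A where "A = (\<Sum>\<nu>=1..d. alpha \<nu>)"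
  have A: "A > 0" "2 * A < 1" using A_bounds by (auto simp: A_def)
  have lam_p: "lam n > 0" for n
    using lam_pos strict_mono_less_eq[OF lam_mono, of 0 n] by simp
  have mu_p: "mu n > 0" for n
    using mu_pos strict_mono_less_eq[OF mu_mono, of 0 n] by simp
  obtain \<nu> :: "nat \<Rightarrow> real" and p q and N :: nat and \<eta> :: real where
    nu: "strict_mono \<nu>" "\<nu> 0 > 0" and sp: "summable (\<lambda>n. norm (p n))" "summable (\<lambda>n. norm (q n))"
    and p0: "p 0 \<noteq> 0" and eta: "\<eta> > 0"
    and small: "\<And>e. e > 0 \<Longrightarrow> \<exists>T0. \<forall>T\<ge>T0. (\<forall>n. ln (lam n) < 2 * A * ln T \<or> 2 * A * ln T + real N * (2 * A * \<eta> / T) < ln (lam n)) \<longrightarrow>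
       norm (\<Sum>n. p n * exp (\<i> * of_real (\<nu> n * T)) + q n * exp (- (\<i> * of_real (\<nu> n * T)))) \<le> e"
    using gap_exponential_sum_small[OF b0 lam_p mu_mono mu_p sigma_pos abs_a abs_b d_pos alpha_pos omega_norm F_mero F_right F_left R_pos F_sing F_decay,
      folded A_def] by blast
  define \<kappa> where "\<kappa> n = lam n powr (1 / (2 * A))" for n
  have kp: "\<kappa> n > 0" for n using lam_p[of n] by (simp add: \<kappa>_def)
  have lk: "ln (lam n) = 2 * A * ln (\<kappa> n)" for n using lam_p[of n] A by (simp add: \<kappa>_def ln_powr)
  have kl: "lam n = \<kappa> n powr (2 * A)" for n using lam_p[of n] A by (simp add: \<kappa>_def powr_powr)
  have kmono: "\<kappa> m < \<kappa> n" if "m < n" for m n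
    unfolding \<kappa>_def using lam_p[of m] A lam_mono that by (intro powr_less_mono2) (auto simp: strict_mono_def)
  have kmono': "\<kappa> m \<le> \<kappa> n" if "m \<le> n" for m n using kmono[of m n] that by (cases "m = n") auto
  have "\<exists>C N0. \<forall>n\<ge>N0. \<kappa> (Suc n) - \<kappa> n \<le> C"
  proof (rule ccontr)
    assume "\<not> ?thesis"
    then have big: "\<exists>n\<ge>N0. \<kappa> (Suc n) - \<kappa> n > C" for C N0 by (meson not_le)
    have "p 0 = 0"
    proof (rule almost_periodic_coefficient_zero[OF nu sp])
      fix L e :: real assume L: "L > 0" and e: "e > 0"
      obtain T0 where T0: "\<And>T. T \<ge> T0 \<Longrightarrow> (\<forall>n. ln (lam n) < 2 * A * ln T \<or> 2 * A * ln T + real N * (2 * A * \<eta> / T) < ln (lam n)) \<Longrightarrow>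
         norm (\<Sum>n. p n * exp (\<i> * of_real (\<nu> n * T)) + q n * exp (- (\<i> * of_real (\<nu> n * T)))) \<le> e"
        using small[OF e] by blast
      define y where "y = real N * \<eta>"
      have y0: "y \<ge> 0" using eta by (simp add: y_def)
      \<comment> \<open>Beyond \<open>T1\<close> the smallness estimate is available and y/T \<le>
        1, so that the spline reaches only up to T exp (y/T) \<le> T + 2 y.\<close>
      define T1 where "T1 = max 1 (max T0 y)"
      have "eventually (\<lambda>n. lam n \<ge> T1 powr (2 * A)) sequentially"
        using lam_lim by (auto simp: filterlim_at_top)
      then obtain N0 where N0: "\<And>n. n \<ge> N0 \<Longrightarrow> lam n \<ge> T1 powr (2 * A)" by (auto simp: eventually_sequentially)
      \<comment> \<open>The gap has to hold the window of length L and the reach 2 y of the spline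
        started at its right end; the window begins at \<kappa> n + 1 to keep T strictly above
        \<kappa> n, whence the 1.\<close>
      obtain n where n: "n \<ge> N0" "\<kappa> (Suc n) - \<kappa> n > L + 1 + 2 * y" using big by blast
      have kn: "\<kappa> n \<ge> T1"
      proof (rule ccontr)
        assume "\<not> \<kappa> n \<ge> T1"
        then have "\<kappa> n powr (2 * A) < T1 powr (2 * A)" using kp[of n] A by (intro powr_less_mono2) auto
        then show False using N0[OF n(1)] kl[of n] by simp
      qed
      show "\<exists>Y. \<forall>T\<in>{Y..Y+L}. norm (\<Sum>n. p n * exp (\<i> * of_real (\<nu> n * T)) + q n * exp (- (\<i> * of_real (\<nu> n * T)))) \<le> e"
      proof (rule exI[of _ "\<kappa> n + 1"], rule ballI)
        fix T assume "T \<in> {\<kappa> n + 1..\<kappa> n + 1 + L}"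
        then have T: "T > \<kappa> n" "T \<le> \<kappa> n + 1 + L" by auto
        have T1: "T \<ge> 1" "T \<ge> T0" "T \<ge> y" using T kn unfolding T1_def by auto
        show "norm (\<Sum>n. p n * exp (\<i> * of_real (\<nu> n * T)) + q n * exp (- (\<i> * of_real (\<nu> n * T)))) \<le> e"
        proof (rule T0[OF T1(2)], rule allI)
          fix k
          show "ln (lam k) < 2 * A * ln T \<or> 2 * A * ln T + real N * (2 * A * \<eta> / T) < ln (lam k)"
          proof (cases "k \<le> n")
            case True
            have "\<kappa> k < T" using kmono'[OF True] T by simp
            then have "ln (\<kappa> k) < ln T" using kp[of k] by simp
            then show ?thesis unfolding lk[of k] using A by simp
          next
            case False
            have x: "0 \<le> y / T" "y / T \<le> 1" using y0 T1 by auto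
            have "exp (y / T) \<le> 1 + y / T + (y / T)\<^sup>2" using x by (rule exp_bound)
            also have "(y / T)\<^sup>2 \<le> y / T" unfolding power2_eq_square using x by (intro mult_left_le) auto
            finally have "exp (y / T) \<le> 1 + 2 * (y / T)" by simp
            then have "T * exp (y / T) \<le> T * (1 + 2 * (y / T))" using T1 by (intro mult_left_mono) auto
            also have "\<dots> = T + 2 * y" using T1 by (simp add: algebra_simps)
            also have "\<dots> < \<kappa> (Suc n)" using T n(2) by simp
            also have "\<dots> \<le> \<kappa> k" using False by (intro kmono') simp
            finally have "T * exp (y / T) < \<kappa> k" .
            then have "ln (T * exp (y / T)) < ln (\<kappa> k)" using T1 kp[of k] by (subst ln_less_cancel_iff) auto
            then have "ln T + y / T < ln (\<kappa> k)" using T1 by (simp add: ln_mult)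
            then have "2 * A * (ln T + y / T) < 2 * A * ln (\<kappa> k)" using A by simp
            then show ?thesis unfolding lk[of k] y_def by (simp add: algebra_simps)
          qed
        qed
      qed
    qed
    then show False using p0 by simp
  qed
  then obtain C N0 where C: "\<And>n. n \<ge> N0 \<Longrightarrow> \<kappa> (Suc n) - \<kappa> n \<le> C" by blast
  show ?thesis
  \<comment> \<open>2 A is the exponent that comes down in the tangent inequality, and the remaining
    power of \<kappa> n is lam n to the power (2 A - 1)/(2 A) = 1 - 1/(2 A).\<close>
  proof (rule exI[of _ "2 * A * C"], rule exI[of _ N0], intro allI impI)
    fix n assume n: "n \<ge> N0"
    have "lam (Suc n) - lam n = \<kappa> (Suc n) powr (2 * A) - \<kappa> n powr (2 * A)" by (simp only: kl)
    also have "\<dots> \<le> 2 * A * \<kappa> n powr (2 * A - 1) * (\<kappa> (Suc n) - \<kappa> n)"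
      using A kp kmono by (intro powr_diff_le_tangent) auto
    also have "\<dots> \<le> 2 * A * \<kappa> n powr (2 * A - 1) * C" using A C[OF n] by (intro mult_left_mono) auto
    also have "\<kappa> n powr (2 * A - 1) = lam n powr (1 - 1 / (2 * A))"
      unfolding \<kappa>_def powr_powr using A by (intro arg_cong[of _ _ "\<lambda>x. lam n powr x"]) (simp add: field_simps)
    finally show "lam (Suc n) - lam n \<le> 2 * A * C * lam n powr (1 - 1 / (2 * (\<Sum>\<nu>=1..d. alpha \<nu>)))"
      unfolding A_def[symmetric] by (simp add: mult_ac)
  qed
qed

end
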